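(* Let $p\ge5$, $A$ a finite étale cubic $\mathbb Z_p$-algebra, $\overline A=A/pA$, $\eta\in A^\times$, $\gamma\in A$, $c\in\mathbb Z_p$, $P$ the order of $\bar\eta$ in $\overline A^\times$, $\eta^P=1+pU$, $\omega=\bar U$. Assume $\omega$ generates $\overline A$ (so $1,\omega,\omega^2$ is an $\mathbb F_p$-basis), let $f_\omega(T)=T^3+\alpha T^2+\beta T+\delta_0$ be the characteristic polynomial of multiplication by $\omega$, and assume $\omega\in\overline A^\times$, i.e. $\operatorname{Norm}(\omega)=-\delta_0\ne0$. Fix $a\in\{0,\dots,P-1\}$, put $y_a=\gamma\eta^a$, $C_m=\operatorname{Tr}_A(y_aU^m)$, $F_{a,c}(t)=\operatorname{Tr}_A(y_a(\eta^P)^t)-c$. Let $z_0,z_1,z_2$ be the trace-dual basis to $1,\omega,\omega^2$ and suppose $x_a=\bar y_a=sz_0$ with $s=\bar c\ne0$. Then $\operatorname{Tr}(x_a\omega)=0$, $\operatorname{Tr}(x_a\omega^2)=0$ and $\operatorname{Tr}(x_a\omega^3)=s\operatorname{Norm}(\omega)\ne0$. If moreover $C_0-c\in p^3\mathbb Z_p$, $C_1\in p^2\mathbb Z_p$ and $C_2\in p\mathbb Z_p$, then $F_{a,c}(X)\in p^3\mathbb Z_p\langle X\rangle$ (also after any integral shift of $X$) and \[ \frac{F_{a,c}(X)}{p^3}\equiv A^{(3)}+B^{(3)}X+D^{(3)}\binom X2+s\operatorname{Norm}(\omega)\binom X3\pmod p, \] with $A^{(3)}\equiv(C_0-c)/p^3$,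 $B^{(3)}\equiv C_1/p^2$, $D^{(3)}\equiv C_2/p\pmod p$. Consequently the first digits of lifts of this class to precision $p^4$ are exactly the roots in $\mathbb F_p$ of $R_{a,c}(X)=A^{(3)}+B^{(3)}X+D^{(3)}\binom X2+s\operatorname{Norm}(\omega)\binom X3$. A simple root gives one simple Hensel branch with $v_p(F_{a,c}(t))=3+v_p(t-\tau)$ in the corresponding residue disk. If $r$ is a root of multiplicity $e\ge2$ with least representative $\tilde r$, then $G_r(Y)=p^{-3}F_{a,c}(\tilde r+Y)\in\mathbb Z_p\langle Y\rangle$ has reduction $R_{a,c}(\tilde r+Y)=Y^eQ(Y)$ with $Q(0)\ne0$, and $G_r$ has a unique local factor whose reduction is a unit times $Y^e$; the zeros of $F_{a,c}$ in $t\in\tilde r+p\mathbb Z_p$ are exactly the zeros of this local factor with $Y\in p\mathbb Z_p$.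
   Context: $(\eta^P)^t$ is the convergent binomial series, so $F_{a,c}$ is a restricted power series in $\mathbb Z_p\langle X\rangle$. Traces and norms on $\overline A$ are over $\mathbb F_p$. The trace-dual basis satisfies $\operatorname{Tr}(\omega^iz_j)=\delta_{ij}$ for $0\le i,j\le2$. *)

theory Defs
  imports
    "HOL-Library.Extended_Nat"
    "HOL-Computational_Algebra.Polynomial_FPS"
    "Berlekamp_Zassenhaus.Finite_Field"
    "Jordan_Normal_Form.Char_Poly"
begin

section \<open>The ring of p-adic integers\<close>

text \<open>
  The prime is \<open>p = CARD('p)\<close>, so that \<open>'p mod_ring\<close> is the field with \<open>p\<close> elements.
  A \<open>p\<close>-adic integer is a compatible sequence of residues modulo \<open>p ^ n\<close>.
\<close>

typedef (overloaded) ('p::prime_card) padic_int =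
  "{x :: nat \<Rightarrow> int. \<forall>n. x n \<in> {0..<int CARD('p) ^ n} \<and> x (Suc n) mod int CARD('p) ^ n = x n}"
  by (rule exI[of _ "\<lambda>_. 0"]) (auto simp: prime_card_int)

setup_lifting type_definition_padic_int

lift_definition padic_trunc :: "'p::prime_card padic_int \<Rightarrow> nat \<Rightarrow> int" is "\<lambda>x. x" .

lemma card_pos_int: "int CARD('p::prime_card) > 0"
  by (simp add: finite_UNIV_card_ge_0)

lemma prime_card_int': "prime (int CARD('p::prime_card))"
  by (simp add: prime_card)

lemma mod_power_Suc_mod: "(a mod (q::int) ^ Suc n) mod q ^ n = a mod q ^ n"
  by (simp add: mod_mod_cancel)

instantiation padic_int :: (prime_card) comm_ring_1
begin

lift_definition zero_padic_int :: "'a padic_int" is "\<lambda>_. 0"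
  using card_pos_int[where 'p = 'a] by auto

lift_definition one_padic_int :: "'a padic_int" is "\<lambda>n. 1 mod int CARD('a) ^ n"
  using card_pos_int[where 'p = 'a] by (auto simp: mod_power_Suc_mod simp del: power_Suc)

lift_definition plus_padic_int :: "'a padic_int \<Rightarrow> 'a padic_int \<Rightarrow> 'a padic_int"
  is "\<lambda>x y n. (x n + y n) mod int CARD('a) ^ n"
proof -
  fix x y :: "nat \<Rightarrow> int" and n
  assume "\<And>n. x n \<in> {0..<int CARD('a) ^ n} \<and> x (Suc n) mod int CARD('a) ^ n = x n"
    and "\<And>n. y n \<in> {0..<int CARD('a) ^ n} \<and> y (Suc n) mod int CARD('a) ^ n = y n"
  hence "(x (Suc n) + y (Suc n)) mod int CARD('a) ^ n = (x n + y n) mod int CARD('a) ^ n"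
    using mod_add_eq[of "x (Suc n)" "int CARD('a) ^ n" "y (Suc n)"] by simp
  thus "(x n + y n) mod int CARD('a) ^ n \<in> {0..<int CARD('a) ^ n} \<and>
      (x (Suc n) + y (Suc n)) mod int CARD('a) ^ Suc n mod int CARD('a) ^ n
        = (x n + y n) mod int CARD('a) ^ n"
    using card_pos_int[where 'p = 'a] by (simp add: mod_power_Suc_mod del: power_Suc)
qed

lift_definition minus_padic_int :: "'a padic_int \<Rightarrow> 'a padic_int \<Rightarrow> 'a padic_int"
  is "\<lambda>x y n. (x n - y n) mod int CARD('a) ^ n"
proof -
  fix x y :: "nat \<Rightarrow> int" and n
  assume "\<And>n. x n \<in> {0..<int CARD('a) ^ n} \<and> x (Suc n) mod int CARD('a) ^ n = x n"
    and "\<And>n. y n \<in> {0..<int CARD('a) ^ n} \<and> y (Suc n) mod int CARD('a) ^ n = y n"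
  hence "(x (Suc n) - y (Suc n)) mod int CARD('a) ^ n = (x n - y n) mod int CARD('a) ^ n"
    using mod_diff_eq[of "x (Suc n)" "int CARD('a) ^ n" "y (Suc n)"] by simp
  thus "(x n - y n) mod int CARD('a) ^ n \<in> {0..<int CARD('a) ^ n} \<and>
      (x (Suc n) - y (Suc n)) mod int CARD('a) ^ Suc n mod int CARD('a) ^ n
        = (x n - y n) mod int CARD('a) ^ n"
    using card_pos_int[where 'p = 'a] by (simp add: mod_power_Suc_mod del: power_Suc)
qed

lift_definition uminus_padic_int :: "'a padic_int \<Rightarrow> 'a padic_int"
  is "\<lambda>x n. (- x n) mod int CARD('a) ^ n"
proof -
  fix x :: "nat \<Rightarrow> int" and n
  assume "\<And>n. x n \<in> {0..<int CARD('a) ^ n} \<and> x (Suc n) mod int CARD('a) ^ n = x n"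
  hence "(- x (Suc n)) mod int CARD('a) ^ n = (- x n) mod int CARD('a) ^ n"
    using mod_minus_eq[of "x (Suc n)" "int CARD('a) ^ n"] by simp
  thus "(- x n) mod int CARD('a) ^ n \<in> {0..<int CARD('a) ^ n} \<and>
      (- x (Suc n)) mod int CARD('a) ^ Suc n mod int CARD('a) ^ n
        = (- x n) mod int CARD('a) ^ n"
    using card_pos_int[where 'p = 'a] by (simp add: mod_power_Suc_mod del: power_Suc)
qed

lift_definition times_padic_int :: "'a padic_int \<Rightarrow> 'a padic_int \<Rightarrow> 'a padic_int"
  is "\<lambda>x y n. (x n * y n) mod int CARD('a) ^ n"
proof -
  fix x y :: "nat \<Rightarrow> int" and n
  assume "\<And>n. x n \<in> {0..<int CARD('a) ^ n} \<and> x (Suc n) mod int CARD('a) ^ n = x n"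
    and "\<And>n. y n \<in> {0..<int CARD('a) ^ n} \<and> y (Suc n) mod int CARD('a) ^ n = y n"
  hence "(x (Suc n) * y (Suc n)) mod int CARD('a) ^ n = (x n * y n) mod int CARD('a) ^ n"
    using mod_mult_eq[of "x (Suc n)" "int CARD('a) ^ n" "y (Suc n)"] by simp
  thus "(x n * y n) mod int CARD('a) ^ n \<in> {0..<int CARD('a) ^ n} \<and>
      (x (Suc n) * y (Suc n)) mod int CARD('a) ^ Suc n mod int CARD('a) ^ n
        = (x n * y n) mod int CARD('a) ^ n"
    using card_pos_int[where 'p = 'a] by (simp add: mod_power_Suc_mod del: power_Suc)
qed

instance
proof
  fix a b c :: "'a padic_int"
  show "a * b * c = a * (b * c)"
    by transfer (simp add: mod_mult_left_eq mod_mult_right_eq mult.assoc)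
  show "a * b = b * a"
    by transfer (simp add: mult.commute)
  show "1 * a = a"
    by transfer (simp add: mod_mult_left_eq fun_eq_iff)
  show "a + b + c = a + (b + c)"
    by transfer (simp add: mod_add_left_eq mod_add_right_eq add.assoc)
  show "a + b = b + a"
    by transfer (simp add: add.commute)
  show "0 + a = a"
    by transfer (simp add: fun_eq_iff)
  show "- a + a = 0"
    by transfer (simp add: mod_add_left_eq)
  show "a - b = a + - b"
    by transfer (simp add: mod_add_right_eq)
  show "(a + b) * c = a * c + b * c"
    by transfer (simp add: mod_mult_left_eq mod_add_eq distrib_right)
  show "(0 :: 'a padic_int) \<noteq> 1"
  proof
    assume "(0 :: 'a padic_int) = 1"
    hence "padic_trunc (0 :: 'a padic_int) 1 = padic_trunc (1 :: 'a padic_int) 1" by simp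
    thus False
      using prime_gt_1_int[OF prime_card_int'[where 'p = 'a]] by transfer simp
  qed
qed

end

lemma padic_int_eq_iff: "x = y \<longleftrightarrow> (\<forall>n. padic_trunc x n = padic_trunc y n)"
  by transfer auto

lemma padic_trunc_0: "padic_trunc 0 n = 0"
  by transfer simp

lemma padic_trunc_1: "padic_trunc (1 :: 'p::prime_card padic_int) n = 1 mod int CARD('p) ^ n"
  by transfer simp

lemma padic_trunc_add:
  "padic_trunc (x + y) n
     = (padic_trunc x n + padic_trunc y n) mod int CARD('p) ^ n"
  for x y :: "'p::prime_card padic_int"
  by transfer simp

lemma padic_trunc_mult:
  "padic_trunc (x * y) n
     = (padic_trunc x n * padic_trunc y n) mod int CARD('p) ^ n"
  for x y :: "'p::prime_card padic_int"
  by transfer simp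

lemma padic_trunc_mod:
  assumes "m \<le> n"
  shows "padic_trunc x n mod int CARD('p) ^ m = padic_trunc (x :: 'p::prime_card padic_int) m"
  using assms
proof (induction n rule: dec_induct)
  case base
  show ?case by transfer auto
next
  case (step n)
  have "padic_trunc x (Suc n) mod int CARD('p) ^ m
      = padic_trunc x (Suc n) mod int CARD('p) ^ n mod int CARD('p) ^ m"
    using step.hyps by (simp add: mod_mod_cancel le_imp_power_dvd)
  also have "padic_trunc x (Suc n) mod int CARD('p) ^ n = padic_trunc x n"
    by transfer auto
  finally show ?case using step.IH by simp
qed

lemma padic_trunc_of_nat: "padic_trunc (of_nat k :: 'p::prime_card padic_int) n
    = int k mod int CARD('p) ^ n"
proof (induction k)
  case 0
  show ?case by (simp add: padic_trunc_0)
next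
  case (Suc k)
  have "padic_trunc (of_nat (Suc k) :: 'p padic_int) n
      = (1 mod int CARD('p) ^ n + int k mod int CARD('p) ^ n) mod int CARD('p) ^ n"
    by (simp only: of_nat_Suc padic_trunc_add padic_trunc_1 Suc)
  thus ?case by (simp only: mod_add_eq of_nat_Suc)
qed

instance padic_int :: (prime_card) idom
proof
  fix a b :: "'a padic_int"
  assume a: "a \<noteq> 0" and b: "b \<noteq> 0"
  let ?p = "int CARD('a)"
  obtain m n where m: "padic_trunc a m \<noteq> 0" and n: "padic_trunc b n \<noteq> 0"
    using a b unfolding padic_int_eq_iff padic_trunc_0 by auto
  have am: "\<not> ?p ^ m dvd padic_trunc a (m + n)"
    using padic_trunc_mod[of m "m + n" a] m by (auto simp: dvd_eq_mod_eq_0)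
  have bn: "\<not> ?p ^ n dvd padic_trunc b (m + n)"
    using padic_trunc_mod[of n "m + n" b] n by (auto simp: dvd_eq_mod_eq_0)
  have "\<not> ?p ^ (m + n) dvd padic_trunc a (m + n) * padic_trunc b (m + n)"
  proof
    assume dvd: "?p ^ (m + n) dvd padic_trunc a (m + n) * padic_trunc b (m + n)"
    have nz: "padic_trunc a (m + n) \<noteq> 0" "padic_trunc b (m + n) \<noteq> 0" using am bn by auto
    have pr: "prime_elem ?p" using prime_card_int'[where 'p = 'a] by auto
    have "m + n \<le> multiplicity ?p (padic_trunc a (m + n) * padic_trunc b (m + n))"
      using dvd nz pr by (intro multiplicity_geI) (auto simp: prime_elem_def)
    also have "\<dots> = multiplicity ?p (padic_trunc a (m + n))
        + multiplicity ?p (padic_trunc b (m + n))"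
      using nz pr by (intro prime_elem_multiplicity_mult_distrib)
    finally have "m \<le> multiplicity ?p (padic_trunc a (m + n))
        \<or> n \<le> multiplicity ?p (padic_trunc b (m + n))" by linarith
    thus False using am bn by (auto dest: multiplicity_dvd')
  qed
  hence "padic_trunc (a * b) (m + n) \<noteq> 0"
    by (auto simp: padic_trunc_mult dvd_eq_mod_eq_0)
  thus "a * b \<noteq> 0" by (auto simp: padic_trunc_0)
qed

instance padic_int :: (prime_card) ring_char_0
proof
  show "inj (of_nat :: nat \<Rightarrow> 'a padic_int)"
  proof (rule injI)
    fix k l assume eq: "of_nat k = (of_nat l :: 'a padic_int)"
    let ?p = "int CARD('a)"
    have *: "int j < ?p ^ (k + l)" if "j \<le> k + l" for j
    proof -
      have "k + l < CARD('a) ^ (k + l)"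
        using prime_gt_1_nat[OF prime_card[where 'a = 'a]] by (intro power_gt_expt) auto
      hence "j < CARD('a) ^ (k + l)" using that by linarith
      thus ?thesis unfolding of_nat_power[symmetric] by (simp only: of_nat_less_iff)
    qed
    have "int k mod ?p ^ (k + l) = int l mod ?p ^ (k + l)"
      using arg_cong[OF eq, of "\<lambda>x. padic_trunc x (k + l)"] by (simp add: padic_trunc_of_nat)
    thus "k = l" using *[of k] *[of l] by simp
  qed
qed

instantiation padic_int :: (prime_card) idom_divide
begin

definition divide_padic_int :: "'a padic_int \<Rightarrow> 'a padic_int \<Rightarrow> 'a padic_int" where
  "divide_padic_int x y = (if y \<noteq> 0 \<and> y dvd x then THE z. x = y * z else 0)"

instance
proof
  fix a b :: "'a padic_int"
  show "a * b div b = a" if "b \<noteq> 0"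
    using that unfolding divide_padic_int_def by (auto simp: mult.commute)
  show "a div 0 = 0" unfolding divide_padic_int_def by simp
qed

end

definition padic_val :: "'p::prime_card padic_int \<Rightarrow> enat" where
  "padic_val x = Sup {enat n | n. of_nat CARD('p) ^ n dvd x}"

definition padic_residue :: "'p::prime_card padic_int \<Rightarrow> 'p mod_ring" where
  "padic_residue x = of_int_mod_ring (padic_trunc x 1)"

definition least_rep :: "'p::prime_card mod_ring \<Rightarrow> 'p padic_int" where
  "least_rep r = of_int (to_int_mod_ring r)"


section \<open>Reduction modulo p\<close>

text \<open>
  \<open>('p, 'a) modp\<close> is the quotient ring \<open>A/pA\<close> of \<open>A = 'a\<close> by the ideal generated by
  \<open>p = CARD('p)\<close>. Since \<open>comm_ring_1\<close> excludes the zero ring, the relation is the equality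
  in the degenerate case where \<open>p\<close> is a unit of \<open>A\<close>. That case does not occur for a
  free \<open>p\<close>-adic algebra of positive rank.
\<close>

definition modp_rel :: "'p::prime_card itself \<Rightarrow> 'a::comm_ring_1 \<Rightarrow> 'a \<Rightarrow> bool" where
  "modp_rel _ x y \<longleftrightarrow>
     (if of_nat CARD('p) dvd (1::'a) then x = y else of_nat CARD('p) dvd x - y)"

lemma modp_rel_equivp: "equivp (modp_rel TYPE('p::prime_card) :: 'a::comm_ring_1 \<Rightarrow> _)"
proof (rule equivpI)
  show "reflp (modp_rel TYPE('p) :: 'a \<Rightarrow> _)"
    by (rule reflpI) (simp add: modp_rel_def)
  show "symp (modp_rel TYPE('p) :: 'a \<Rightarrow> _)"
  proof (rule sympI)
    fix x y :: 'a
    assume "modp_rel TYPE('p) x y"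
    thus "modp_rel TYPE('p) y x"
      using dvd_minus_iff[of "of_nat CARD('p)" "x - y"]
      by (auto simp: modp_rel_def split: if_splits)
  qed
  show "transp (modp_rel TYPE('p) :: 'a \<Rightarrow> _)"
  proof (rule transpI)
    fix x y z :: 'a
    assume "modp_rel TYPE('p) x y" "modp_rel TYPE('p) y z"
    thus "modp_rel TYPE('p) x z"
      using dvd_add[of "of_nat CARD('p)" "x - y" "y - z"]
      by (auto simp: modp_rel_def split: if_splits)
  qed
qed

quotient_type (overloaded) ('p, 'a) modp =
  "'a::comm_ring_1" / "modp_rel TYPE('p::prime_card) :: 'a \<Rightarrow> 'a \<Rightarrow> bool"
  by (rule modp_rel_equivp)

instantiation modp :: (prime_card, comm_ring_1) comm_ring_1
begin

lift_definition zero_modp :: "('a, 'b) modp" is 0 .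
lift_definition one_modp :: "('a, 'b) modp" is 1 .

lift_definition plus_modp :: "('a, 'b) modp \<Rightarrow> ('a, 'b) modp \<Rightarrow> ('a, 'b) modp" is "(+)"
proof -
  fix w x y z :: 'b
  assume "modp_rel TYPE('a) w x" "modp_rel TYPE('a) y z"
  thus "modp_rel TYPE('a) (w + y) (x + z)"
    using dvd_add[of "of_nat CARD('a)" "w - x" "y - z"]
    by (auto simp: modp_rel_def algebra_simps split: if_splits)
qed

lift_definition minus_modp :: "('a, 'b) modp \<Rightarrow> ('a, 'b) modp \<Rightarrow> ('a, 'b) modp" is "(-)"
proof -
  fix w x y z :: 'b
  assume "modp_rel TYPE('a) w x" "modp_rel TYPE('a) y z"
  thus "modp_rel TYPE('a) (w - y) (x - z)"
    using dvd_diff[of "of_nat CARD('a)" "w - x" "y - z"]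
    by (auto simp: modp_rel_def algebra_simps split: if_splits)
qed

lift_definition uminus_modp :: "('a, 'b) modp \<Rightarrow> ('a, 'b) modp" is uminus
proof -
  fix x y :: 'b
  assume "modp_rel TYPE('a) x y"
  thus "modp_rel TYPE('a) (- x) (- y)"
    using dvd_minus_iff[of "of_nat CARD('a)" "x - y"]
    by (auto simp: modp_rel_def split: if_splits)
qed

lift_definition times_modp :: "('a, 'b) modp \<Rightarrow> ('a, 'b) modp \<Rightarrow> ('a, 'b) modp" is "(*)"
proof -
  fix w x y z :: 'b
  assume *: "modp_rel TYPE('a) w x" "modp_rel TYPE('a) y z"
  have "w * y - x * z = (w - x) * y + x * (y - z)" by (simp add: algebra_simps)
  thus "modp_rel TYPE('a) (w * y) (x * z)"
    using * by (auto simp: modp_rel_def split: if_splits intro!: dvd_add)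
qed

instance
proof
  fix a b c :: "('a, 'b) modp"
  note refl = equivp_reflp[OF modp_rel_equivp]
  show "a * b * c = a * (b * c)" by transfer (simp add: mult.assoc refl)
  show "a * b = b * a" by transfer (simp add: mult.commute refl)
  show "1 * a = a" by transfer (simp add: refl)
  show "a + b + c = a + (b + c)" by transfer (simp add: add.assoc refl)
  show "a + b = b + a" by transfer (simp add: add.commute refl)
  show "0 + a = a" by transfer (simp add: refl)
  show "- a + a = 0" by transfer (simp add: refl)
  show "a - b = a + - b" by transfer (simp add: refl)
  show "(a + b) * c = a * c + b * c" by transfer (simp add: distrib_right refl)
  show "(0 :: ('a, 'b) modp) \<noteq> 1"
    by transfer (simp add: modp_rel_def)
qed

end

lift_definition reduce :: "'a::comm_ring_1 \<Rightarrow> ('p::prime_card, 'a) modp" is "\<lambda>x. x" .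

text \<open>The structure map of the algebra \<open>A/pA\<close> over the field with \<open>p\<close> elements.\<close>

definition of_fp :: "'p::prime_card mod_ring \<Rightarrow> ('p, 'a::comm_ring_1) modp" where
  "of_fp k = of_int (to_int_mod_ring k)"


section \<open>Finite free algebras, trace and norm\<close>

text \<open>An algebra \<open>'a\<close> over \<open>'r\<close> is given by its structure map \<open>\<phi>\<close>.\<close>

definition alg_basis :: "('r::comm_ring_1 \<Rightarrow> 'a::comm_ring_1) \<Rightarrow> 'a list \<Rightarrow> bool" where
  "alg_basis \<phi> es \<longleftrightarrow>
     (\<forall>x. \<exists>!v. v \<in> carrier_vec (length es) \<and> x = (\<Sum>i<length es. \<phi> (v $ i) * es ! i))"

definition alg_coords ::
  "('r::comm_ring_1 \<Rightarrow> 'a::comm_ring_1) \<Rightarrow> 'a list \<Rightarrow> 'a \<Rightarrow> 'r vec" where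
  "alg_coords \<phi> es x =
     (THE v. v \<in> carrier_vec (length es) \<and> x = (\<Sum>i<length es. \<phi> (v $ i) * es ! i))"

text \<open>
  The matrix of multiplication by \<open>x\<close> in some basis; its trace, determinant and
  characteristic polynomial do not depend on the choice of the basis.
\<close>

definition mult_matrix :: "('r::comm_ring_1 \<Rightarrow> 'a::comm_ring_1) \<Rightarrow> 'a \<Rightarrow> 'r mat" where
  "mult_matrix \<phi> x =
     (let es = SOME es. alg_basis \<phi> es
      in mat (length es) (length es) (\<lambda>(i, j). alg_coords \<phi> es (x * es ! j) $ i))"

definition alg_trace :: "('r::comm_ring_1 \<Rightarrow> 'a::comm_ring_1) \<Rightarrow> 'a \<Rightarrow> 'r" where
  "alg_trace \<phi> x = (\<Sum>i<dim_row (mult_matrix \<phi> x). mult_matrix \<phi> x $$ (i, i))"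

definition alg_norm :: "('r::comm_ring_1 \<Rightarrow> 'a::comm_ring_1) \<Rightarrow> 'a \<Rightarrow> 'r" where
  "alg_norm \<phi> x = det (mult_matrix \<phi> x)"

definition alg_char_poly :: "('r::comm_ring_1 \<Rightarrow> 'a::comm_ring_1) \<Rightarrow> 'a \<Rightarrow> 'r poly" where
  "alg_char_poly \<phi> x = char_poly (mult_matrix \<phi> x)"

text \<open>
  Finite etale algebras of rank \<open>n\<close> over a ring all of whose finite projective modules are
  free (such as the \<open>p\<close>-adic integers): free of rank \<open>n\<close> as a module, and the trace pairing is
  perfect, i.e. \<open>a \<mapsto> (x \<mapsto> Tr (a x))\<close> is a bijection onto the module of linear forms.
\<close>

definition finite_etale :: "nat \<Rightarrow> ('r::comm_ring_1 \<Rightarrow> 'a::comm_ring_1) \<Rightarrow> bool" where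
  "finite_etale n \<phi> \<longleftrightarrow>
     comm_ring_hom \<phi> \<and>
     (\<exists>es. length es = n \<and> alg_basis \<phi> es) \<and>
     (\<forall>l :: 'a \<Rightarrow> 'r.
        (\<forall>x y. l (x + y) = l x + l y) \<and> (\<forall>k x. l (\<phi> k * x) = k * l x) \<longrightarrow>
        (\<exists>!a. \<forall>x. l x = alg_trace \<phi> (a * x)))"

definition generates_algebra :: "('r::comm_ring_1 \<Rightarrow> 'a::comm_ring_1) \<Rightarrow> 'a \<Rightarrow> bool" where
  "generates_algebra \<phi> x \<longleftrightarrow> (\<forall>y. \<exists>q. y = poly (map_poly \<phi> q) x)"

definition mult_order :: "'a::comm_ring_1 \<Rightarrow> nat" where
  "mult_order x = (LEAST n. n > 0 \<and> x ^ n = 1)"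


section \<open>Adic series and restricted power series\<close>

definition adic_sums :: "'a::comm_ring_1 \<Rightarrow> (nat \<Rightarrow> 'a) \<Rightarrow> 'a \<Rightarrow> bool" where
  "adic_sums q f l \<longleftrightarrow> (\<forall>N. \<exists>K. \<forall>k\<ge>K. q ^ N dvd (\<Sum>i<k. f i) - l)"

definition adic_suminf :: "'a::comm_ring_1 \<Rightarrow> (nat \<Rightarrow> 'a) \<Rightarrow> 'a" where
  "adic_suminf q f = (THE l. adic_sums q f l)"

definition restricted_fps :: "'p::prime_card padic_int fps set" where
  "restricted_fps = {f. \<forall>N. \<exists>K. \<forall>n\<ge>K. of_nat CARD('p) ^ N dvd fps_nth f n}"

definition rps_eval :: "'p::prime_card padic_int fps \<Rightarrow> 'p padic_int \<Rightarrow> 'p padic_int" where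
  "rps_eval f t = adic_suminf (of_nat CARD('p)) (\<lambda>n. fps_nth f n * t ^ n)"

text \<open>\<open>f(u + X)\<close> for a restricted power series \<open>f\<close>, expanded in powers of \<open>X\<close>.\<close>

definition rps_shift ::
  "'p::prime_card padic_int \<Rightarrow> 'p padic_int fps \<Rightarrow> 'p padic_int fps" where
  "rps_shift u f = Abs_fps (\<lambda>n. adic_suminf (of_nat CARD('p))
     (\<lambda>k. of_nat ((n + k) choose n) * fps_nth f (n + k) * u ^ k))"

definition rps_residue :: "'p::prime_card padic_int fps \<Rightarrow> 'p mod_ring fps" where
  "rps_residue f = Abs_fps (\<lambda>n. padic_residue (fps_nth f n))"

definition rps_unit :: "'p::prime_card padic_int fps \<Rightarrow> bool" where
  "rps_unit f \<longleftrightarrow> f \<in> restricted_fps \<and> (\<exists>g\<in>restricted_fps. f * g = 1)"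

text \<open>
  Factors of \<open>G\<close> in the ring of restricted power series whose reduction is a unit (of the
  polynomial ring over the residue field) times \<open>Y ^ e\<close>.
\<close>

definition local_factor ::
  "nat \<Rightarrow> 'p::prime_card padic_int fps \<Rightarrow> 'p padic_int fps \<Rightarrow> bool" where
  "local_factor e G H \<longleftrightarrow>
     H \<in> restricted_fps \<and> (\<exists>V\<in>restricted_fps. G = H * V) \<and>
     (\<exists>u. u dvd 1 \<and> rps_residue H = fps_of_poly (u * [:0, 1:] ^ e))"


section \<open>Binomial series\<close>

text \<open>The division is exact: binomial coefficients of \<open>p\<close>-adic integers are \<open>p\<close>-adic integers.\<close>

definition padic_binomial :: "'p::prime_card padic_int \<Rightarrow> nat \<Rightarrow> 'p padic_int" where
  "padic_binomial t k = (\<Prod>i<k. t - of_nat i) div fact k"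

text \<open>\<open>w ^ t = (\<Sum>k. (t choose k) * (w - 1) ^ k)\<close> for \<open>w \<in> 1 + p A\<close> and a \<open>p\<close>-adic integer \<open>t\<close>.\<close>

definition padic_power ::
  "('p::prime_card padic_int \<Rightarrow> 'a::comm_ring_1) \<Rightarrow> 'a \<Rightarrow> 'p padic_int \<Rightarrow> 'a" where
  "padic_power \<phi> w t =
     adic_suminf (of_nat CARD('p)) (\<lambda>k. \<phi> (padic_binomial t k) * (w - 1) ^ k)"

text \<open>
  The polynomial \<open>p ^ k * (X choose k)\<close>; since \<open>k!\<close> divides \<open>p ^ k\<close>
  in the \<open>p\<close>-adic integers, the division is exact.
\<close>

definition scaled_binomial_poly :: "nat \<Rightarrow> 'p::prime_card padic_int poly" where
  "scaled_binomial_poly k =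
     Polynomial.smult (of_nat CARD('p) ^ k div fact k) (\<Prod>i<k. [:- of_nat i, 1:])"

text \<open>\<open>(1 + p U) ^ X\<close>, the binomial series rearranged in powers of the variable \<open>X\<close>.\<close>

definition padic_power_fps ::
  "('p::prime_card padic_int \<Rightarrow> 'a::comm_ring_1) \<Rightarrow> 'a \<Rightarrow> 'a fps" where
  "padic_power_fps \<phi> U = Abs_fps (\<lambda>n. adic_suminf (of_nat CARD('p))
     (\<lambda>k. \<phi> (poly.coeff (scaled_binomial_poly k) n) * U ^ k))"

text \<open>The function \<open>F(t) = Tr(y w ^ t) - c\<close>, and its power series for \<open>w = 1 + p U\<close>.\<close>

definition trace_fun ::
  "('p::prime_card padic_int \<Rightarrow> 'a::comm_ring_1) \<Rightarrow> 'a \<Rightarrow> 'a \<Rightarrow> 'p padic_int \<Rightarrow>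
     'p padic_int \<Rightarrow> 'p padic_int" where
  "trace_fun \<phi> y w c t = alg_trace \<phi> (y * padic_power \<phi> w t) - c"

definition trace_fps ::
  "('p::prime_card padic_int \<Rightarrow> 'a::comm_ring_1) \<Rightarrow> 'a \<Rightarrow> 'a \<Rightarrow> 'p padic_int \<Rightarrow>
     'p padic_int fps" where
  "trace_fps \<phi> y U c =
     Abs_fps (\<lambda>n. alg_trace \<phi> (y * fps_nth (padic_power_fps \<phi> U) n)) - fps_const c"

definition binomial_poly :: "nat \<Rightarrow> 'k::field poly" where
  "binomial_poly k = Polynomial.smult (inverse (of_nat (fact k))) (\<Prod>i<k. [:- of_nat i, 1:])"

end

theory Submission
  imports Defs
begin

text \<open>
  Expanding the binomial series, \<open>F(X) = Tr(y) - c + (\<Sum>k>0. p ^ k / k! * Tr(y U ^ k) * X (X - 1) \<dots> (X - k + 1))\<close>.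
  Since \<open>4 * v\<^sub>p(k!) < k\<close> for \<open>p \<ge> 5\<close>, all terms with \<open>k \<ge> 4\<close> vanish modulo \<open>p ^ 4\<close>, so that
  the divisibility of the first three traces makes \<open>F / p ^ 3\<close> an integral series whose reduction is
  a cubic polynomial. Its leading coefficient is \<open>Tr(x \<omega> ^ 3) / 6\<close>, where the dual basis extracts from
  \<open>\<omega> ^ 3\<close> the constant coefficient in the basis \<open>1, \<omega>, \<omega> ^ 2\<close>, i.e. the determinant of a companion
  matrix. At a root of multiplicity \<open>e\<close> of the cubic, Hensel's lemma splits off a monic polynomial
  of degree \<open>e\<close> with a cofactor that has no zeros in the residue disk. The simple roots are the
  case \<open>e = 1\<close>.
\<close>

section \<open>The p-adic integers\<close>

text \<open>Two objects carry the function: the series \<open>trace_fps\<close>, rearranged in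
  powers of X, and the map \<open>trace_fun\<close>, summed anew for each argument. Instead of
  justifying the rearrangement of a double series, both are compared modulo every power of p with
  the same polynomial partial sums. The bound on the factorials is only just sufficient: the
  resulting lower bound \<open>k - (k - 1) div 4\<close> for the valuation of p^k / k! never
  decreases, but it equals 4 at k = 4 and still at k = 5. A further obstacle is that trace, norm and
  characteristic polynomial are defined through an arbitrarily chosen basis of unknown length.
  Independence of the basis is therefore proved before traces can be reduced modulo p and before the
  powers of \<omega> can serve as a basis.\<close>

abbreviation padic_prime :: "'p::prime_card padic_int" (\<open>\<pi>\<close>) where
  "\<pi> \<equiv> of_nat CARD('p)"

lemma padic_trunc_diff:
  "padic_trunc (x - y) n = (padic_trunc x n - padic_trunc y n) mod int CARD('p) ^ n"
  for x y :: "'p::prime_card padic_int"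
  by transfer simp

lemma padic_trunc_range:
  "padic_trunc (x :: 'p::prime_card padic_int) n \<in> {0..<int CARD('p) ^ n}"
  by transfer auto

lemma padic_trunc_of_int:
  "padic_trunc (of_int k :: 'p::prime_card padic_int) n = k mod int CARD('p) ^ n"
proof -
  obtain i j where k: "k = int i - int j" by (rule int_diff_cases)
  show ?thesis
    unfolding k of_int_diff of_int_of_nat_eq padic_trunc_diff padic_trunc_of_nat
    by (rule mod_diff_eq)
qed

text \<open>In the converse direction the quotient is built level by level: its residue modulo p^k
  is the residue of \<open>x\<close> modulo p^(n+k), divided by p^n. This division is exact because
  \<open>x\<close> vanishes at level n, and it keeps the levels compatible.\<close>

lemma prime_power_dvd_iff_trunc: "\<pi> ^ n dvd x \<longleftrightarrow> padic_trunc x n = 0"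
  for x :: "'p::prime_card padic_int"
proof
  assume "\<pi> ^ n dvd x"
  then obtain y where "x = of_nat (CARD('p) ^ n) * y" by auto
  thus "padic_trunc x n = 0" by (simp only: padic_trunc_mult padic_trunc_of_nat) simp
next
  assume 0: "padic_trunc x n = 0"
  let ?p = "int CARD('p)"
  define y where "y = (\<lambda>k. padic_trunc x (n + k) div ?p ^ n)"
  have pos: "?p > 0" by (rule card_pos_int)
  have dvd: "?p ^ n dvd padic_trunc x (n + k)" for k
    using padic_trunc_mod[of n "n + k" x] 0 by (simp add: dvd_eq_mod_eq_0)
  have y: "?p ^ n * y k = padic_trunc x (n + k)" for k
    using dvd[of k] by (simp add: y_def)
  have y_mod: "y k \<in> {0..<?p ^ k} \<and> y (Suc k) mod ?p ^ k = y k" for k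
  proof
    have "padic_trunc x (n + k) \<in> {0..<?p ^ n * ?p ^ k}"
      using padic_trunc_range[of x "n + k"] by (simp add: power_add)
    moreover have "?p ^ n > 0" using pos by simp
    ultimately show "y k \<in> {0..<?p ^ k}" using y[of k, symmetric] by (auto simp: zero_le_mult_iff)
    have "?p ^ n * (y (Suc k) mod ?p ^ k) = padic_trunc x (n + Suc k) mod ?p ^ (n + k)"
      by (simp only: y[of "Suc k", symmetric] power_add mult_mod_right)
    also have "\<dots> = ?p ^ n * y k" by (simp add: padic_trunc_mod y)
    finally show "y (Suc k) mod ?p ^ k = y k" using pos by simp
  qed
  have "padic_trunc x k = padic_trunc (\<pi> ^ n * Abs_padic_int y :: 'p padic_int) k" for k
  proof -
    have "padic_trunc (\<pi> ^ n * Abs_padic_int y :: 'p padic_int) k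
        = padic_trunc (of_nat (CARD('p) ^ n) * Abs_padic_int y :: 'p padic_int) k" by simp
    also have "\<dots> = (?p ^ n * y k) mod ?p ^ k"
      unfolding padic_trunc_mult padic_trunc_of_nat
      using Abs_padic_int_inverse[where 'p = 'p, of y] y_mod
      by (simp add: padic_trunc.rep_eq mod_mult_left_eq)
    also have "\<dots> = padic_trunc x k" unfolding y by (rule padic_trunc_mod) simp
    finally show ?thesis by simp
  qed
  hence "x = \<pi> ^ n * Abs_padic_int y" by (simp add: padic_int_eq_iff)
  thus "\<pi> ^ n dvd x" by simp
qed

lemma prime_power_dvd_diff_trunc: "\<pi> ^ n dvd x - of_int (padic_trunc x n)"
  for x :: "'p::prime_card padic_int"
  by (simp add: prime_power_dvd_iff_trunc padic_trunc_diff padic_trunc_of_int)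

lemma padic_prime_nonzero [simp]: "(\<pi> :: 'p::prime_card padic_int) \<noteq> 0"
  by (simp add: finite_UNIV_card_ge_0)

lemma eq_0_if_prime_powers_dvd: "x = 0" if "\<And>N. \<pi> ^ N dvd x"
  for x :: "'p::prime_card padic_int"
  using that by (simp add: prime_power_dvd_iff_trunc padic_int_eq_iff padic_trunc_0)

lemma of_int_mod_card: "(of_int (k mod int CARD('p)) :: 'p::prime_card mod_ring) = of_int k"
  unfolding of_int_of_int_mod_ring by transfer simp

lemma of_int_mod_ring_eq_0_iff:
  "(of_int k :: 'p::prime_card mod_ring) = 0 \<longleftrightarrow> int CARD('p) dvd k"
  unfolding of_int_of_int_mod_ring by transfer (auto simp: dvd_eq_mod_eq_0)

lemma padic_residue_of_int [simp]: "padic_residue (of_int k) = of_int k"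
  by (simp add: padic_residue_def padic_trunc_of_int of_int_of_int_mod_ring[symmetric] of_int_mod_card)

interpretation padic_residue: comm_ring_hom "padic_residue :: 'p::prime_card padic_int \<Rightarrow> _"
proof
  fix x y :: "'p padic_int"
  show "padic_residue (x + y) = padic_residue x + padic_residue y"
    unfolding padic_residue_def padic_trunc_add of_int_of_int_mod_ring[symmetric]
    by (simp add: of_int_mod_card)
  show "padic_residue (x * y) = padic_residue x * padic_residue y"
    unfolding padic_residue_def padic_trunc_mult of_int_of_int_mod_ring[symmetric]
    by (simp add: of_int_mod_card)
  show "padic_residue (0 :: 'p padic_int) = 0" "padic_residue (1 :: 'p padic_int) = 1"
    using padic_residue_of_int[of 0] padic_residue_of_int[of 1] by auto
qed

lemma padic_residue_eq_0_iff: "padic_residue x = 0 \<longleftrightarrow> \<pi> dvd x"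
  for x :: "'p::prime_card padic_int"
proof -
  have "padic_residue x = 0 \<longleftrightarrow> int CARD('p) dvd padic_trunc x 1"
    by (simp add: padic_residue_def of_int_of_int_mod_ring[symmetric] of_int_mod_ring_eq_0_iff)
  also have "\<dots> \<longleftrightarrow> padic_trunc x 1 = 0"
    using padic_trunc_range[of x 1] by (auto simp: zdvd_not_zless dest: zdvd_imp_le)
  finally show ?thesis using prime_power_dvd_iff_trunc[of 1 x] by simp
qed

lemma padic_residue_eq_iff: "padic_residue x = padic_residue y \<longleftrightarrow> \<pi> dvd x - y"
  for x y :: "'p::prime_card padic_int"
  using padic_residue_eq_0_iff[of "x - y"] by (simp add: padic_residue.hom_minus)

lemma padic_residue_least_rep [simp]: "padic_residue (least_rep r) = r"
  by (simp add: least_rep_def of_int_of_int_mod_ring)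

text \<open>The multiples of p form the kernel of the reduction to a field, hence a prime
  ideal.\<close>

lemma prime_padic_prime_dvd_mult: "\<pi> dvd x * y \<longleftrightarrow> \<pi> dvd x \<or> \<pi> dvd y"
  for x y :: "'p::prime_card padic_int"
  by (simp add: padic_residue_eq_0_iff[symmetric] padic_residue.hom_mult)


section \<open>Adic series\<close>

text \<open>In a complete nonarchimedean ring this condition on the terms alone already forces the
  series to converge.\<close>

definition adic_null :: "'a::comm_ring_1 \<Rightarrow> (nat \<Rightarrow> 'a) \<Rightarrow> bool" where
  "adic_null q f \<longleftrightarrow> (\<forall>N. \<exists>K. \<forall>k\<ge>K. q ^ N dvd f k)"

text \<open>The Hausdorff property, which makes the definite description in
  \<open>adic_suminf\<close> meaningful. It is a predicate on \<open>q\<close> because it is needed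
  both for the p-adic integers and for the algebra, which inherits it through coordinates.\<close>

definition adic_separated :: "'a::comm_ring_1 \<Rightarrow> bool" where
  "adic_separated q \<longleftrightarrow> (\<forall>x. (\<forall>N. q ^ N dvd x) \<longrightarrow> x = 0)"

lemma adic_separated_padic_prime: "adic_separated (\<pi> :: 'p::prime_card padic_int)"
  by (auto simp: adic_separated_def intro: eq_0_if_prime_powers_dvd)

lemma adic_sums_unique:
  assumes "adic_separated q" "adic_sums q f l" "adic_sums q f m"
  shows "l = m"
proof -
  have "q ^ N dvd l - m" for N
  proof -
    obtain K L where "\<forall>k\<ge>K. q ^ N dvd (\<Sum>i<k. f i) - l" "\<forall>k\<ge>L. q ^ N dvd (\<Sum>i<k. f i) - m"
      using assms(2,3) unfolding adic_sums_def by metis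
    hence "q ^ N dvd (\<Sum>i<K + L. f i) - m - ((\<Sum>i<K + L. f i) - l)"
      by (intro dvd_diff[of _ "_ - m"]) auto
    thus ?thesis by simp
  qed
  thus ?thesis using assms(1) unfolding adic_separated_def by (metis right_minus_eq)
qed

lemma adic_suminf_eqI: "adic_separated q \<Longrightarrow> adic_sums q f l \<Longrightarrow> adic_suminf q f = l"
  unfolding adic_suminf_def by (rule the_equality) (auto intro: adic_sums_unique)

text \<open>By the ultrametric inequality the whole tail is as divisible as each of its
  terms.\<close>

lemma adic_sums_partial:
  assumes "adic_sums q f l" "\<And>k. k \<ge> K \<Longrightarrow> q ^ N dvd f k"
  shows "q ^ N dvd l - (\<Sum>i<K. f i)"
proof -
  obtain L where L: "\<forall>k\<ge>L. q ^ N dvd (\<Sum>i<k. f i) - l"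
    using assms(1) unfolding adic_sums_def by blast
  have "{..<K + L} = {..<K} \<union> {K..<K + L}" by auto
  hence "(\<Sum>i<K + L. f i) = (\<Sum>i<K. f i) + (\<Sum>i=K..<K + L. f i)"
    by (simp add: sum.union_disjoint ivl_disj_int)
  moreover have "q ^ N dvd (\<Sum>i=K..<K + L. f i)" using assms(2) by (intro dvd_sum) auto
  moreover have "q ^ N dvd (\<Sum>i<K + L. f i) - l" using L by simp
  ultimately have "q ^ N dvd (\<Sum>i=K..<K + L. f i) - ((\<Sum>i<K. f i) + (\<Sum>i=K..<K + L. f i) - l)"
    by (metis dvd_diff)
  thus ?thesis by (simp add: algebra_simps)
qed

text \<open>The second assumption is continuity of \<open>L\<close>. Scalar multiplication, the
  embedding of a coordinate axis and the trace are all taken inside infinite sums in this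
  way.\<close>

lemma adic_sums_additive_image:
  assumes "\<And>x y. L (x + y) = L x + L y" "\<And>N x. q ^ N dvd x \<Longrightarrow> r ^ N dvd L x"
    and "adic_sums q f l"
  shows "adic_sums r (\<lambda>k. L (f k)) (L l)"
proof -
  interpret L: Modules.additive L by standard (rule assms(1))
  have "L ((\<Sum>i<k. f i) - l) = (\<Sum>i<k. L (f i)) - L l" for k
    by (simp add: L.diff L.sum)
  thus ?thesis using assms(2,3) unfolding adic_sums_def by metis
qed

text \<open>The limit is a diagonal: its residue modulo p^n is read off from \<open>X n\<close>, and
  the assumption makes these residues compatible.\<close>

lemma padic_limit_exists:
  fixes X :: "nat \<Rightarrow> 'p::prime_card padic_int"
  assumes "\<And>n. \<pi> ^ n dvd X (Suc n) - X n"
  shows "\<exists>x. \<forall>n. \<pi> ^ n dvd x - X n"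
proof -
  have eq: "padic_trunc (X (Suc n)) n = padic_trunc (X n) n" for n
  proof -
    have "int CARD('p) ^ n dvd padic_trunc (X (Suc n)) n - padic_trunc (X n) n"
      using assms[of n] by (simp add: prime_power_dvd_iff_trunc padic_trunc_diff dvd_eq_mod_eq_0)
    hence "padic_trunc (X (Suc n)) n mod int CARD('p) ^ n = padic_trunc (X n) n mod int CARD('p) ^ n"
      by (simp add: mod_eq_dvd_iff)
    thus ?thesis by (simp add: padic_trunc_mod)
  qed
  define x :: "'p padic_int" where "x = Abs_padic_int (\<lambda>n. padic_trunc (X n) n)"
  have "padic_trunc x n = padic_trunc (X n) n" for n
  proof -
    have "padic_trunc (X (Suc k)) (Suc k) mod int CARD('p) ^ k = padic_trunc (X k) k" for k
      by (simp add: padic_trunc_mod eq)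
    thus ?thesis
      unfolding x_def padic_trunc.rep_eq
      by (subst Abs_padic_int_inverse) (use padic_trunc_range in \<open>auto simp: padic_trunc.rep_eq\<close>)
  qed
  thus ?thesis by (intro exI[of _ x]) (auto simp: prime_power_dvd_iff_trunc padic_trunc_diff)
qed

lemma padic_adic_sums_exists:
  fixes f :: "nat \<Rightarrow> 'p::prime_card padic_int"
  assumes "adic_null \<pi> f"
  shows "\<exists>l. adic_sums \<pi> f l"
proof -
  obtain K where K: "\<And>N k. k \<ge> K N \<Longrightarrow> \<pi> ^ N dvd f k"
    using assms unfolding adic_null_def by metis
  \<comment> \<open>Adding up the moduli makes them increasing, so that the partial sums up to
    \<open>M N\<close> satisfy the step condition of \<open>padic_limit_exists\<close>.\<close>
  define M where "M = (\<lambda>N. \<Sum>n\<le>N. K n)"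
  have M: "K N \<le> M N" "M N \<le> M (Suc N)" for N
    by (auto simp: M_def intro: member_le_sum)
  have diff: "\<pi> ^ N dvd (\<Sum>i<k. f i) - (\<Sum>i<M N. f i)" if "k \<ge> M N" for k N
  proof -
    have "(\<Sum>i<k. f i) = (\<Sum>i<M N. f i) + (\<Sum>i=M N..<k. f i)"
      using that by (metis atLeast0LessThan sum.atLeastLessThan_concat zero_le)
    moreover have "\<pi> ^ N dvd (\<Sum>i=M N..<k. f i)"
      using M(1)[of N] by (intro dvd_sum K) auto
    ultimately show ?thesis by simp
  qed
  obtain l where l: "\<And>N. \<pi> ^ N dvd l - (\<Sum>i<M N. f i)"
    using padic_limit_exists[of "\<lambda>N. \<Sum>i<M N. f i"] diff M(2) by blast
  have "\<pi> ^ N dvd (\<Sum>i<k. f i) - l" if "k \<ge> M N" for N k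
    using dvd_diff[OF diff[OF that] l[of N]] by simp
  thus ?thesis unfolding adic_sums_def by blast
qed

lemma padic_suminf:
  fixes f :: "nat \<Rightarrow> 'p::prime_card padic_int"
  assumes "adic_null \<pi> f"
  shows "adic_sums \<pi> f (adic_suminf \<pi> f)"
  using padic_adic_sums_exists[OF assms] adic_suminf_eqI[OF adic_separated_padic_prime] by metis

section \<open>Units and valuations of p-adic integers\<close>

lemma padic_unit_iff: "x dvd 1 \<longleftrightarrow> padic_residue x \<noteq> 0"
  for x :: "'p::prime_card padic_int"
proof
  assume "x dvd 1"
  then obtain y where "1 = x * y" by auto
  hence "padic_residue x * padic_residue y = 1"
    by (metis padic_residue.hom_mult padic_residue.hom_one)
  thus "padic_residue x \<noteq> 0" by auto
next
  assume nz: "padic_residue x \<noteq> 0"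
  \<comment> \<open>A lift of the inverse residue inverts \<open>x\<close> up to an error divisible
    by p; the geometric series in that error corrects it.\<close>
  define y where "y = least_rep (inverse (padic_residue x))"
  have "padic_residue (1 - x * y) = 0"
    using nz by (simp add: y_def padic_residue.hom_minus padic_residue.hom_mult)
  then obtain w where w: "1 - x * y = \<pi> * w" by (auto simp: padic_residue_eq_0_iff)
  have "\<pi> ^ N dvd (\<pi> * w) ^ k" if "k \<ge> N" for N k
    using that by (simp add: power_mult_distrib le_imp_power_dvd dvd_mult2)
  hence null: "adic_null \<pi> (\<lambda>k. (\<pi> * w) ^ k)" unfolding adic_null_def by blast
  define l where "l = adic_suminf \<pi> (\<lambda>k. (\<pi> * w) ^ k)"
  have "(x * y) * l = 1"
  proof -
    have "\<pi> ^ N dvd (x * y) * l - 1" for N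
    proof -
      have "\<pi> ^ N dvd (x * y) * (l - (\<Sum>i<N. (\<pi> * w) ^ i)) - (\<pi> * w) ^ N"
        using adic_sums_partial[OF padic_suminf[OF null], of N N] \<open>\<And>N k. N \<le> k \<Longrightarrow> _\<close>
        by (auto simp: l_def intro: dvd_diff[of _ "_ * _"] dvd_mult)
      also have "(x * y) * (l - (\<Sum>i<N. (\<pi> * w) ^ i)) - (\<pi> * w) ^ N
          = (x * y) * l - (1 - \<pi> * w) * (\<Sum>i<N. (\<pi> * w) ^ i) - (\<pi> * w) ^ N"
        unfolding w[symmetric] by (simp add: right_diff_distrib)
      also have "(1 - \<pi> * w) * (\<Sum>i<N. (\<pi> * w) ^ i) = 1 - (\<pi> * w) ^ N"
        by (simp add: one_diff_power_eq)
      finally show ?thesis by simp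
    qed
    thus ?thesis using eq_0_if_prime_powers_dvd[of "(x * y) * l - 1"] by simp
  qed
  thus "x dvd 1" by (metis dvd_triv_left mult.assoc)
qed

lemma padic_val_prime_power_mult:
  fixes u :: "'p::prime_card padic_int"
  assumes "\<not> \<pi> dvd u"
  shows "padic_val (\<pi> ^ m * u) = enat m"
proof -
  have "\<pi> ^ n dvd \<pi> ^ m * u \<longleftrightarrow> n \<le> m" for n
  proof
    assume dvd: "\<pi> ^ n dvd \<pi> ^ m * u"
    show "n \<le> m"
    proof (rule ccontr)
      assume "\<not> n \<le> m"
      hence "\<pi> ^ m * \<pi> dvd \<pi> ^ m * u"
        using dvd_trans[OF le_imp_power_dvd[of "Suc m" n] dvd] by (simp add: mult.commute)
      thus False using assms by simp
    qed
  qed (simp add: le_imp_power_dvd dvd_mult2)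
  hence "padic_val (\<pi> ^ m * u) = Sup (enat ` {..m})"
    unfolding padic_val_def by (simp add: image_def) (metis atMost_iff)
  also have "\<dots> = enat m"
    by (rule antisym) (auto intro!: Sup_least Sup_upper)
  finally show ?thesis .
qed

lemma padic_val_0: "padic_val (0 :: 'p::prime_card padic_int) = \<infinity>"
proof -
  have "enat n \<le> padic_val (0 :: 'p padic_int)" for n
    unfolding padic_val_def by (rule Sup_upper) auto
  thus ?thesis by (metis enat_ord_simps(4) enat_ord_code(4) not_infinity_eq less_irrefl
        Suc_ile_eq)
qed

lemma padic_decompose:
  fixes x :: "'p::prime_card padic_int"
  assumes "x \<noteq> 0"
  obtains m u where "x = \<pi> ^ m * u" "\<not> \<pi> dvd u"
proof -
  obtain n where n: "\<not> \<pi> ^ n dvd x" using eq_0_if_prime_powers_dvd assms by blast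
  \<comment> \<open>The exponent 0 never fails, so the least failing exponent is positive and the
    subtraction is not truncated.\<close>
  define m where "m = (LEAST n. \<not> \<pi> ^ n dvd x) - 1"
  have least: "\<not> \<pi> ^ (LEAST n. \<not> \<pi> ^ n dvd x) dvd x" using n by (rule LeastI)
  hence pos: "(LEAST n. \<not> \<pi> ^ n dvd x) = Suc m"
    unfolding m_def by (cases "LEAST n. \<not> \<pi> ^ n dvd x") auto
  have "\<pi> ^ m dvd x" using not_less_Least[of m "\<lambda>n. \<not> \<pi> ^ n dvd x"] pos by simp
  then obtain u where u: "x = \<pi> ^ m * u" by auto
  moreover have "\<not> \<pi> dvd u" using least unfolding pos by (auto simp: u mult_ac)
  ultimately show ?thesis using that by blast
qed

lemma padic_val_shift:
  fixes x u :: "'p::prime_card padic_int"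
  assumes "\<not> \<pi> dvd u"
  shows "padic_val (\<pi> ^ n * (x * u)) = enat n + padic_val x"
proof (cases "x = 0")
  case False
  obtain m v where "x = \<pi> ^ m * v" "\<not> \<pi> dvd v" using padic_decompose[OF False] .
  moreover from this have "\<pi> ^ n * (x * u) = \<pi> ^ (n + m) * (v * u)"
    by (simp only: power_add ac_simps)
  ultimately show ?thesis
    using assms
    by (metis padic_val_prime_power_mult prime_padic_prime_dvd_mult plus_enat_simps(1))
qed (simp add: padic_val_0)


section \<open>Restricted power series\<close>

lemma restricted_fps_iff_null: "f \<in> restricted_fps \<longleftrightarrow> adic_null \<pi> (fps_nth f)"
  by (simp add: restricted_fps_def adic_null_def)

lemma fps_const_dvd_iff: "fps_const c dvd f \<longleftrightarrow> (\<forall>n. c dvd fps_nth f n)"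
  for f :: "'a::comm_ring_1 fps"
proof
  assume "\<forall>n. c dvd fps_nth f n"
  then obtain g where "\<And>n. fps_nth f n = c * g n" unfolding dvd_def by metis
  hence "f = fps_const c * Abs_fps g" by (simp add: fps_eq_iff)
  thus "fps_const c dvd f" by simp
qed auto

text \<open>
  The congruence modulo \<open>p ^ N\<close> of power series is coefficientwise, and a restricted series is
  one that is congruent to a polynomial for every \<open>N\<close>. Identities between restricted series
  are reduced to identities between polynomials in this way.
\<close>

lemma restricted_fps_iff_approx:
  "f \<in> restricted_fps \<longleftrightarrow> (\<forall>N. \<exists>h. fps_const (\<pi> ^ N) dvd f - fps_of_poly h)"
  for f :: "'p::prime_card padic_int fps"
proof
  assume f: "f \<in> restricted_fps"
  show "\<forall>N. \<exists>h. fps_const (\<pi> ^ N) dvd f - fps_of_poly h"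
  proof
    fix N
    obtain K where "\<forall>n\<ge>K. \<pi> ^ N dvd fps_nth f n"
      using f unfolding restricted_fps_def by blast
    hence "fps_const (\<pi> ^ N) dvd f - fps_of_poly (truncate_fps K f)"
      by (auto simp: fps_const_dvd_iff)
    thus "\<exists>h. fps_const (\<pi> ^ N) dvd f - fps_of_poly h" by blast
  qed
next
  assume *: "\<forall>N. \<exists>h. fps_const (\<pi> ^ N) dvd f - fps_of_poly h"
  have "\<exists>K. \<forall>n\<ge>K. \<pi> ^ N dvd fps_nth f n" for N
  proof -
    obtain h where h: "fps_const (\<pi> ^ N) dvd f - fps_of_poly h" using * by blast
    have "\<pi> ^ N dvd fps_nth f n" if "n \<ge> Suc (degree h)" for n
      using h that by (auto simp: fps_const_dvd_iff coeff_eq_0 dest!: spec[of _ n])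
    thus ?thesis by blast
  qed
  thus "f \<in> restricted_fps" unfolding restricted_fps_def by blast
qed

lemma restricted_approx:
  assumes "f \<in> restricted_fps"
  obtains h where "fps_const (\<pi> ^ N) dvd f - fps_of_poly h"
  using assms unfolding restricted_fps_iff_approx by blast

lemma restricted_fps_of_poly [simp]: "fps_of_poly h \<in> restricted_fps"
  unfolding restricted_fps_iff_approx by (auto intro!: exI[of _ h])

lemma restricted_one [simp]: "1 \<in> restricted_fps"
  using restricted_fps_of_poly[of 1] by simp

lemma restricted_fps_const [simp]: "fps_const c \<in> restricted_fps"
  using restricted_fps_of_poly[of "[:c:]"] by (simp add: fps_of_poly_const)

lemma restricted_add:
  assumes "f \<in> restricted_fps" "g \<in> restricted_fps"
  shows "f + g \<in> restricted_fps"
  unfolding restricted_fps_iff_approx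
proof
  fix N
  obtain h k where "fps_const (\<pi> ^ N) dvd f - fps_of_poly h" "fps_const (\<pi> ^ N) dvd g - fps_of_poly k"
    using assms restricted_approx by metis
  hence "fps_const (\<pi> ^ N) dvd (f - fps_of_poly h) + (g - fps_of_poly k)" by (rule dvd_add)
  hence "fps_const (\<pi> ^ N) dvd f + g - fps_of_poly (h + k)"
    by (simp add: fps_of_poly_add algebra_simps)
  thus "\<exists>h. fps_const (\<pi> ^ N) dvd f + g - fps_of_poly h" by blast
qed

lemma fps_const_dvd_mult_diff:
  fixes f g :: "'a::comm_ring_1 fps"
  assumes "fps_const c dvd f - h" "fps_const c dvd g - k"
  shows "fps_const c dvd f * g - h * k"
proof -
  have "f * g - h * k = (f - h) * g + h * (g - k)" by (simp add: algebra_simps)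
  thus ?thesis using assms by (metis dvd_add dvd_mult dvd_mult2)
qed

lemma restricted_mult:
  assumes "f \<in> restricted_fps" "g \<in> restricted_fps"
  shows "f * g \<in> restricted_fps"
  unfolding restricted_fps_iff_approx
proof
  fix N
  obtain h k where "fps_const (\<pi> ^ N) dvd f - fps_of_poly h" "fps_const (\<pi> ^ N) dvd g - fps_of_poly k"
    using assms restricted_approx by metis
  hence "fps_const (\<pi> ^ N) dvd f * g - fps_of_poly (h * k)"
    unfolding fps_of_poly_mult by (rule fps_const_dvd_mult_diff)
  thus "\<exists>h. fps_const (\<pi> ^ N) dvd f * g - fps_of_poly h" by blast
qed

lemma restricted_uminus: "f \<in> restricted_fps \<Longrightarrow> - f \<in> restricted_fps"
  using restricted_mult[OF restricted_fps_const[of "-1"], of f]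
  by (simp flip: fps_const_neg)

lemma restricted_diff: "f \<in> restricted_fps \<Longrightarrow> g \<in> restricted_fps \<Longrightarrow> f - g \<in> restricted_fps"
  using restricted_add[of f "- g"] restricted_uminus[of g] by simp

lemma restricted_power: "f \<in> restricted_fps \<Longrightarrow> f ^ n \<in> restricted_fps"
  by (induction n) (auto intro: restricted_mult)

lemma restricted_sum: "(\<And>i. i \<in> I \<Longrightarrow> f i \<in> restricted_fps) \<Longrightarrow> sum f I \<in> restricted_fps"
  by (induction I rule: infinite_finite_induct)
    (auto intro: restricted_add simp: restricted_fps_of_poly[of 0, simplified])

text \<open>Cancelling p^m costs m digits, so the decay of the coefficients is requested to
  precision m + N.\<close>

lemma restricted_cancel:
  assumes "fps_const (\<pi> ^ m) * G \<in> restricted_fps"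
  shows "G \<in> restricted_fps"
  unfolding restricted_fps_def
proof (safe)
  fix N
  obtain K where K: "\<forall>n\<ge>K. \<pi> ^ (m + N) dvd fps_nth (fps_const (\<pi> ^ m) * G) n"
    using assms unfolding restricted_fps_def by blast
  have "\<pi> ^ N dvd fps_nth G n" if "n \<ge> K" for n
    using K that by (auto simp: power_add)
  thus "\<exists>K. \<forall>n\<ge>K. \<pi> ^ N dvd fps_nth G n" by blast
qed

section \<open>Evaluation of restricted series\<close>

lemma rps_eval_sums:
  assumes "f \<in> restricted_fps"
  shows "adic_sums \<pi> (\<lambda>n. fps_nth f n * t ^ n) (rps_eval f t)"
  unfolding rps_eval_def
proof (rule padic_suminf)
  show "adic_null \<pi> (\<lambda>n. fps_nth f n * t ^ n)"
    using assms unfolding restricted_fps_iff_null adic_null_def by (meson dvd_mult2)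
qed

lemma poly_eq_sum_lessThan: "degree h < K \<Longrightarrow> poly h t = (\<Sum>i<K. poly.coeff h i * t ^ i)"
  for h :: "'a::comm_semiring_1 poly"
  unfolding poly_altdef by (rule sum.mono_neutral_left) (auto simp: coeff_eq_0)

lemma rps_eval_approx:
  assumes f: "f \<in> restricted_fps" and h: "fps_const (\<pi> ^ N) dvd f - fps_of_poly h"
  shows "\<pi> ^ N dvd rps_eval f t - poly h t"
proof -
  obtain K where "\<forall>n\<ge>K. \<pi> ^ N dvd fps_nth f n"
    using f unfolding restricted_fps_def by blast
  \<comment> \<open>The truncation point also exceeds the degree of \<open>h\<close>, so that the
    truncated sum for \<open>h\<close> is its full value.\<close>
  hence "\<pi> ^ N dvd rps_eval f t - (\<Sum>i<K + Suc (degree h). fps_nth f i * t ^ i)"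
    by (intro adic_sums_partial[OF rps_eval_sums[OF f]]) auto
  moreover have "\<pi> ^ N dvd (\<Sum>i<K + Suc (degree h). (fps_nth f i - poly.coeff h i) * t ^ i)"
    using h by (intro dvd_sum dvd_mult2) (auto simp: fps_const_dvd_iff)
  ultimately have "\<pi> ^ N dvd rps_eval f t - (\<Sum>i<K + Suc (degree h). fps_nth f i * t ^ i) +
      (\<Sum>i<K + Suc (degree h). (fps_nth f i - poly.coeff h i) * t ^ i)" by (rule dvd_add)
  also have "\<dots> = rps_eval f t - poly h t"
    by (simp add: poly_eq_sum_lessThan[of h "K + Suc (degree h)"] left_diff_distrib sum_subtractf
        del: sum.lessThan_Suc add_Suc_right)
  finally show ?thesis .
qed

text \<open>Separatedness turns agreement to every finite precision into equality. The polynomial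
  may change with N, so no limits have to be interchanged.\<close>

lemma rps_eval_eqI:
  fixes f :: "'p::prime_card padic_int fps"
  assumes "f \<in> restricted_fps"
    and "\<And>N. \<exists>h. fps_const (\<pi> ^ N) dvd f - fps_of_poly h \<and> \<pi> ^ N dvd x - poly h t"
  shows "rps_eval f t = x"
proof -
  have "\<pi> ^ N dvd rps_eval f t - x" for N
  proof -
    obtain h where "fps_const (\<pi> ^ N) dvd f - fps_of_poly h" "\<pi> ^ N dvd x - poly h t"
      using assms(2) by blast
    hence "\<pi> ^ N dvd (rps_eval f t - poly h t) - (x - poly h t)"
      using rps_eval_approx[OF assms(1)] by (metis dvd_diff)
    thus ?thesis by simp
  qed
  thus ?thesis using eq_0_if_prime_powers_dvd[of "rps_eval f t - x"] by simp
qed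

lemma rps_eval_of_poly [simp]: "rps_eval (fps_of_poly h) t = poly h t"
  by (rule rps_eval_eqI) (auto intro!: exI[of _ h])

lemma rps_eval_const [simp]: "rps_eval (fps_const c) t = c"
  using rps_eval_of_poly[of "[:c:]"] by (simp add: fps_of_poly_const)

lemma rps_eval_mult:
  assumes "f \<in> restricted_fps" "g \<in> restricted_fps"
  shows "rps_eval (f * g) t = rps_eval f t * rps_eval g t"
proof (rule rps_eval_eqI[OF restricted_mult[OF assms]])
  fix N
  obtain h k where h: "fps_const (\<pi> ^ N) dvd f - fps_of_poly h"
    and k: "fps_const (\<pi> ^ N) dvd g - fps_of_poly k"
    using assms restricted_approx by metis
  have "rps_eval f t * rps_eval g t - poly (h * k) t
      = (rps_eval f t - poly h t) * rps_eval g t + poly h t * (rps_eval g t - poly k t)"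
    by (simp add: algebra_simps)
  hence "\<pi> ^ N dvd rps_eval f t * rps_eval g t - poly (h * k) t"
    using rps_eval_approx[OF assms(1) h, of t] rps_eval_approx[OF assms(2) k, of t] by simp
  moreover have "fps_const (\<pi> ^ N) dvd f * g - fps_of_poly (h * k)"
    unfolding fps_of_poly_mult by (rule fps_const_dvd_mult_diff[OF h k])
  ultimately show "\<exists>h. fps_const (\<pi> ^ N) dvd f * g - fps_of_poly h \<and>
      \<pi> ^ N dvd rps_eval f t * rps_eval g t - poly h t" by blast
qed

section \<open>Translation of the variable and differentiation\<close>

lemma coeff_pcompose_translate:
  fixes h :: "'a::idom poly"
  assumes "degree h < K"
  shows "poly.coeff (pcompose h [:u, 1:]) n =
    (\<Sum>k<K. of_nat ((n + k) choose n) * poly.coeff h (n + k) * u ^ k)"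
    (is "_ = ?rhs")
proof -
  \<comment> \<open>\<open>K\<close> is any strict bound for the degree, so that it can later be
    matched with the truncation point of a series; the surplus terms vanish.\<close>
  have "h = (\<Sum>i<n + K. Polynomial.monom (poly.coeff h i) i)"
    using assms by (intro poly_eqI) (auto simp: coeff_sum coeff_eq_0)
  hence "pcompose h [:u, 1:] = (\<Sum>i<n + K. pcompose (Polynomial.monom (poly.coeff h i) i) [:u, 1:])"
    by (metis pcompose_sum)
  also have "\<dots> = (\<Sum>i<n + K. Polynomial.smult (poly.coeff h i) ([:u, 1:] ^ i))"
    by (simp add: monom_altdef pcompose_smult pcompose_hom.hom_power pcompose_pCons)
  moreover have "poly.coeff ([:u, 1:] ^ i) n = of_nat (i choose n) * u ^ (i - n)" for i
  proof (cases "n \<le> i")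
    case False
    hence "degree ([:u, 1:] ^ i) < n" by (simp add: degree_linear_power)
    thus ?thesis using False by (simp add: coeff_eq_0 binomial_eq_0)
  qed (simp add: coeff_linear_poly_power)
  ultimately have "poly.coeff (pcompose h [:u, 1:]) n
      = (\<Sum>i<n + K. poly.coeff h i * (of_nat (i choose n) * u ^ (i - n)))"
    by (simp add: coeff_sum)
  also have "\<dots> = (\<Sum>i=n..<n + K. poly.coeff h i * (of_nat (i choose n) * u ^ (i - n)))"
    by (rule sum.mono_neutral_right) (auto simp: binomial_eq_0)
  also have "\<dots> = (\<Sum>i<K. poly.coeff h (i + n) * (of_nat ((i + n) choose n) * u ^ i))"
    using sum.shift_bounds_nat_ivl[of "\<lambda>i. poly.coeff h i * (of_nat (i choose n) * u ^ (i - n))" 0 n K]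
    by (simp add: add.commute atLeast0LessThan)
  also have "\<dots> = ?rhs" by (simp add: ac_simps)
  finally show ?thesis .
qed

text \<open>The Taylor formula is linear with integral coefficients, so it preserves congruences; on
  the polynomial \<open>h\<close> it is substitution of u + X.\<close>

lemma rps_shift_approx:
  fixes f :: "'p::prime_card padic_int fps"
  assumes f: "f \<in> restricted_fps" and h: "fps_const (\<pi> ^ N) dvd f - fps_of_poly h"
  shows "fps_const (\<pi> ^ N) dvd rps_shift u f - fps_of_poly (pcompose h [:u, 1:])"
  unfolding fps_const_dvd_iff
proof
  fix n
  let ?g = "\<lambda>k. of_nat ((n + k) choose n) * fps_nth f (n + k) * u ^ k"
  have null: "\<exists>K. \<forall>k\<ge>K. \<pi> ^ M dvd ?g k" for M
  proof -
    obtain K where "\<forall>n\<ge>K. \<pi> ^ M dvd fps_nth f n"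
      using f unfolding restricted_fps_def by blast
    hence "\<forall>k\<ge>K. \<pi> ^ M dvd ?g k" by auto
    thus ?thesis by blast
  qed
  hence sums: "adic_sums \<pi> ?g (fps_nth (rps_shift u f) n)"
    unfolding rps_shift_def fps_nth_Abs_fps by (intro padic_suminf) (simp add: adic_null_def)
  obtain K where "\<forall>k\<ge>K. \<pi> ^ N dvd ?g k" using null by blast
  hence "\<pi> ^ N dvd fps_nth (rps_shift u f) n - (\<Sum>i<K + Suc (degree h). ?g i)"
    by (intro adic_sums_partial[OF sums]) auto
  moreover have "\<pi> ^ N dvd (\<Sum>i<K + Suc (degree h).
      of_nat ((n + i) choose n) * (fps_nth f (n + i) - poly.coeff h (n + i)) * u ^ i)"
    using h by (intro dvd_sum dvd_mult2 dvd_mult) (auto simp: fps_const_dvd_iff)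
  ultimately have "\<pi> ^ N dvd fps_nth (rps_shift u f) n - (\<Sum>i<K + Suc (degree h). ?g i)
      + (\<Sum>i<K + Suc (degree h).
          of_nat ((n + i) choose n) * (fps_nth f (n + i) - poly.coeff h (n + i)) * u ^ i)"
    by (rule dvd_add)
  also have "\<dots> = fps_nth (rps_shift u f) n - poly.coeff (pcompose h [:u, 1:]) n"
    by (simp add: coeff_pcompose_translate[of h "K + Suc (degree h)"] left_diff_distrib
        right_diff_distrib sum_subtractf del: sum.lessThan_Suc add_Suc_right)
  finally show "\<pi> ^ N dvd fps_nth (rps_shift u f - fps_of_poly (pcompose h [:u, 1:])) n" by simp
qed

lemma restricted_rps_shift:
  assumes "f \<in> restricted_fps"
  shows "rps_shift u f \<in> restricted_fps"
  unfolding restricted_fps_iff_approx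
  using rps_shift_approx[OF assms] restricted_approx[OF assms] by metis

lemma rps_eval_shift:
  assumes f: "f \<in> restricted_fps"
  shows "rps_eval (rps_shift u f) t = rps_eval f (u + t)"
proof (rule rps_eval_eqI[OF restricted_rps_shift[OF f]])
  fix N
  obtain h where h: "fps_const (\<pi> ^ N) dvd f - fps_of_poly h" using restricted_approx[OF f] .
  have "poly (pcompose h [:u, 1:]) t = poly h (u + t)" by (simp add: poly_pcompose)
  thus "\<exists>h. fps_const (\<pi> ^ N) dvd rps_shift u f - fps_of_poly h \<and>
      \<pi> ^ N dvd rps_eval f (u + t) - poly h t"
    using rps_shift_approx[OF f h] rps_eval_approx[OF f h] by metis
qed

text \<open>A constant is pulled out of \<open>adic_suminf\<close> by way of convergence, which
  restrictedness of \<open>f\<close> provides.\<close>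

lemma rps_shift_const_mult:
  fixes f :: "'p::prime_card padic_int fps"
  assumes f: "f \<in> restricted_fps"
  shows "rps_shift u (fps_const c * f) = fps_const c * rps_shift u f"
proof (rule fps_ext)
  fix n
  let ?g = "\<lambda>k. of_nat ((n + k) choose n) * fps_nth f (n + k) * u ^ k"
  have "adic_null \<pi> ?g" unfolding adic_null_def
  proof
    fix M
    obtain K where "\<forall>n\<ge>K. \<pi> ^ M dvd fps_nth f n"
      using f unfolding restricted_fps_def by blast
    hence "\<forall>k\<ge>K. \<pi> ^ M dvd ?g k" by auto
    thus "\<exists>K. \<forall>k\<ge>K. \<pi> ^ M dvd ?g k" by blast
  qed
  hence "adic_sums \<pi> ?g (adic_suminf \<pi> ?g)" by (rule padic_suminf)
  hence "adic_sums \<pi> (\<lambda>k. c * ?g k) (c * adic_suminf \<pi> ?g)"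
    by (rule adic_sums_additive_image[rotated 2]) (auto simp: algebra_simps)
  hence "adic_suminf \<pi> (\<lambda>k. c * ?g k) = c * adic_suminf \<pi> ?g"
    by (rule adic_suminf_eqI[OF adic_separated_padic_prime])
  thus "fps_nth (rps_shift u (fps_const c * f)) n = fps_nth (fps_const c * rps_shift u f) n"
    by (simp add: rps_shift_def mult_ac)
qed

lemma restricted_fps_deriv:
  assumes "f \<in> restricted_fps"
  shows "fps_deriv f \<in> restricted_fps"
  unfolding restricted_fps_iff_approx
proof
  fix N
  obtain h where "fps_const (\<pi> ^ N) dvd f - fps_of_poly h" using restricted_approx[OF assms] .
  hence "fps_const (\<pi> ^ N) dvd fps_deriv f - fps_of_poly (pderiv h)"
    by (auto simp: fps_const_dvd_iff coeff_pderiv right_diff_distrib[symmetric] simp del: of_nat_Suc)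
  thus "\<exists>h. fps_const (\<pi> ^ N) dvd fps_deriv f - fps_of_poly h" by blast
qed


section \<open>Reduction of restricted power series\<close>

lemma rps_residue_nth [simp]: "fps_nth (rps_residue f) n = padic_residue (fps_nth f n)"
  by (simp add: rps_residue_def)

lemma rps_residue_eq_iff: "rps_residue f = rps_residue g \<longleftrightarrow> fps_const \<pi> dvd f - g"
  by (simp add: fps_eq_iff fps_const_dvd_iff padic_residue_eq_iff)

lemma rps_residue_mult: "rps_residue (f * g) = rps_residue f * rps_residue g"
  by (simp add: fps_eq_iff fps_mult_nth padic_residue.hom_sum padic_residue.hom_mult)

lemma rps_residue_add: "rps_residue (f + g) = rps_residue f + rps_residue g"
  by (simp add: fps_eq_iff padic_residue.hom_add)

lemma rps_residue_diff: "rps_residue (f - g) = rps_residue f - rps_residue g"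
  by (simp add: fps_eq_iff padic_residue.hom_minus)

lemma rps_residue_1 [simp]: "rps_residue 1 = 1"
  by (simp add: fps_eq_iff fps_one_nth)

lemma rps_residue_of_poly: "rps_residue (fps_of_poly h) = fps_of_poly (map_poly padic_residue h)"
  by (simp add: fps_eq_iff)

lemma rps_residue_eq_0_iff: "rps_residue f = 0 \<longleftrightarrow> fps_const \<pi> dvd f"
  using rps_residue_eq_iff[of f 0] by (simp add: rps_residue_def fps_eq_iff)

text \<open>A section of the reduction, but not a homomorphism: identities between polynomials
  survive lifting only modulo p.\<close>

definition lift_poly :: "'p::prime_card mod_ring poly \<Rightarrow> 'p padic_int poly" where
  "lift_poly = map_poly least_rep"

lemma least_rep_0 [simp]: "least_rep 0 = 0"
  by (simp add: least_rep_def)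

lemma map_poly_residue_lift [simp]: "map_poly padic_residue (lift_poly R) = R"
  by (rule poly_eqI) (simp add: lift_poly_def coeff_map_poly)

lemma rps_residue_lift [simp]: "rps_residue (fps_of_poly (lift_poly R)) = fps_of_poly R"
  by (simp add: rps_residue_of_poly)

lemma coeff_lift_poly: "poly.coeff (lift_poly R) n = least_rep (poly.coeff R n)"
  by (simp add: lift_poly_def coeff_map_poly)

text \<open>An approximation to precision 1 already leaves only finitely many coefficients that are
  nonzero modulo p.\<close>

lemma rps_residue_is_poly:
  assumes "f \<in> restricted_fps"
  obtains R where "rps_residue f = fps_of_poly R"
proof -
  obtain h where "fps_const (\<pi> ^ 1) dvd f - fps_of_poly h" using restricted_approx[OF assms] .
  hence "rps_residue f = rps_residue (fps_of_poly h)" by (simp add: rps_residue_eq_iff)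
  thus ?thesis using that by (simp add: rps_residue_of_poly)
qed

lemma rps_residue_approx:
  assumes "rps_residue f = fps_of_poly R"
  shows "fps_const (\<pi> ^ 1) dvd f - fps_of_poly (lift_poly R)"
  using assms by (simp add: rps_residue_eq_iff[symmetric])

lemma padic_residue_rps_eval:
  assumes "f \<in> restricted_fps" "rps_residue f = fps_of_poly R"
  shows "padic_residue (rps_eval f t) = poly R (padic_residue t)"
proof -
  have "padic_residue (rps_eval f t) = padic_residue (poly (lift_poly R) t)"
    using rps_eval_approx[OF assms(1) rps_residue_approx[OF assms(2)]]
    by (simp add: padic_residue_eq_iff)
  also have "\<dots> = poly (map_poly padic_residue (lift_poly R)) (padic_residue t)"
    by (rule padic_residue.poly_map_poly[symmetric])
  finally show ?thesis by simp
qed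

lemma rps_residue_shift:
  assumes "f \<in> restricted_fps" "rps_residue f = fps_of_poly R"
  shows "rps_residue (rps_shift u f) = fps_of_poly (pcompose R [:padic_residue u, 1:])"
proof -
  have "rps_residue (rps_shift u f) = rps_residue (fps_of_poly (pcompose (lift_poly R) [:u, 1:]))"
    using rps_shift_approx[OF assms(1) rps_residue_approx[OF assms(2)]]
    by (simp add: rps_residue_eq_iff)
  also have "\<dots> = fps_of_poly (pcompose R [:padic_residue u, 1:])"
    by (simp add: rps_residue_of_poly padic_residue.map_poly_pcompose padic_residue.map_poly_pCons_hom)
  finally show ?thesis .
qed

lemma rps_residue_deriv:
  assumes "rps_residue f = fps_of_poly R"
  shows "rps_residue (fps_deriv f) = fps_of_poly (pderiv R)"
proof (rule fps_ext)
  fix n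
  have "padic_residue (fps_nth f (Suc n)) = poly.coeff R (Suc n)"
    using arg_cong[OF assms, of "\<lambda>g. fps_nth g (Suc n)"] by simp
  thus "fps_nth (rps_residue (fps_deriv f)) n = fps_nth (fps_of_poly (pderiv R)) n"
    by (simp add: coeff_pderiv padic_residue.hom_mult padic_residue.hom_of_nat
        padic_residue.hom_add del: of_nat_Suc)
qed


section \<open>Local factors of restricted power series\<close>

text \<open>Write f = 1 - w with w divisible by p. A formal inverse exists because the constant
  coefficient is a unit; it is restricted because modulo p^N it agrees with the first N terms of the
  geometric series in w.\<close>

lemma restricted_inverse:
  fixes f :: "'p::prime_card padic_int fps"
  assumes f: "f \<in> restricted_fps" and res: "rps_residue f = 1"
  shows "\<exists>g\<in>restricted_fps. f * g = 1"
proof -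
  have "rps_residue 1 = rps_residue f" using res by simp
  then obtain m where m: "1 - f = fps_const \<pi> * m" unfolding rps_residue_eq_iff by auto
  have "fps_const (\<pi> ^ 1) * m \<in> restricted_fps"
    using restricted_diff[OF restricted_one f] m by simp
  define w where "w = fps_const \<pi> * m"
  have w: "w \<in> restricted_fps" "f = 1 - w"
    using \<open>fps_const (\<pi> ^ 1) * m \<in> restricted_fps\<close> m
    by (auto simp: w_def algebra_simps)
  have "padic_residue (fps_nth f 0) = 1"
    using arg_cong[OF res, of "\<lambda>g. fps_nth g 0"] by simp
  hence "fps_nth f 0 dvd 1" by (simp add: padic_unit_iff)
  then obtain y where y: "fps_nth f 0 * y = 1" by (metis dvdE)
  define g where "g = fps_right_inverse f y"
  have fg: "f * g = 1" unfolding g_def by (rule fps_right_inverse[OF y])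
  have "g \<in> restricted_fps" unfolding restricted_fps_iff_approx
  proof
    fix N
    have "(\<Sum>k<N. w ^ k) \<in> restricted_fps" by (intro restricted_sum restricted_power w)
    then obtain h where h: "fps_const (\<pi> ^ N) dvd (\<Sum>k<N. w ^ k) - fps_of_poly h"
      by (rule restricted_approx)
    have "(\<Sum>k<N. w ^ k) = (\<Sum>k<N. w ^ k) * (f * g)" by (simp add: fg)
    also have "\<dots> = ((1 - w) * (\<Sum>k<N. w ^ k)) * g" by (simp add: w(2) ac_simps)
    also have "(1 - w) * (\<Sum>k<N. w ^ k) = 1 - w ^ N" by (simp add: one_diff_power_eq)
    finally have "g - fps_of_poly h = ((\<Sum>k<N. w ^ k) - fps_of_poly h) + w ^ N * g"
      by (simp add: algebra_simps)
    moreover have "fps_const (\<pi> ^ N) dvd w ^ N * g"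
      by (simp add: w_def power_mult_distrib fps_const_power)
    ultimately show "\<exists>h. fps_const (\<pi> ^ N) dvd g - fps_of_poly h" using h by (metis dvd_add)
  qed
  thus ?thesis using fg by blast
qed

text \<open>A Bezout identity over the residue field is lifted coefficientwise; the lifted
  combination reduces to 1 and is therefore invertible.\<close>

lemma restricted_bezout:
  fixes V H :: "'p::prime_card padic_int fps"
  assumes V: "V \<in> restricted_fps" "rps_residue V = fps_of_poly v"
    and H: "H \<in> restricted_fps" "rps_residue H = fps_of_poly w"
    and "coprime v w"
  obtains a b where "a \<in> restricted_fps" "b \<in> restricted_fps" "a * V + b * H = 1"
proof -
  obtain s t where st: "s * v + t * w = 1"
    using \<open>coprime v w\<close> by (metis bezout_coefficients_fst_snd coprime_iff_gcd_eq_1)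
  let ?s = "fps_of_poly (lift_poly s)" and ?t = "fps_of_poly (lift_poly t)"
  have "rps_residue (?s * V + ?t * H) = fps_of_poly (s * v + t * w)"
    by (simp add: rps_residue_add rps_residue_mult V H fps_of_poly_add fps_of_poly_mult)
  hence "rps_residue (?s * V + ?t * H) = 1" by (simp add: st)
  moreover have "?s * V + ?t * H \<in> restricted_fps"
    by (intro restricted_add restricted_mult V H restricted_fps_of_poly)
  ultimately obtain g where g: "g \<in> restricted_fps" "(?s * V + ?t * H) * g = 1"
    using restricted_inverse by blast
  show ?thesis
  proof (rule that)
    show "g * ?s \<in> restricted_fps" "g * ?t \<in> restricted_fps"
      by (intro restricted_mult g restricted_fps_of_poly)+
    show "g * ?s * V + g * ?t * H = 1" using g(2) by (simp add: algebra_simps)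
  qed
qed

lemma coprime_power_X:
  fixes Q :: "'k::field_gcd poly"
  assumes "poly Q 0 \<noteq> 0"
  shows "coprime Q ([:0, 1:] ^ e)"
proof -
  have "\<not> [:0, 1:] dvd Q" using assms poly_eq_0_iff_dvd[of Q 0] by simp
  moreover have "prime_elem ([:0, 1:] :: 'k poly)"
    by (intro irreducible_imp_prime_elem irreducible_linear_field_poly) auto
  ultimately have "coprime [:0, 1:] Q" by (intro prime_elem_imp_coprime)
  thus ?thesis by (simp add: coprime_commute)
qed

text \<open>Comparing reductions gives Q = u * v: the whole zero at the origin is carried by
  \<open>H\<close>, and the cofactor does not vanish there.\<close>

lemma local_factor_cofactor:
  fixes G :: "'p::prime_card padic_int fps"
  assumes G: "rps_residue G = fps_of_poly ([:0, 1:] ^ e * Q)" "poly Q 0 \<noteq> 0"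
    and H: "local_factor e G H"
  obtains u V v where "u dvd 1" "H \<in> restricted_fps" "rps_residue H = fps_of_poly (u * [:0, 1:] ^ e)"
    "V \<in> restricted_fps" "G = H * V" "rps_residue V = fps_of_poly v" "poly v 0 \<noteq> 0"
    "coprime v (u * [:0, 1:] ^ e)"
proof -
  obtain V u where V: "V \<in> restricted_fps" "G = H * V"
    and u: "u dvd 1" "rps_residue H = fps_of_poly (u * [:0, 1:] ^ e)"
    using H unfolding local_factor_def by blast
  obtain v where v: "rps_residue V = fps_of_poly v" using rps_residue_is_poly[OF V(1)] .
  have "fps_of_poly ([:0, 1:] ^ e * Q) = fps_of_poly (u * [:0, 1:] ^ e * v)"
    using G(1) unfolding V(2) rps_residue_mult u(2) v fps_of_poly_mult by simp
  hence "[:0, 1:] ^ e * Q = [:0, 1:] ^ e * (u * v)"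
    by (simp add: fps_of_poly_eq_iff ac_simps)
  hence "Q = u * v" by simp
  hence v0: "poly v 0 \<noteq> 0" using G(2) by auto
  have "coprime v (u * [:0, 1:] ^ e)"
    using coprime_power_X[OF v0, of e] u(1)
    by (simp add: is_unit_right_imp_coprime)
  thus ?thesis using that u V v v0 H unfolding local_factor_def by blast
qed

text \<open>Take a * V + b * H' = 1 for the cofactor \<open>V\<close> of \<open>H\<close> and
  multiply by \<open>H\<close>. Since H * V is \<open>G\<close>, a multiple of H', both summands are
  divisible by H'.\<close>

lemma local_factor_dvd:
  fixes G :: "'p::prime_card padic_int fps"
  assumes G: "rps_residue G = fps_of_poly ([:0, 1:] ^ e * Q)" "poly Q 0 \<noteq> 0"
    and H: "local_factor e G H" and H': "local_factor e G H'"
  shows "\<exists>W\<in>restricted_fps. H = W * H'"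
proof -
  obtain u V v where V: "V \<in> restricted_fps" "G = H * V" "rps_residue V = fps_of_poly v"
    "poly v 0 \<noteq> 0" and Hr: "H \<in> restricted_fps"
    using local_factor_cofactor[OF G H] by metis
  obtain u' V' where V': "V' \<in> restricted_fps" "G = H' * V'" "H' \<in> restricted_fps"
    and u': "u' dvd 1" "rps_residue H' = fps_of_poly (u' * [:0, 1:] ^ e)"
    using local_factor_cofactor[OF G H'] by metis
  have "coprime v (u' * [:0, 1:] ^ e)"
    using coprime_power_X[OF V(4), of e] u'(1) by (simp add: is_unit_right_imp_coprime)
  then obtain a b where ab: "a \<in> restricted_fps" "b \<in> restricted_fps" "a * V + b * H' = 1"
    using restricted_bezout[OF V(1,3) V'(3) u'(2)] by metis
  have "H = (a * V + b * H') * H" by (simp add: ab)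
  also have "\<dots> = a * (H * V) + b * H * H'" by (simp add: algebra_simps)
  also have "H * V = H' * V'" using V V' by simp
  finally have "H = (a * V' + b * H) * H'" by (simp add: algebra_simps)
  moreover have "a * V' + b * H \<in> restricted_fps"
    by (intro restricted_add restricted_mult ab V' Hr)
  ultimately show ?thesis by blast
qed

text \<open>Mutual divisibility in a domain; \<open>H\<close> can be cancelled because its
  reduction, and hence \<open>H\<close> itself, is nonzero.\<close>

lemma local_factor_unique_up_to_unit:
  fixes G :: "'p::prime_card padic_int fps"
  assumes G: "rps_residue G = fps_of_poly ([:0, 1:] ^ e * Q)" "poly Q 0 \<noteq> 0"
    and H: "local_factor e G H" and H': "local_factor e G H'"
  shows "\<exists>W. rps_unit W \<and> H' = W * H"
proof -
  obtain W W' where W: "W \<in> restricted_fps" "H = W * H'" and W': "W' \<in> restricted_fps" "H' = W' * H"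
    using local_factor_dvd[OF G] H H' by metis
  have "H \<noteq> 0"
  proof
    assume "H = 0"
    obtain u where "u dvd 1" "rps_residue H = fps_of_poly (u * [:0, 1:] ^ e)"
      using H unfolding local_factor_def by blast
    moreover have "rps_residue H = fps_of_poly 0"
      using \<open>H = 0\<close> by (simp add: rps_residue_def fps_eq_iff)
    ultimately show False by (simp only: fps_of_poly_eq_iff) auto
  qed
  moreover have "(W' * W) * H = 1 * H"
  proof -
    have "W * (W' * H) = H" by (simp only: W(2)[symmetric] W'(2)[symmetric])
    thus ?thesis by (simp add: ac_simps)
  qed
  ultimately have "W' * W = 1" by (metis mult_right_cancel)
  thus ?thesis using W W' unfolding rps_unit_def by blast
qed

text \<open>For t divisible by p the value of the cofactor reduces to v(0), which is nonzero, so it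
  is a unit and contributes no zeros.\<close>

lemma local_factor_zeros:
  fixes G :: "'p::prime_card padic_int fps"
  assumes G: "rps_residue G = fps_of_poly ([:0, 1:] ^ e * Q)" "poly Q 0 \<noteq> 0"
    and H: "local_factor e G H"
  obtains V where "\<And>t. rps_eval G t = rps_eval H t * rps_eval V t"
    "\<And>t. \<pi> dvd t \<Longrightarrow> \<not> \<pi> dvd rps_eval V t"
proof -
  obtain V v where V: "H \<in> restricted_fps" "V \<in> restricted_fps" "G = H * V"
    "rps_residue V = fps_of_poly v" "poly v 0 \<noteq> 0"
    using local_factor_cofactor[OF G H] by metis
  show ?thesis
  proof (rule that)
    show "rps_eval G t = rps_eval H t * rps_eval V t" for t
      unfolding V(3) by (rule rps_eval_mult) (rule V)+
    show "\<not> \<pi> dvd rps_eval V t" if "\<pi> dvd t" for t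
      using that V(5) unfolding padic_residue_eq_0_iff[symmetric] padic_residue_rps_eval[OF V(2,4)]
      by simp
  qed
qed

section \<open>Normalisation of the local factor to a monic polynomial\<close>

lemma monic_local_factor_residue:
  assumes h: "monic h" "degree h = e"
    and u: "u dvd 1" "rps_residue (fps_of_poly h) = fps_of_poly (u * [:0, 1:] ^ e)"
  shows "map_poly padic_residue h = [:0, 1:] ^ e"
proof -
  have eq: "map_poly padic_residue h = u * [:0, 1:] ^ e"
    using u(2) by (simp add: rps_residue_of_poly fps_of_poly_eq_iff)
  obtain k where k: "u = [:k:]" using u(1) by (metis is_unit_polyE)
  have "k = poly.coeff (u * [:0, 1:] ^ e) e"
    by (simp add: k coeff_linear_poly_power)
  also have "\<dots> = 1" using h by (simp flip: eq)
  finally show ?thesis using eq k by simp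
qed

text \<open>With k = W - 1, the product k * h is h' - h and has no coefficients in degree e or
  above. Modulo p, \<open>h\<close> is X^e, so multiplication by it merely shifts coefficients, and
  k must be divisible by p. Dividing by p preserves the vanishing in high degrees, so the argument
  repeats and k is zero.\<close>

lemma monic_local_factor_unique:
  fixes G :: "'p::prime_card padic_int fps"
  assumes G: "rps_residue G = fps_of_poly ([:0, 1:] ^ e * Q)" "poly Q 0 \<noteq> 0"
    and h: "monic h" "degree h = e" "local_factor e G (fps_of_poly h)"
    and h': "monic h'" "degree h' = e" "local_factor e G (fps_of_poly h')"
  shows "h = h'"
proof -
  obtain W where W: "fps_of_poly h' = W * fps_of_poly h"
    using local_factor_unique_up_to_unit[OF G h(3) h'(3)] by blast
  have res: "rps_residue (fps_of_poly h) = fps_X ^ e"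
    using monic_local_factor_residue[OF h(1,2)] h(3) unfolding local_factor_def
    by (metis rps_residue_of_poly fps_of_poly_power fps_of_poly_fps_X)
  define k where "k = W - 1"
  have top: "fps_nth (k * fps_of_poly h) n = 0" if "n \<ge> e" for n
  proof -
    have "k * fps_of_poly h = fps_of_poly (h' - h)"
      by (simp add: k_def algebra_simps W fps_of_poly_diff)
    thus ?thesis using that h h' by (cases "n = e") (auto simp: coeff_eq_0)
  qed
  have "fps_const (\<pi> ^ N) dvd k" for N
  proof (induction N)
    case (Suc N)
    then obtain g where g: "k = fps_const (\<pi> ^ N) * g" by auto
    have "fps_nth (g * fps_of_poly h) n = 0" if "n \<ge> e" for n
      using top[OF that] unfolding g mult.assoc by simp
    hence "fps_nth (rps_residue (g * fps_of_poly h)) (n + e) = 0" for n by simp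
    hence "fps_nth (rps_residue g * fps_X ^ e) (n + e) = 0" for n
      unfolding rps_residue_mult res .
    hence "rps_residue g = 0" by (simp add: fps_eq_iff fps_X_power_mult_right_nth)
    then obtain g' where "g = fps_const \<pi> * g'" unfolding rps_residue_eq_0_iff by auto
    hence "k = (fps_const (\<pi> ^ N) * fps_const \<pi>) * g'" by (simp only: g mult.assoc)
    also have "fps_const (\<pi> ^ N) * fps_const \<pi> = fps_const (\<pi> ^ Suc N)"
      by (simp add: mult.commute)
    finally show ?case by (rule dvdI)
  qed (simp add: fps_const_1_eq_1)
  hence "k = 0" by (auto simp: fps_const_dvd_iff fps_eq_iff intro: eq_0_if_prime_powers_dvd)
  thus "h = h'" using W by (simp add: k_def fps_of_poly_eq_iff)
qed

section \<open>Hensel lifting of the factorisation\<close>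

lemma fps_limit_exists:
  fixes X :: "nat \<Rightarrow> 'p::prime_card padic_int fps"
  assumes "\<And>n. fps_const (\<pi> ^ n) dvd X (Suc n) - X n"
  obtains x where "\<And>n. fps_const (\<pi> ^ n) dvd x - X n"
proof -
  have "\<exists>y. \<forall>n. \<pi> ^ n dvd y - fps_nth (X n) k" for k
    using assms by (intro padic_limit_exists) (auto simp: fps_const_dvd_iff)
  then obtain y where "\<And>n k. \<pi> ^ n dvd y k - fps_nth (X n) k" by metis
  hence "fps_const (\<pi> ^ n) dvd Abs_fps y - X n" for n by (simp add: fps_const_dvd_iff)
  thus ?thesis by (rule that)
qed

lemma coeff_X_power_eq:
  "poly.coeff ([:0, 1:] ^ e) n = (if n = e then 1 else (0 :: 'a::comm_semiring_1))"
  using coeff_monom[of "1 :: 'a" e n] by (simp add: monom_altdef)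

text \<open>
  One step of Hensel's lemma: the correction of the factors is found by solving the linearised
  equation over the residue field, where the two factors are coprime.
\<close>

lemma hensel_step:
  fixes G :: "'p::prime_card padic_int fps"
  assumes G: "G \<in> restricted_fps" and Q: "poly Q 0 \<noteq> 0"
    and h: "monic h" "degree h = e" "map_poly padic_residue h = [:0, 1:] ^ e"
    and V: "V \<in> restricted_fps" "rps_residue V = fps_of_poly Q"
    and n: "n > 0" "fps_const (\<pi> ^ n) dvd G - fps_of_poly h * V"
  shows "\<exists>h' V'. monic h' \<and> degree h' = e \<and> map_poly padic_residue h' = [:0, 1:] ^ e \<and>
    V' \<in> restricted_fps \<and> rps_residue V' = fps_of_poly Q \<and>
    fps_const (\<pi> ^ Suc n) dvd G - fps_of_poly h' * V' \<and>
    fps_const (\<pi> ^ n) dvd fps_of_poly h' - fps_of_poly h \<and> fps_const (\<pi> ^ n) dvd V' - V"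
proof -
  let ?X = "[:0, 1:] ^ e :: 'p mod_ring poly"
  obtain E where E: "G - fps_of_poly h * V = fps_const (\<pi> ^ n) * E" using n(2) by auto
  have "fps_const (\<pi> ^ n) * E \<in> restricted_fps"
    using restricted_diff[OF G restricted_mult[OF restricted_fps_of_poly V(1)]] E by metis
  hence "E \<in> restricted_fps" by (rule restricted_cancel)
  then obtain \<epsilon> where \<epsilon>: "rps_residue E = fps_of_poly \<epsilon>" by (rule rps_residue_is_poly)
  obtain s t where st: "s * Q + t * ?X = 1"
    using coprime_power_X[OF Q, of e] by (metis bezout_coefficients_fst_snd coprime_iff_gcd_eq_1)
  \<comment> \<open>Reducing modulo X^e keeps the correction below degree e, so that the new factor
    stays monic; the quotient is absorbed into \<open>b\<close>.\<close>
  define a where "a = (\<epsilon> * s) mod ?X"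
  define b where "b = \<epsilon> * t + (\<epsilon> * s) div ?X * Q"
  have ab: "a * Q + ?X * b = \<epsilon>"
  proof -
    have "a * Q + ?X * b = ((\<epsilon> * s) mod ?X + (\<epsilon> * s) div ?X * ?X) * Q + \<epsilon> * t * ?X"
      unfolding a_def b_def by (simp only: algebra_simps)
    also have "\<dots> = \<epsilon> * (s * Q + t * ?X)"
      unfolding mod_div_mult_eq by (simp only: algebra_simps)
    finally show ?thesis by (simp add: st)
  qed
  have a: "a = 0 \<or> degree a < e"
    using degree_mod_less[of ?X "\<epsilon> * s"] by (simp add: a_def degree_linear_power)
  have coeff_a: "poly.coeff (lift_poly a) i = 0" if "i \<ge> e" for i
    using a that by (auto simp: coeff_lift_poly coeff_eq_0)
  define h' where "h' = h + Polynomial.smult (\<pi> ^ n) (lift_poly a)"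
  define V' where "V' = V + fps_const (\<pi> ^ n) * fps_of_poly (lift_poly b)"
  have res0: "padic_residue (\<pi> ^ n * x) = 0" for x :: "'p padic_int"
    unfolding padic_residue_eq_0_iff using n(1) by (auto intro: dvd_mult2 dvd_power)
  have deg: "degree h' = e"
  proof (rule antisym)
    show "degree h' \<le> e" using h coeff_a by (intro degree_le) (auto simp: h'_def coeff_eq_0)
    show "e \<le> degree h'" using h coeff_a[of e] by (intro le_degree) (auto simp: h'_def)
  qed
  moreover have "monic h'" using h coeff_a[of e] deg by (simp add: h'_def)
  moreover have "map_poly padic_residue h' = ?X"
    using h(3) by (simp add: poly_eq_iff h'_def padic_residue.hom_add res0)
  moreover have "V' \<in> restricted_fps" unfolding V'_def
    by (intro restricted_add restricted_mult V restricted_fps_const restricted_fps_of_poly)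
  moreover have "rps_residue V' = fps_of_poly Q"
    using V(2) by (simp add: fps_eq_iff V'_def padic_residue.hom_add res0)
  moreover have "fps_const (\<pi> ^ n) dvd fps_of_poly h' - fps_of_poly h"
    by (simp add: h'_def fps_of_poly_add fps_of_poly_smult)
  moreover have "fps_const (\<pi> ^ n) dvd V' - V" by (simp add: V'_def)
  moreover have "fps_const (\<pi> ^ Suc n) dvd G - fps_of_poly h' * V'"
  proof -
    let ?a = "fps_of_poly (lift_poly a)" and ?b = "fps_of_poly (lift_poly b)"
    have "rps_residue (E - (?a * V + fps_of_poly h * ?b)) = fps_of_poly (\<epsilon> - (a * Q + ?X * b))"
      by (simp add: rps_residue_diff rps_residue_add rps_residue_mult \<epsilon> V(2)
          rps_residue_of_poly h(3) fps_of_poly_diff fps_of_poly_add fps_of_poly_mult)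
    hence "fps_const \<pi> dvd E - (?a * V + fps_of_poly h * ?b)"
      by (simp add: ab flip: rps_residue_eq_0_iff)
    \<comment> \<open>The product of the two corrections carries p^(2n), which is negligible at
      precision n + 1 because n > 0.\<close>
    moreover have "fps_const \<pi> dvd fps_const (\<pi> ^ n) * (?a * ?b)"
      using n(1) by (auto simp: fps_const_dvd_iff intro: dvd_mult2 dvd_power)
    ultimately have "fps_const (\<pi> ^ n) * fps_const \<pi> dvd fps_const (\<pi> ^ n) *
        (E - (?a * V + fps_of_poly h * ?b) - fps_const (\<pi> ^ n) * (?a * ?b))"
      by (intro mult_dvd_mono dvd_diff[of _ "E - _"] dvd_refl)
    also have "\<dots> = G - fps_of_poly h' * V'"
    proof -
      have "G = fps_of_poly h * V + fps_const (\<pi> ^ n) * E" using E by (simp add: algebra_simps)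
      thus ?thesis
        by (simp only: h'_def V'_def fps_of_poly_add fps_of_poly_smult) (simp only: algebra_simps)
    qed
    finally show ?thesis by (simp add: mult.commute)
  qed
  ultimately show ?thesis by blast
qed

lemma monic_local_factor_exists:
  fixes G :: "'p::prime_card padic_int fps"
  assumes G: "G \<in> restricted_fps" "rps_residue G = fps_of_poly ([:0, 1:] ^ e * Q)" "poly Q 0 \<noteq> 0"
  shows "\<exists>h. monic h \<and> degree h = e \<and> local_factor e G (fps_of_poly h)"
proof -
  \<comment> \<open>Stage \<open>n\<close> has precision n + 1: the initial factorisation holds
    modulo p, and \<open>hensel_step\<close> asks for a positive exponent.\<close>
  define P where "P = (\<lambda>n (h, V). monic h \<and> degree h = e \<and>
    map_poly padic_residue h = [:0, 1:] ^ e \<and> V \<in> restricted_fps \<and>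
    rps_residue V = fps_of_poly Q \<and> fps_const (\<pi> ^ Suc n) dvd G - fps_of_poly h * V)"
  define R where "R = (\<lambda>n (h :: 'p padic_int poly, V) (h', V').
    fps_const (\<pi> ^ Suc n) dvd fps_of_poly h' - fps_of_poly h \<and>
    fps_const (\<pi> ^ Suc n) dvd V' - (V :: 'p padic_int fps))"
  have "\<exists>f. \<forall>n. P n (f n) \<and> R n (f n) (f (Suc n))"
  proof (rule dependent_nat_choice)
    have X: "map_poly padic_residue ([:0, 1:] ^ e) = [:0, 1:] ^ e"
      by (simp add: poly_eq_iff coeff_X_power_eq)
    have "rps_residue G = rps_residue (fps_of_poly ([:0, 1:] ^ e) * fps_of_poly (lift_poly Q))"
      unfolding G(2) rps_residue_mult rps_residue_lift fps_of_poly_mult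
      by (simp add: rps_residue_of_poly X)
    hence "P 0 ([:0, 1:] ^ e, fps_of_poly (lift_poly Q))"
      by (simp add: P_def X rps_residue_eq_iff degree_linear_power coeff_X_power_eq)
    thus "\<exists>x. P 0 x" by blast
  next
    fix x n assume Px: "P n x"
    obtain h V where x: "x = (h, V)" by (cases x)
    show "\<exists>y. P (Suc n) y \<and> R n x y"
    proof -
      have "monic h" "degree h = e" "map_poly padic_residue h = [:0, 1:] ^ e"
        "V \<in> restricted_fps" "rps_residue V = fps_of_poly Q"
        "fps_const (\<pi> ^ Suc n) dvd G - fps_of_poly h * V"
        using Px unfolding P_def x prod.case by blast+
      from hensel_step[OF G(1,3) this(1-5) zero_less_Suc this(6)]
      obtain h' V' where "P (Suc n) (h', V')" "R n x (h', V')"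
        unfolding P_def R_def x prod.case by metis
      thus ?thesis by blast
    qed
  qed
  then obtain f where f: "\<And>n. P n (f n)" "\<And>n. R n (f n) (f (Suc n))" by blast
  define h V where "h = (\<lambda>n. fst (f n))" and "V = (\<lambda>n. snd (f n))"
  have h: "monic (h n)" "degree (h n) = e" "map_poly padic_residue (h n) = [:0, 1:] ^ e"
    and V: "V n \<in> restricted_fps" and GhV: "fps_const (\<pi> ^ Suc n) dvd G - fps_of_poly (h n) * V n"
    for n using f(1)[of n] unfolding P_def h_def V_def case_prod_unfold by blast+
  have weaken: "fps_const (\<pi> ^ Suc n) dvd g \<Longrightarrow> fps_const (\<pi> ^ n) dvd g"
    for n and g :: "'p padic_int fps"
    unfolding fps_const_dvd_iff by (meson dvd_trans le_imp_power_dvd le_SucI le_refl)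
  have "fps_const (\<pi> ^ n) dvd fps_of_poly (h (Suc n)) - fps_of_poly (h n)" for n
    using f(2)[of n] unfolding R_def h_def case_prod_unfold by (blast intro: weaken)
  then obtain H where H: "\<And>n. fps_const (\<pi> ^ n) dvd H - fps_of_poly (h n)"
    using fps_limit_exists[of "\<lambda>n. fps_of_poly (h n)"] by blast
  have "fps_const (\<pi> ^ n) dvd V (Suc n) - V n" for n
    using f(2)[of n] unfolding R_def V_def case_prod_unfold by (blast intro: weaken)
  then obtain W where W: "\<And>n. fps_const (\<pi> ^ n) dvd W - V n"
    using fps_limit_exists[of V] by blast
  \<comment> \<open>From degree e upwards all approximants have the same coefficients, so the limit
    is again a monic polynomial of degree e and not merely a series.\<close>
  have H_nth: "fps_nth H k = (if k = e then 1 else 0)" if "k \<ge> e" for k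
  proof -
    have "\<pi> ^ n dvd fps_nth H k - (if k = e then 1 else 0)" for n
      using H[of n] h[of n] that unfolding fps_const_dvd_iff
      by (cases "k = e") (auto simp: coeff_eq_0 dest!: spec[of _ k])
    from eq_0_if_prime_powers_dvd[OF this] show ?thesis by simp
  qed
  define hh where "hh = truncate_fps (Suc e) H"
  have hh: "fps_of_poly hh = H"
    by (auto simp: hh_def fps_eq_iff H_nth)
  have deg: "degree hh = e"
  proof (rule antisym)
    show "degree hh \<le> e" by (intro degree_le) (auto simp: hh_def)
    show "e \<le> degree hh" by (intro le_degree) (auto simp: hh_def H_nth)
  qed
  have "W \<in> restricted_fps" unfolding restricted_fps_iff_approx
  proof
    fix N
    obtain k where "fps_const (\<pi> ^ N) dvd V N - fps_of_poly k" using restricted_approx[OF V] .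
    hence "fps_const (\<pi> ^ N) dvd (W - V N) + (V N - fps_of_poly k)" using W by (intro dvd_add)
    thus "\<exists>k. fps_const (\<pi> ^ N) dvd W - fps_of_poly k" by auto
  qed
  moreover have "G = H * W"
  proof -
    have "fps_const (\<pi> ^ n) dvd G - H * W" for n
    proof -
      have "fps_const (\<pi> ^ n) dvd (G - fps_of_poly (h n) * V n) - (H * W - fps_of_poly (h n) * V n)"
        by (rule dvd_diff[OF weaken[OF GhV] fps_const_dvd_mult_diff[OF H W]])
      thus ?thesis by simp
    qed
    hence "fps_nth (G - H * W) k = 0" for k
      unfolding fps_const_dvd_iff by (intro eq_0_if_prime_powers_dvd) blast
    thus ?thesis by (simp add: fps_eq_iff)
  qed
  moreover have "rps_residue H = fps_of_poly (1 * [:0, 1:] ^ e)"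
    using H[of 1] h(3)[of 1] by (simp add: rps_residue_of_poly flip: rps_residue_eq_iff)
  ultimately have "local_factor e G (fps_of_poly hh)"
    unfolding local_factor_def hh
    using restricted_fps_of_poly[of hh] by (intro conjI bexI[of _ W] exI[of _ 1]) (simp_all add: hh)
  moreover have "monic hh" using deg by (simp add: hh_def H_nth)
  ultimately show ?thesis using deg by blast
qed


section \<open>Trace and norm of finite free algebras\<close>

text \<open>The basis is a parameter because several bases occur: a given one, its reduction modulo
  p, the arbitrary choice made in \<open>mult_matrix\<close>, and the powers of the
  generator.\<close>

locale free_algebra = comm_ring_hom \<phi>
  for \<phi> :: "'r::comm_ring_1 \<Rightarrow> 'a::comm_ring_1" +
  fixes es :: "'a list"
  assumes basis: "alg_basis \<phi> es"
begin

abbreviation coord :: "nat \<Rightarrow> 'a \<Rightarrow> 'r" where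
  "coord i x \<equiv> alg_coords \<phi> es x $ i"

lemma coord_expansion: "(\<Sum>i<length es. \<phi> (coord i x) * es ! i) = x"
  using theI'[OF basis[unfolded alg_basis_def, rule_format, of x]]
  unfolding alg_coords_def by metis

lemma alg_coords_carrier: "alg_coords \<phi> es x \<in> carrier_vec (length es)"
  using theI'[OF basis[unfolded alg_basis_def, rule_format, of x]]
  unfolding alg_coords_def by blast

lemma coord_eqI:
  assumes "x = (\<Sum>i<length es. \<phi> (f i) * es ! i)" "i < length es"
  shows "coord i x = f i"
proof -
  have "vec (length es) f \<in> carrier_vec (length es) \<and>
      x = (\<Sum>i<length es. \<phi> (vec (length es) f $ i) * es ! i)"
    using assms(1) by simp
  moreover have "alg_coords \<phi> es x \<in> carrier_vec (length es) \<and>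
      x = (\<Sum>i<length es. \<phi> (alg_coords \<phi> es x $ i) * es ! i)"
    using alg_coords_carrier coord_expansion[of x] by simp
  ultimately have "alg_coords \<phi> es x = vec (length es) f"
    using basis unfolding alg_basis_def by blast
  thus ?thesis using assms(2) by simp
qed

lemma eqI_coord: "x = y" if "\<And>i. i < length es \<Longrightarrow> coord i x = coord i y"
proof -
  have "(\<Sum>i<length es. \<phi> (coord i x) * es ! i) = (\<Sum>i<length es. \<phi> (coord i y) * es ! i)"
    using that by (intro sum.cong) auto
  thus ?thesis by (simp only: coord_expansion)
qed

lemma coord_add: "i < length es \<Longrightarrow> coord i (x + y) = coord i x + coord i y"
  by (rule coord_eqI) (simp add: hom_add distrib_right sum.distrib coord_expansion)

lemma coord_scale: "i < length es \<Longrightarrow> coord i (\<phi> k * x) = k * coord i x"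
  by (rule coord_eqI) (simp add: hom_mult mult.assoc coord_expansion flip: sum_distrib_left)

lemma coord_0: "i < length es \<Longrightarrow> coord i 0 = 0"
  by (rule coord_eqI) auto

lemma coord_sum: "i < length es \<Longrightarrow> coord i (sum f I) = (\<Sum>j\<in>I. coord i (f j))"
  by (induction I rule: infinite_finite_induct) (auto simp: coord_0 coord_add)

lemma coord_basis: "i < length es \<Longrightarrow> j < length es \<Longrightarrow> coord i (es ! j) = (if i = j then 1 else 0)"
  by (rule coord_eqI)
    (auto simp: if_distrib[of \<phi>] if_distrib[of "\<lambda>x. x * _"] sum.delta cong: if_cong)

text \<open>Expanding the second factor in the basis gives the product rule for multiplication
  matrices; the same identity serves in the change of basis.\<close>

lemma coord_mult:
  assumes "i < length es"
  shows "(\<Sum>k<length es. coord i (x * es ! k) * coord k w) = coord i (x * w)"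
proof -
  have "coord i (x * w) = coord i (x * (\<Sum>k<length es. \<phi> (coord k w) * es ! k))"
    by (simp only: coord_expansion)
  also have "\<dots> = coord i (\<Sum>k<length es. \<phi> (coord k w) * (x * es ! k))"
    by (simp add: sum_distrib_left ac_simps)
  also have "\<dots> = (\<Sum>k<length es. coord k w * coord i (x * es ! k))"
    using assms by (simp add: coord_sum coord_scale)
  finally show ?thesis by (simp add: mult.commute)
qed

lemma length_basis_pos: "length es > 0"
  using coord_expansion[of 1] by (cases es) auto

lemma dvd_coord: "\<phi> r dvd x \<Longrightarrow> i < length es \<Longrightarrow> r dvd coord i x"
  by (auto simp: coord_scale)

lemma adic_separated_image:
  assumes "adic_separated r"
  shows "adic_separated (\<phi> r)"
  unfolding adic_separated_def
proof (intro allI impI)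
  fix x assume *: "\<forall>N. \<phi> r ^ N dvd x"
  show "x = 0"
  proof (rule eqI_coord)
    fix i assume i: "i < length es"
    have "r ^ N dvd coord i x" for N
      using * i by (intro dvd_coord) (auto simp: hom_power)
    thus "coord i x = coord i 0" using assms i by (auto simp: adic_separated_def coord_0)
  qed
qed

definition basis_matrix :: "'a \<Rightarrow> 'r mat" where
  "basis_matrix x = mat (length es) (length es) (\<lambda>(i, j). coord i (x * es ! j))"

definition basis_trace :: "'a \<Rightarrow> 'r" where
  "basis_trace x = (\<Sum>i<length es. coord i (x * es ! i))"

lemma basis_trace_add: "basis_trace (x + y) = basis_trace x + basis_trace y"
  by (simp add: basis_trace_def distrib_right coord_add sum.distrib)

lemma basis_trace_scale: "basis_trace (\<phi> k * x) = k * basis_trace x"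
  by (simp add: basis_trace_def mult.assoc coord_scale sum_distrib_left)

lemma basis_matrix_mult: "basis_matrix x * basis_matrix y = basis_matrix (x * y)"
proof (rule eq_matI)
  fix i j assume "i < dim_row (basis_matrix (x * y))" "j < dim_col (basis_matrix (x * y))"
  thus "(basis_matrix x * basis_matrix y) $$ (i, j) = basis_matrix (x * y) $$ (i, j)"
    by (simp add: basis_matrix_def scalar_prod_def atLeast0LessThan coord_mult mult.assoc)
qed (auto simp: basis_matrix_def)

lemma basis_matrix_1: "basis_matrix 1 = 1\<^sub>m (length es)"
  by (rule eq_matI) (auto simp: basis_matrix_def coord_basis)

lemma basis_matrix_carrier: "basis_matrix x \<in> carrier_mat (length es) (length es)"
  by (simp add: basis_matrix_def)

lemma det_basis_matrix_unit:
  assumes "x dvd 1"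
  shows "det (basis_matrix x) dvd 1"
proof -
  obtain y where "1 = x * y" using assms by (rule dvdE)
  hence "det (basis_matrix x * basis_matrix y) = 1"
    by (simp only: basis_matrix_mult flip: \<open>1 = x * y\<close>) (simp add: basis_matrix_1)
  thus ?thesis
    unfolding det_mult[OF basis_matrix_carrier basis_matrix_carrier] by (intro dvdI) (rule sym)
qed

end

text \<open>
  The two bases may have different lengths here, since the length of the basis chosen in the
  definition of the trace is not known.
\<close>

lemma basis_trace_unique:
  assumes "free_algebra \<phi> es" "free_algebra \<phi> fs"
  shows "free_algebra.basis_trace \<phi> es x = free_algebra.basis_trace \<phi> fs x"
proof -
  interpret e: free_algebra \<phi> es by fact
  interpret f: free_algebra \<phi> fs by fact
  have "e.basis_trace x = (\<Sum>i<length es. e.coord i (x * (\<Sum>j<length fs. \<phi> (f.coord j (es ! i)) * fs ! j)))"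
    unfolding e.basis_trace_def by (simp only: f.coord_expansion)
  also have "\<dots> = (\<Sum>i<length es. e.coord i (\<Sum>j<length fs. \<phi> (f.coord j (es ! i)) * (x * fs ! j)))"
    by (simp add: sum_distrib_left ac_simps)
  also have "\<dots> = (\<Sum>i<length es. \<Sum>j<length fs. f.coord j (es ! i) * e.coord i (x * fs ! j))"
    by (simp add: e.coord_sum e.coord_scale)
  also have "\<dots> = (\<Sum>j<length fs. \<Sum>i<length es. e.coord i (x * fs ! j) * f.coord j (es ! i))"
    by (subst sum.swap) (simp add: mult.commute)
  also have "\<dots> = (\<Sum>j<length fs. f.coord j (\<Sum>i<length es. \<phi> (e.coord i (x * fs ! j)) * es ! i))"
    by (simp add: f.coord_sum f.coord_scale)
  also have "\<dots> = f.basis_trace x"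
    unfolding f.basis_trace_def by (simp only: e.coord_expansion)
  finally show ?thesis .
qed

text \<open>\<open>T\<close> and \<open>S\<close> are the transition matrices, square because the
  lengths agree. They are inverse to each other, and \<open>T\<close> intertwines the two
  multiplication matrices.\<close>

lemma det_basis_matrix_unique:
  assumes "free_algebra \<phi> es" "free_algebra \<phi> fs" "length es = length fs"
  shows "det (free_algebra.basis_matrix \<phi> es x) = det (free_algebra.basis_matrix \<phi> fs x)"
proof -
  interpret e: free_algebra \<phi> es by fact
  interpret f: free_algebra \<phi> fs by fact
  let ?n = "length fs"
  define T where "T = mat ?n ?n (\<lambda>(i, j). f.coord i (es ! j))"
  define S where "S = mat ?n ?n (\<lambda>(i, j). e.coord i (fs ! j))"
  have TS_carrier: "T \<in> carrier_mat ?n ?n" "S \<in> carrier_mat ?n ?n" by (auto simp: T_def S_def)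
  have M: "e.basis_matrix x \<in> carrier_mat ?n ?n" "f.basis_matrix x \<in> carrier_mat ?n ?n"
    using e.basis_matrix_carrier f.basis_matrix_carrier assms(3) by auto
  have expand: "(\<Sum>k<?n. f.coord i (es ! k) * e.coord k w) = f.coord i w" if "i < ?n" for i w
  proof -
    have "f.coord i w = f.coord i (\<Sum>k<?n. \<phi> (e.coord k w) * es ! k)"
      using e.coord_expansion[of w] by (simp only: assms(3))
    also have "\<dots> = (\<Sum>k<?n. f.coord i (es ! k) * e.coord k w)"
      using that by (simp add: f.coord_sum f.coord_scale mult.commute[of "f.coord _ _"])
    finally show ?thesis by simp
  qed
  have "T * S = 1\<^sub>m ?n"
    by (rule eq_matI)
      (auto simp: T_def S_def scalar_prod_def atLeast0LessThan expand f.coord_basis)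
  hence "det T * det S = 1" using det_mult[OF TS_carrier] by simp
  moreover have "T * e.basis_matrix x = f.basis_matrix x * T"
  proof (rule eq_matI)
    fix i j assume "i < dim_row (f.basis_matrix x * T)" "j < dim_col (f.basis_matrix x * T)"
    hence ij: "i < ?n" "j < ?n" using TS_carrier M by auto
    hence "(T * e.basis_matrix x) $$ (i, j) = f.coord i (x * es ! j)"
      using assms(3)
      by (simp add: T_def e.basis_matrix_def scalar_prod_def atLeast0LessThan expand)
    also have "\<dots> = (f.basis_matrix x * T) $$ (i, j)"
      using ij by (simp add: T_def f.basis_matrix_def scalar_prod_def atLeast0LessThan f.coord_mult)
    finally show "(T * e.basis_matrix x) $$ (i, j) = (f.basis_matrix x * T) $$ (i, j)" .
  qed (use TS_carrier M in auto)
  hence "det T * det (e.basis_matrix x) = det T * det (f.basis_matrix x)"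
    using det_mult[OF TS_carrier(1) M(1)] det_mult[OF M(2) TS_carrier(1)] by (simp add: mult.commute)
  \<comment> \<open>Zero divisors are possible, so det T is cancelled by means of its inverse det
    S.\<close>
  hence "det S * det T * det (e.basis_matrix x) = det S * det T * det (f.basis_matrix x)"
    by (simp only: mult.assoc)
  ultimately show ?thesis by (simp add: mult.commute)
qed

context free_algebra
begin

lemma chosen_free_algebra: "free_algebra \<phi> (SOME es. alg_basis \<phi> es)"
proof -
  have "alg_basis \<phi> (SOME es. alg_basis \<phi> es)" using basis by (rule someI)
  thus ?thesis by unfold_locales
qed

lemma mult_matrix_eq:
  "mult_matrix \<phi> x = free_algebra.basis_matrix \<phi> (SOME es. alg_basis \<phi> es) x"
  unfolding mult_matrix_def free_algebra.basis_matrix_def[OF chosen_free_algebra] by (simp add: Let_def)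

text \<open>This frees the trace from the choice made in \<open>mult_matrix\<close>: from here on it
  is computed in whichever basis is convenient.\<close>

lemma alg_trace_eq: "alg_trace \<phi> x = basis_trace x"
proof -
  let ?fs = "SOME es. alg_basis \<phi> es"
  interpret c: free_algebra \<phi> ?fs by (rule chosen_free_algebra)
  have "alg_trace \<phi> x = c.basis_trace x"
    unfolding alg_trace_def mult_matrix_eq c.basis_matrix_def c.basis_trace_def by simp
  also have "\<dots> = basis_trace x"
    by (rule basis_trace_unique) unfold_locales
  finally show ?thesis .
qed

lemma alg_trace_add: "alg_trace \<phi> (x + y) = alg_trace \<phi> x + alg_trace \<phi> y"
  by (simp add: alg_trace_eq basis_trace_add)

lemma alg_trace_scale: "alg_trace \<phi> (\<phi> k * x) = k * alg_trace \<phi> x"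
  by (simp add: alg_trace_eq basis_trace_scale)

lemma alg_trace_0: "alg_trace \<phi> 0 = 0"
  using alg_trace_scale[of 0 0] by simp

lemma alg_trace_sum: "alg_trace \<phi> (sum f I) = (\<Sum>i\<in>I. alg_trace \<phi> (f i))"
  by (induction I rule: infinite_finite_induct) (auto simp: alg_trace_0 alg_trace_add)

end


section \<open>Cubic algebras over a finite field\<close>

lemma coeff_0_char_poly:
  assumes "M \<in> carrier_mat n n"
  shows "poly.coeff (char_poly M) 0 = (-1) ^ n * det (M :: 'k::field mat)"
proof -
  have "poly.coeff (char_poly M) 0 = poly (char_poly M) 0" by (simp add: poly_0_coeff_0)
  also have "\<dots> = det (- char_matrix M 0)" by (rule char_poly_matrix[OF assms])
  also have "- char_matrix M 0 = (-1) \<cdot>\<^sub>m M"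
    using assms by (intro eq_matI) (auto simp: char_matrix_def)
  finally show ?thesis using assms by simp
qed

text \<open>The top row has at most one nonzero entry, f 0 in the last column. The complementary
  minor is the identity, and its sign is positive because 0 + 2 is even.\<close>

lemma det_companion_3:
  fixes f :: "nat \<Rightarrow> 'k::comm_ring_1"
  assumes "M = mat 3 3 (\<lambda>(i, j). if j = 2 then f i else if i = Suc j then 1 else 0)"
  shows "det M = f 0"
proof -
  have "det M = (\<Sum>j<3. M $$ (0, j) * cofactor M 0 j)"
    by (rule laplace_expansion_row) (auto simp: assms)
  also have "\<dots> = f 0 * cofactor M 0 2"
    by (simp add: assms numeral_3_eq_3 numeral_2_eq_2)
  also have "mat_delete M 0 2 = 1\<^sub>m 2"
    by (rule eq_matI) (auto simp: assms mat_delete_def)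
  hence "cofactor M 0 2 = 1" by (simp add: cofactor_def)
  finally show ?thesis by simp
qed

lemma finite_carrier_vec: "finite (carrier_vec n :: 'k::finite vec set)"
proof (rule finite_subset)
  show "carrier_vec n \<subseteq> vec_of_list ` {xs :: 'k list. set xs \<subseteq> UNIV \<and> length xs = n}"
  proof
    fix v :: "'k vec" assume "v \<in> carrier_vec n"
    thus "v \<in> vec_of_list ` {xs. set xs \<subseteq> UNIV \<and> length xs = n}"
      by (intro image_eqI[of _ _ "list_of_vec v"]) (auto simp: vec_list)
  qed
  show "finite (vec_of_list ` {xs :: 'k list. set xs \<subseteq> UNIV \<and> length xs = n})"
    by (intro finite_imageI finite_lists_length_eq) simp
qed

locale cubic_generator =
  fixes \<psi> :: "'k::{field,finite} \<Rightarrow> 'b::comm_ring_1" and bs :: "'b list"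
    and \<omega> :: 'b and f :: "'k poly" and z :: "nat \<Rightarrow> 'b"
  assumes free: "free_algebra \<psi> bs"
    and char_poly: "alg_char_poly \<psi> \<omega> = f" "degree f = 3"
    and dual: "\<And>i j. i < 3 \<Longrightarrow> j < 3 \<Longrightarrow>
      alg_trace \<psi> (\<omega> ^ i * z j) = (if i = j then 1 else 0)"
begin

sublocale free_algebra \<psi> bs by (rule free)

sublocale chosen: free_algebra \<psi> "SOME es. alg_basis \<psi> es" by (rule chosen_free_algebra)

text \<open>The degree of a characteristic polynomial is the size of its matrix, so the cubic
  \<open>f\<close> reveals the length of the basis picked by \<open>SOME\<close>.\<close>

lemma length_chosen: "length (SOME es. alg_basis \<psi> es) = 3"
proof -
  have "degree (alg_char_poly \<psi> \<omega>) = length (SOME es. alg_basis \<psi> es)"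
    unfolding alg_char_poly_def mult_matrix_eq
    using degree_monic_char_poly[OF chosen.basis_matrix_carrier] by blast
  thus ?thesis using char_poly by simp
qed

text \<open>Pairing a combination of the powers with \<open>z j\<close> under the trace recovers its
  j-th coefficient, which gives independence. Spanning follows by counting coordinate vectors over
  the finite field.\<close>

lemma alg_basis_powers: "alg_basis \<psi> [1, \<omega>, \<omega>\<^sup>2]"
proof -
  let ?fs = "[1, \<omega>, \<omega>\<^sup>2]"
  define L where "L = (\<lambda>v. \<Sum>i<3. \<psi> (v $ i) * \<omega> ^ i)"
  have fs: "?fs ! i = \<omega> ^ i" if "i < 3" for i
    using that by (auto simp: numeral_3_eq_3 less_Suc_eq power2_eq_square)
  have coeff: "alg_trace \<psi> (L v * z j) = v $ j" if "j < 3" for v j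
  proof -
    have "L v * z j = (\<Sum>i<3. \<psi> (v $ i) * (\<omega> ^ i * z j))"
      by (simp add: L_def sum_distrib_right mult.assoc)
    hence "alg_trace \<psi> (L v * z j) = (\<Sum>i<3. v $ i * (if i = j then 1 else 0))"
      using that by (simp add: alg_trace_sum alg_trace_scale dual)
    also have "\<dots> = v $ j" using that by (simp add: if_distrib cong: if_cong)
    finally show ?thesis .
  qed
  have inj: "inj_on L (carrier_vec 3)"
  proof (rule inj_onI)
    fix v w :: "'k vec" assume "v \<in> carrier_vec 3" "w \<in> carrier_vec 3" "L v = L w"
    thus "v = w" using coeff[of _ v] coeff[of _ w] by (intro eq_vecI) auto
  qed
  \<comment> \<open>\<open>g\<close> sends coordinates with respect to the powers to coordinates in
    the chosen basis; it is an injective self-map of a finite set and hence surjective.\<close>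
  define g where "g = (\<lambda>v. alg_coords \<psi> (SOME es. alg_basis \<psi> es) (L v))"
  have "inj_on g (carrier_vec 3)"
  proof (rule inj_onI)
    fix v w :: "'k vec" assume v: "v \<in> carrier_vec 3" "w \<in> carrier_vec 3" "g v = g w"
    hence "L v = L w" by (intro chosen.eqI_coord) (simp add: g_def)
    thus "v = w" using inj v by (auto dest: inj_onD)
  qed
  moreover have "g ` carrier_vec 3 \<subseteq> carrier_vec 3"
    using chosen.alg_coords_carrier by (auto simp: g_def length_chosen)
  ultimately have surj: "g ` carrier_vec 3 = carrier_vec 3"
    by (intro endo_inj_surj finite_carrier_vec)
  have "\<exists>!v. v \<in> carrier_vec 3 \<and> x = L v" for x
  proof -
    obtain v where v: "v \<in> carrier_vec 3" "alg_coords \<psi> (SOME es. alg_basis \<psi> es) x = g v"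
      using surj chosen.alg_coords_carrier[of x] length_chosen by (metis imageE)
    hence "x = L v" by (intro chosen.eqI_coord) (simp add: g_def)
    thus ?thesis using v inj by (auto dest: inj_onD)
  qed
  moreover have "L v = (\<Sum>i<length ?fs. \<psi> (v $ i) * ?fs ! i)" for v
    unfolding L_def by (rule sum.cong) (auto simp: fs)
  moreover have "length ?fs = 3" by simp
  ultimately show ?thesis unfolding alg_basis_def by metis
qed

sublocale powers: free_algebra \<psi> "[1, \<omega>, \<omega>\<^sup>2]"
  using alg_basis_powers by unfold_locales

text \<open>Both the chosen basis and the powers have length 3, which is what the comparison of
  determinants requires.\<close>

lemma alg_norm_eq: "alg_norm \<psi> x = det (powers.basis_matrix x)"
  unfolding alg_norm_def mult_matrix_eq
  by (rule det_basis_matrix_unique) (unfold_locales, simp add: length_chosen)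

lemma alg_norm_char_poly: "alg_norm \<psi> \<omega> = - poly.coeff f 0"
proof -
  have "poly.coeff f 0 = (-1) ^ 3 * alg_norm \<psi> \<omega>"
    unfolding char_poly(1)[symmetric] alg_char_poly_def alg_norm_def
    by (rule coeff_0_char_poly)
      (use chosen.basis_matrix_carrier[of \<omega>] in \<open>simp add: mult_matrix_eq length_chosen\<close>)
  thus ?thesis by simp
qed

lemma alg_norm_nonzero: "\<omega> dvd 1 \<Longrightarrow> alg_norm \<psi> \<omega> \<noteq> 0"
  using powers.det_basis_matrix_unit[of \<omega>] by (auto simp: alg_norm_eq)

lemma alg_trace_dual_cube: "alg_trace \<psi> (z 0 * \<omega> ^ 3) = alg_norm \<psi> \<omega>"
proof -
  define a where "a = (\<lambda>i. powers.coord i (\<omega> ^ 3))"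
  have fs: "[1, \<omega>, \<omega>\<^sup>2] ! i = \<omega> ^ i" if "i < 3" for i
    using that by (auto simp: numeral_3_eq_3 less_Suc_eq power2_eq_square)
  have "\<omega> ^ 3 = (\<Sum>i<3. \<psi> (a i) * \<omega> ^ i)"
  proof -
    have "\<omega> ^ 3 = (\<Sum>i<3. \<psi> (a i) * [1, \<omega>, \<omega>\<^sup>2] ! i)"
      using powers.coord_expansion[of "\<omega> ^ 3"]
      by (simp add: a_def numeral_3_eq_3 del: power_Suc)
    also have "\<dots> = (\<Sum>i<3. \<psi> (a i) * \<omega> ^ i)" by (intro sum.cong) (auto simp: fs)
    finally show ?thesis .
  qed
  hence "z 0 * \<omega> ^ 3 = (\<Sum>i<3. \<psi> (a i) * (\<omega> ^ i * z 0))"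
    by (simp add: sum_distrib_left ac_simps)
  hence "alg_trace \<psi> (z 0 * \<omega> ^ 3) = (\<Sum>i<3. a i * (if i = 0 then 1 else 0))"
    by (simp add: alg_trace_sum alg_trace_scale dual)
  also have "\<dots> = a 0" by (simp add: if_distrib cong: if_cong)
  also have "a 0 = det (powers.basis_matrix \<omega>)"
  proof (rule det_companion_3[symmetric])
    show "powers.basis_matrix \<omega> =
        mat 3 3 (\<lambda>(i, j). if j = 2 then a i else if i = Suc j then 1 else 0)"
    proof (rule eq_matI)
      fix i j :: nat
      assume "i < dim_row (mat 3 3 (\<lambda>(i, j). if j = 2 then a i else if i = Suc j then 1 else 0))"
        "j < dim_col (mat 3 3 (\<lambda>(i, j). if j = 2 then a i else if i = Suc j then 1 else 0))"
      hence ij: "i < 3" "j < 3" by auto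
      have "powers.basis_matrix \<omega> $$ (i, j) = powers.coord i (\<omega> * [1, \<omega>, \<omega>\<^sup>2] ! j)"
        using ij by (simp add: powers.basis_matrix_def numeral_3_eq_3)
      also have "\<dots> = powers.coord i (\<omega> ^ Suc j)" using ij by (simp add: fs)
      also have "\<dots> = (if j = 2 then a i else if i = Suc j then 1 else 0)"
      \<comment> \<open>Columns 0 and 1 move a basis vector to the next one; only column 2 leaves
        the basis and brings in the coordinates of \<omega>^3.\<close>
      proof (cases "j = 2")
        case False
        hence "Suc j < 3" using ij by simp
        hence "powers.coord i (\<omega> ^ Suc j) = (if i = Suc j then 1 else 0)"
          using powers.coord_basis[of i "Suc j", unfolded fs[OF \<open>Suc j < 3\<close>]] ij by simp
        thus ?thesis using False by simp
      qed (simp add: a_def numeral_3_eq_3)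
      finally show "powers.basis_matrix \<omega> $$ (i, j) =
          mat 3 3 (\<lambda>(i, j). if j = 2 then a i else if i = Suc j then 1 else 0) $$ (i, j)"
        using ij by simp
    qed (auto simp: powers.basis_matrix_def numeral_3_eq_3)
  qed
  finally show ?thesis by (simp add: alg_norm_eq)
qed

end


section \<open>Algebras over the p-adic integers and their reduction\<close>

lemma reduce_add: "reduce (x + y) = reduce x + reduce y"
  by transfer (rule equivp_reflp[OF modp_rel_equivp])

lemma reduce_mult: "reduce (x * y) = reduce x * reduce y"
  by transfer (rule equivp_reflp[OF modp_rel_equivp])

lemma reduce_0 [simp]: "reduce 0 = 0"
  by transfer (rule equivp_reflp[OF modp_rel_equivp])

lemma reduce_1 [simp]: "reduce 1 = 1"
  by transfer (rule equivp_reflp[OF modp_rel_equivp])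

interpretation reduce: comm_ring_hom "reduce :: 'a::comm_ring_1 \<Rightarrow> ('p::prime_card, 'a) modp"
  by standard (auto simp: reduce_add reduce_mult)

lemma reduce_surj: obtains x where "y = reduce x"
  by (transfer fixing: thesis) (metis equivp_reflp[OF modp_rel_equivp])

text \<open>The assumption excludes the degenerate case in which \<open>modp_rel\<close> is plain
  equality.\<close>

lemma reduce_eq_0_iff:
  assumes "\<not> of_nat CARD('p) dvd (1 :: 'a)"
  shows "(reduce x :: ('p::prime_card, 'a::comm_ring_1) modp) = 0 \<longleftrightarrow> of_nat CARD('p) dvd x"
  using assms by transfer (simp add: modp_rel_def)

lemma of_int_to_int_mod_ring: "of_int (to_int_mod_ring r) = (r :: 'p::prime_card mod_ring)"
  by (simp add: of_int_of_int_mod_ring)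

lemma adic_sums_add:
  assumes "adic_sums q f l" "adic_sums q g m"
  shows "adic_sums q (\<lambda>k. f k + g k) (l + m)"
  unfolding adic_sums_def
proof
  fix N
  obtain K L where "\<forall>k\<ge>K. q ^ N dvd (\<Sum>i<k. f i) - l" "\<forall>k\<ge>L. q ^ N dvd (\<Sum>i<k. g i) - m"
    using assms unfolding adic_sums_def by metis
  hence "\<forall>k\<ge>K + L. q ^ N dvd ((\<Sum>i<k. f i) - l) + ((\<Sum>i<k. g i) - m)"
    by (intro allI impI dvd_add) auto
  thus "\<exists>K. \<forall>k\<ge>K. q ^ N dvd (\<Sum>i<k. f i + g i) - (l + m)"
    by (intro exI[of _ "K + L"]) (simp add: sum.distrib algebra_simps)
qed

lemma adic_sums_sum:
  assumes "\<And>i. i \<in> I \<Longrightarrow> adic_sums q (f i) (l i)"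
  shows "adic_sums q (\<lambda>k. \<Sum>i\<in>I. f i k) (\<Sum>i\<in>I. l i)"
  using assms
proof (induction I rule: infinite_finite_induct)
  case (insert i I)
  thus ?case by (simp add: adic_sums_add)
qed (auto simp: adic_sums_def)

locale padic_algebra = free_algebra \<phi> es
  for \<phi> :: "'p::prime_card padic_int \<Rightarrow> 'a::comm_ring_1" and es
begin

lemma map_prime: "\<phi> \<pi> = of_nat CARD('p)"
  by (rule hom_of_nat)

lemma map_prime_power: "\<phi> (\<pi> ^ N) = of_nat CARD('p) ^ N"
  by (simp add: hom_power map_prime)

text \<open>Otherwise p would divide a basis vector and therefore its own coordinate 1.\<close>

lemma prime_not_unit: "\<not> of_nat CARD('p) dvd (1 :: 'a)"
proof
  assume "of_nat CARD('p) dvd (1 :: 'a)"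
  hence "\<phi> \<pi> dvd es ! 0" unfolding map_prime by (rule dvd_trans) simp
  hence "\<pi> dvd coord 0 (es ! 0)" using length_basis_pos by (rule dvd_coord)
  hence "\<pi> dvd (1 :: 'p padic_int)" using length_basis_pos by (simp add: coord_basis)
  thus False unfolding padic_residue_eq_0_iff[symmetric] by simp
qed

lemma reduce_prime: "of_nat CARD('p) = (0 :: ('p, 'a) modp)"
proof -
  have "reduce (of_nat CARD('p)) = (0 :: ('p, 'a) modp)"
    by (simp only: reduce_eq_0_iff[OF prime_not_unit] dvd_refl)
  thus ?thesis by (simp only: reduce.hom_of_nat)
qed

text \<open>\<open>of_fp\<close> passes through least representatives, so the homomorphism laws hold
  only up to multiples of p. These vanish in the quotient, and once arbitrary integers are allowed
  as arguments the laws are immediate.\<close>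

lemma of_fp_of_int: "of_fp (of_int m) = (of_int m :: ('p, 'a) modp)"
proof -
  have "to_int_mod_ring (of_int m :: 'p mod_ring) = m mod int CARD('p)"
    unfolding of_int_of_int_mod_ring by transfer simp
  hence "of_fp (of_int m) = (of_int (m mod int CARD('p)) :: ('p, 'a) modp)"
    by (simp add: of_fp_def)
  also have "\<dots> = of_int (m mod int CARD('p)) + of_nat CARD('p) * of_int (m div int CARD('p))"
    by (simp only: reduce_prime) simp
  also have "\<dots> = of_int (m mod int CARD('p) + int CARD('p) * (m div int CARD('p)))"
    by (simp only: of_int_add of_int_mult of_int_of_nat_eq)
  finally show ?thesis by simp
qed

lemma of_fp_hom: "comm_ring_hom (of_fp :: 'p mod_ring \<Rightarrow> ('p, 'a) modp)"
proof
  fix r s :: "'p mod_ring"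
  let ?r = "to_int_mod_ring r" and ?s = "to_int_mod_ring s"
  have "of_fp (of_int ?r + of_int ?s) = (of_fp (of_int ?r) + of_fp (of_int ?s) :: ('p, 'a) modp)"
    by (simp only: of_fp_of_int flip: of_int_add)
  thus "of_fp (r + s) = (of_fp r + of_fp s :: ('p, 'a) modp)" by (simp only: of_int_to_int_mod_ring)
  have "of_fp (of_int ?r * of_int ?s) = (of_fp (of_int ?r) * of_fp (of_int ?s) :: ('p, 'a) modp)"
    by (simp only: of_fp_of_int flip: of_int_mult)
  thus "of_fp (r * s) = (of_fp r * of_fp s :: ('p, 'a) modp)" by (simp only: of_int_to_int_mod_ring)
  show "of_fp (0 :: 'p mod_ring) = (0 :: ('p, 'a) modp)" "of_fp (1 :: 'p mod_ring) = (1 :: ('p, 'a) modp)"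
    using of_fp_of_int[of 0] of_fp_of_int[of 1] by simp_all
qed

text \<open>The square formed by the structure maps and the two reductions commutes; this transports
  basis expansions from A to A/pA.\<close>

lemma of_fp_residue: "of_fp (padic_residue k) = (reduce (\<phi> k) :: ('p, 'a) modp)"
proof -
  let ?m = "padic_trunc k 1"
  obtain w where w: "k - of_int ?m = \<pi> * w" using prime_power_dvd_diff_trunc[of 1 k] by auto
  hence k: "k = of_int ?m + \<pi> * w" by (simp add: algebra_simps)
  have "reduce (\<phi> k) = of_int ?m + reduce (of_nat CARD('p)) * reduce (\<phi> w)"
    by (subst k) (simp only: hom_add hom_mult map_prime hom_of_int reduce.hom_add reduce.hom_mult
        reduce.hom_of_int)
  also have "\<dots> = (of_int ?m :: ('p, 'a) modp)"
    by (simp only: reduce.hom_of_nat reduce_prime) simp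
  also have "\<dots> = of_fp (padic_residue k)"
    by (simp add: padic_residue_def flip: of_fp_of_int of_int_of_int_mod_ring)
  finally show ?thesis by simp
qed

lemma reduce_expansion:
  "reduce (\<Sum>i<length es. \<phi> (v i) * es ! i) =
    (\<Sum>i<length (map reduce es :: ('p, 'a) modp list).
      of_fp (padic_residue (v i)) * (map reduce es :: ('p, 'a) modp list) ! i)"
  by (simp add: reduce.hom_sum reduce.hom_mult of_fp_residue)

text \<open>For existence the coordinates of a lift are reduced. For uniqueness two coordinate
  vectors are lifted by least representatives: the difference of the lifted combinations is a
  multiple of p, hence so is each coordinate of it.\<close>

lemma reduced_basis: "alg_basis (of_fp :: 'p mod_ring \<Rightarrow> ('p, 'a) modp) (map reduce es)"
  unfolding alg_basis_def
proof
  fix x :: "('p, 'a) modp"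
  let ?n = "length (map reduce es :: ('p, 'a) modp list)"
  let ?S = "\<lambda>v. \<Sum>i<?n. of_fp (v $ i) * (map reduce es :: ('p, 'a) modp list) ! i"
  interpret of_fp: comm_ring_hom "of_fp :: 'p mod_ring \<Rightarrow> ('p, 'a) modp" by (rule of_fp_hom)
  obtain x' where x': "x = reduce x'" by (rule reduce_surj)
  have S_lift: "?S v = (reduce (\<Sum>i<length es. \<phi> (least_rep (v $ i)) * es ! i) :: ('p, 'a) modp)" for v
    unfolding reduce_expansion by simp
  show "\<exists>!v. v \<in> carrier_vec ?n \<and> x = ?S v"
  proof (rule ex_ex1I)
    have "x = ?S (vec ?n (\<lambda>i. padic_residue (coord i x')))"
      unfolding x' using reduce_expansion[of "\<lambda>i. coord i x'"] by (simp add: coord_expansion)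
    thus "\<exists>v. v \<in> carrier_vec ?n \<and> x = ?S v" using vec_carrier by blast
  next
    fix v w assume vw: "v \<in> carrier_vec ?n \<and> x = ?S v" "w \<in> carrier_vec ?n \<and> x = ?S w"
    let ?d = "\<lambda>i. least_rep (v $ i) - least_rep (w $ i)"
    have "?S v - ?S w = (reduce (\<Sum>i<length es. \<phi> (?d i) * es ! i) :: ('p, 'a) modp)"
      unfolding S_lift by (simp add: hom_minus left_diff_distrib sum_subtractf reduce.hom_minus)
    hence "(reduce (\<Sum>i<length es. \<phi> (?d i) * es ! i) :: ('p, 'a) modp) = 0" using vw by simp
    hence dvd: "\<phi> \<pi> dvd (\<Sum>i<length es. \<phi> (?d i) * es ! i)"
      by (simp only: reduce_eq_0_iff[OF prime_not_unit] map_prime)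
    show "v = w"
    proof (rule eq_vecI)
      fix i assume "i < dim_vec w"
      hence i: "i < length es" using vw by auto
      have "\<pi> dvd ?d i"
        using dvd_coord[OF dvd i] coord_eqI[OF refl i, of ?d] by simp
      hence "padic_residue (least_rep (v $ i)) = padic_residue (least_rep (w $ i))"
        by (simp only: padic_residue_eq_iff)
      thus "v $ i = w $ i" by simp
    qed (use vw in auto)
  qed
qed

lemma reduced_free_algebra:
  "free_algebra (of_fp :: 'p mod_ring \<Rightarrow> ('p, 'a) modp) (map reduce es)"
proof -
  interpret of_fp: comm_ring_hom "of_fp :: 'p mod_ring \<Rightarrow> ('p, 'a) modp" by (rule of_fp_hom)
  show ?thesis using reduced_basis by unfold_locales
qed

text \<open>Coordinates in the reduced basis are the residues of coordinates in \<open>es\<close>,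
  so the trace commutes with base change.\<close>

lemma alg_trace_reduce:
  "alg_trace of_fp (reduce x :: ('p, 'a) modp) = padic_residue (alg_trace \<phi> x)"
proof -
  interpret red: free_algebra "of_fp :: 'p mod_ring \<Rightarrow> ('p, 'a) modp" "map reduce es"
    by (rule reduced_free_algebra)
  have coord: "red.coord i (reduce w) = padic_residue (coord i w)" if "i < length es" for i w
  proof (rule red.coord_eqI)
    show "reduce w = (\<Sum>i<length (map reduce es :: ('p, 'a) modp list).
        of_fp (padic_residue (coord i w)) * (map reduce es :: ('p, 'a) modp list) ! i)"
      unfolding reduce_expansion[symmetric] coord_expansion ..
  qed (use that in simp)
  have "red.basis_trace (reduce x) = (\<Sum>i<length es. red.coord i (reduce (x * es ! i)))"
    unfolding red.basis_trace_def by (simp add: reduce_mult)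
  also have "\<dots> = padic_residue (basis_trace x)"
    unfolding basis_trace_def by (simp add: coord padic_residue.hom_sum)
  finally show ?thesis by (simp add: alg_trace_eq red.alg_trace_eq)
qed

section \<open>Completeness of the algebra and continuity of the trace\<close>

lemma adic_separated_prime: "adic_separated (of_nat CARD('p) :: 'a)"
  using adic_separated_image[OF adic_separated_padic_prime] by (simp add: map_prime)

text \<open>A finite free module over a complete ring is complete: the sums are formed in each
  coordinate and then reassembled.\<close>

lemma alg_suminf:
  fixes f :: "nat \<Rightarrow> 'a"
  assumes "adic_null (of_nat CARD('p)) f"
  shows "adic_sums (of_nat CARD('p)) f (adic_suminf (of_nat CARD('p)) f)"
proof -
  have "\<exists>l. adic_sums \<pi> (\<lambda>k. coord i (f k)) l" if i: "i < length es" for i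
  proof (rule padic_adic_sums_exists, unfold adic_null_def, rule allI)
    fix N
    obtain K where "\<forall>k\<ge>K. \<phi> (\<pi> ^ N) dvd f k"
      using assms unfolding adic_null_def map_prime_power by blast
    thus "\<exists>K. \<forall>k\<ge>K. \<pi> ^ N dvd coord i (f k)" using dvd_coord i by blast
  qed
  then obtain l where l: "\<And>i. i < length es \<Longrightarrow> adic_sums \<pi> (\<lambda>k. coord i (f k)) (l i)" by metis
  have "adic_sums (of_nat CARD('p)) (\<lambda>k. \<phi> (coord i (f k)) * es ! i) (\<phi> (l i) * es ! i)"
    if "i < length es" for i
  proof (rule adic_sums_additive_image[where L = "\<lambda>k. \<phi> k * es ! i", OF _ _ l[OF that]])
    show "of_nat CARD('p) ^ N dvd \<phi> x * es ! i" if "\<pi> ^ N dvd x" for N x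
      using hom_dvd[OF that] unfolding map_prime_power by simp
  qed (simp add: hom_add distrib_right)
  hence "adic_sums (of_nat CARD('p)) (\<lambda>k. \<Sum>i<length es. \<phi> (coord i (f k)) * es ! i)
      (\<Sum>i<length es. \<phi> (l i) * es ! i)"
    by (intro adic_sums_sum) auto
  thus ?thesis
    unfolding coord_expansion using adic_suminf_eqI[OF adic_separated_prime] by metis
qed

text \<open>The scalars \<open>a k\<close> are arbitrary because two cases are needed: coefficients
  of the scaled binomial polynomials, which give the series, and their values, which give the
  function.\<close>

lemma alg_trace_suminf:
  assumes "adic_null \<pi> a"
  shows "adic_sums \<pi> (\<lambda>k. a k * alg_trace \<phi> (y * U ^ k))
    (alg_trace \<phi> (y * adic_suminf (of_nat CARD('p)) (\<lambda>k. \<phi> (a k) * U ^ k)))"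
proof -
  have "adic_null (of_nat CARD('p)) (\<lambda>k. \<phi> (a k) * U ^ k)"
    unfolding adic_null_def
  proof
    fix N
    obtain K where "\<forall>k\<ge>K. \<pi> ^ N dvd a k" using assms unfolding adic_null_def by blast
    hence "\<forall>k\<ge>K. of_nat CARD('p) ^ N dvd \<phi> (a k) * U ^ k"
      using hom_dvd unfolding map_prime_power[symmetric] by (metis dvd_mult2)
    thus "\<exists>K. \<forall>k\<ge>K. of_nat CARD('p) ^ N dvd \<phi> (a k) * U ^ k" by blast
  qed
  from alg_suminf[OF this]
  have "adic_sums \<pi> (\<lambda>k. alg_trace \<phi> (y * (\<phi> (a k) * U ^ k)))
    (alg_trace \<phi> (y * adic_suminf (of_nat CARD('p)) (\<lambda>k. \<phi> (a k) * U ^ k)))"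
  proof (rule adic_sums_additive_image[rotated 2])
    show "\<pi> ^ N dvd alg_trace \<phi> (y * x)" if dvd: "of_nat CARD('p) ^ N dvd x" for N x
    proof -
      obtain w where "x = \<phi> (\<pi> ^ N) * w" using dvd unfolding map_prime_power[symmetric] by auto
      hence "y * x = \<phi> (\<pi> ^ N) * (y * w)" by (simp only: ac_simps)
      thus ?thesis by (simp add: alg_trace_scale)
    qed
  qed (simp add: distrib_left alg_trace_add)
  moreover have "y * (\<phi> (a k) * U ^ k) = \<phi> (a k) * (y * U ^ k)" for k by (simp add: ac_simps)
  ultimately show ?thesis by (simp add: alg_trace_scale)
qed

end


section \<open>Divisibility of factorials\<close>

text \<open>Strictly between consecutive multiples of p no factor is divisible by p, while the
  factor p * m contributes one more than the multiplicity of \<open>m\<close>. Iterating this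
  recursion gives Legendre's formula.\<close>

lemma multiplicity_fact_mult:
  fixes p :: nat
  assumes p: "prime p"
  shows "multiplicity p (fact (p * m) :: nat) = m + multiplicity p (fact m :: nat)"
    and "r < p \<Longrightarrow> multiplicity p (fact (p * m + r) :: nat) = multiplicity p (fact (p * m) :: nat)"
proof -
  have pe: "prime_elem p" using p by simp
  have step: "multiplicity p (fact (Suc n) :: nat) = multiplicity p (Suc n) + multiplicity p (fact n :: nat)" for n
    unfolding fact_Suc of_nat_id by (intro prime_elem_multiplicity_mult_distrib pe) auto
  have block: "multiplicity p (fact (p * m + r) :: nat) = multiplicity p (fact (p * m) :: nat)"
    if "r < p" for m r
    using that
  proof (induction r)
    case (Suc r)
    have "\<not> p dvd Suc (p * m + r)"
    proof
      assume "p dvd Suc (p * m + r)"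
      hence "p dvd p * m + Suc r" by simp
      hence "p dvd Suc r" by (simp only: dvd_add_right_iff[OF dvd_triv_left])
      thus False using Suc.prems by (auto dest: dvd_imp_le)
    qed
    thus ?case using Suc by (simp add: step not_dvd_imp_multiplicity_0 del: fact_Suc)
  qed simp
  show "multiplicity p (fact (p * m + r) :: nat) = multiplicity p (fact (p * m) :: nat)" if "r < p"
    by (rule block[OF that])
  show "multiplicity p (fact (p * m) :: nat) = m + multiplicity p (fact m :: nat)"
  proof (induction m)
    case (Suc m)
    have "p * Suc m = Suc (p * m + (p - 1))" using prime_gt_0_nat[OF p] by simp
    hence "multiplicity p (fact (p * Suc m) :: nat)
        = multiplicity p (p * Suc m) + multiplicity p (fact (p * m + (p - 1)) :: nat)"
      using step by metis
    also have "\<dots> = 1 + multiplicity p (Suc m) + (m + multiplicity p (fact m :: nat))"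
      using block[of "p - 1" m] prime_gt_0_nat[OF p] Suc pe
      by (simp add: prime_elem_multiplicity_mult_distrib multiplicity_self prime_elem_not_unit
          del: fact_Suc mult_Suc_right)
    finally show ?case by (simp only: step)
  qed simp
qed

text \<open>With m = k div p > 0, the recursion v(k!) = m + v(m!) and the induction hypothesis give
  (p - 1) * v(k!) < (p - 1) * m + m = p * m \<le> k. For m = 0 the multiplicity is zero.\<close>

lemma multiplicity_fact_less:
  fixes p :: nat
  assumes p: "prime p" and "k > 0"
  shows "(p - 1) * multiplicity p (fact k :: nat) < k"
  using \<open>k > 0\<close>
proof (induction k rule: less_induct)
  case (less k)
  let ?m = "k div p"
  have p1: "p > 1" using p by (rule prime_gt_1_nat)
  have "multiplicity p (fact k :: nat) = ?m + multiplicity p (fact ?m :: nat)"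
    using multiplicity_fact_mult[OF p, of ?m] multiplicity_fact_mult(2)[OF p, of "k mod p" ?m] p1
    by simp
  hence eq: "(p - 1) * multiplicity p (fact k :: nat)
      = (p - 1) * ?m + (p - 1) * multiplicity p (fact ?m :: nat)"
    by (simp add: distrib_left)
  show ?case
  proof (cases "?m = 0")
    case False
    hence "(p - 1) * multiplicity p (fact ?m :: nat) < ?m" using less p1 by (intro less.IH) auto
    hence "(p - 1) * multiplicity p (fact k :: nat) < (p - 1) * ?m + ?m" using eq by simp
    also have "\<dots> = p * ?m" using p1 by (cases p) auto
    also have "\<dots> \<le> k" by simp
    finally show ?thesis .
  qed (use eq less p1 in auto)
qed

text \<open>The divisor 4 is the least possible value of p - 1. Using k - 1 instead of k keeps the
  strictness of the estimate, without which the term k = 4 would lose one digit; truncated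
  subtraction covers k = 0.\<close>

lemma fact_decompose:
  assumes "CARD('p::prime_card) \<ge> 5"
  obtains v u u' where "fact k = \<pi> ^ v * (u :: 'p padic_int)" "u * u' = 1" "v \<le> (k - 1) div 4"
proof -
  let ?p = "CARD('p)"
  define v where "v = multiplicity ?p (fact k :: nat)"
  have "?p ^ v dvd fact k" unfolding v_def by (rule multiplicity_dvd)
  then obtain n where n: "fact k = ?p ^ v * n" by auto
  have "\<not> ?p dvd n"
  proof
    assume "?p dvd n"
    hence "?p ^ Suc v dvd fact k" unfolding n by (simp add: mult.commute mult_dvd_mono)
    hence "Suc v \<le> v" unfolding v_def
      using prime_gt_1_nat[OF prime_card[where 'a = 'p]] by (intro multiplicity_geI) auto
    thus False by simp
  qed
  hence "(of_nat n :: 'p padic_int) dvd 1"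
    using of_nat_0_mod_ring_dvd[where 'a = 'p, of n]
    by (auto simp: padic_unit_iff padic_residue.hom_of_nat)
  then obtain u' where "(of_nat n :: 'p padic_int) * u' = 1" by (metis dvdE)
  moreover have "fact k = \<pi> ^ v * (of_nat n :: 'p padic_int)"
    using arg_cong[OF n, of "of_nat :: nat \<Rightarrow> 'p padic_int"] by simp
  moreover have "v \<le> (k - 1) div 4"
  proof (cases "k = 0")
    case False
    hence "(?p - 1) * v < k"
      unfolding v_def using multiplicity_fact_less[OF prime_card[where 'a = 'p]] by blast
    moreover have "4 * v \<le> (?p - 1) * v" using assms by (intro mult_right_mono) auto
    ultimately have "4 * v \<le> k - 1" by linarith
    thus ?thesis by simp
  qed (simp add: v_def)
  ultimately show ?thesis using that by blast
qed

text \<open>If k! is p^v times a unit, the quotient is p^(k - v) times the inverse unit, and v is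
  bounded by (k - 1) div 4.\<close>

lemma fact_mult_prime_power_div_fact:
  assumes "CARD('p::prime_card) \<ge> 5"
  shows "fact k * (\<pi> ^ k div fact k) = (\<pi> ^ k :: 'p padic_int)"
    and "\<pi> ^ (k - (k - 1) div 4) dvd (\<pi> ^ k div fact k :: 'p padic_int)"
proof -
  obtain v u u' where u: "fact k = \<pi> ^ v * (u :: 'p padic_int)" "u * u' = 1" "v \<le> (k - 1) div 4"
    using fact_decompose[OF assms] .
  have "\<pi> ^ k = \<pi> ^ v * \<pi> ^ (k - v)" using u(3) by (simp flip: power_add)
  hence eq: "\<pi> ^ k = fact k * (\<pi> ^ (k - v) * u')"
    by (metis (no_types, opaque_lifting) u(1,2) mult.assoc mult.commute mult.left_commute mult_1_right)
  thus "fact k * (\<pi> ^ k div fact k) = (\<pi> ^ k :: 'p padic_int)" by simp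
  have "\<pi> ^ k div fact k = \<pi> ^ (k - v) * u'" by (simp add: eq)
  moreover have "\<pi> ^ (k - (k - 1) div 4) dvd (\<pi> ^ (k - v) :: 'p padic_int)"
    using u(3) by (intro le_imp_power_dvd) auto
  ultimately show "\<pi> ^ (k - (k - 1) div 4) dvd (\<pi> ^ k div fact k :: 'p padic_int)" by simp
qed

lemma prod_of_nat_diff: "(\<Prod>i<k. of_nat n - of_nat i) = (of_nat (fact k * (n choose k)) :: 'a::comm_ring_1)"
proof (induction k)
  case (Suc k)
  show ?case
  proof (cases "k \<le> n")
    case True
    have "Suc k * (n choose Suc k) = (n - k) * (n choose k)"
      by (simp only: binomial_absorption binomial_absorb_comp)
    hence "fact (Suc k) * (n choose Suc k) = fact k * (n choose k) * (n - k)"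
      by (simp only: fact_Suc of_nat_id) (metis mult.assoc mult.commute)
    thus ?thesis using Suc True by (simp only: prod.lessThan_Suc of_nat_mult of_nat_diff)
  qed (use Suc in \<open>simp add: binomial_eq_0\<close>)
qed simp

text \<open>
  The integrality of binomial coefficients of \<open>p\<close>-adic integers is inherited from the natural
  numbers, which are dense.
\<close>

lemma fact_dvd_prod_diff:
  fixes t :: "'p::prime_card padic_int"
  assumes "CARD('p) \<ge> 5"
  shows "fact k dvd (\<Prod>i<k. t - of_nat i)"
proof -
  obtain v u u' where u: "fact k = \<pi> ^ v * (u :: 'p padic_int)" "u * u' = 1"
    using fact_decompose[OF assms] by metis
  \<comment> \<open>A natural number congruent to \<open>t\<close> modulo the exact power of p in
    k!.\<close>
  define n where "n = nat (padic_trunc t v)"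
  have "of_int (padic_trunc t v) = (of_nat n :: 'p padic_int)"
    using padic_trunc_range[of t v] by (simp add: n_def)
  hence tn: "\<pi> ^ v dvd t - of_nat n" using prime_power_dvd_diff_trunc[of v t] by simp
  have "\<pi> ^ v dvd (\<Prod>i<j. t - of_nat i) - (\<Prod>i<j. of_nat n - of_nat i)" for j
  proof (induction j)
    case (Suc j)
    have "(\<Prod>i<Suc j. t - of_nat i) - (\<Prod>i<Suc j. of_nat n - of_nat i) =
        ((\<Prod>i<j. t - of_nat i) - (\<Prod>i<j. of_nat n - of_nat i)) * (t - of_nat j)
        + (\<Prod>i<j. of_nat n - of_nat i) * (t - of_nat n)"
      by (simp add: algebra_simps)
    thus ?case using Suc tn by (metis dvd_add dvd_mult dvd_mult2)
  qed simp
  from this[of k] have "\<pi> ^ v dvd (\<Prod>i<k. t - of_nat i) - fact k * of_nat (n choose k)"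
    by (simp add: prod_of_nat_diff)
  moreover have "\<pi> ^ v dvd fact k * (of_nat (n choose k) :: 'p padic_int)" by (simp add: u(1))
  ultimately have "\<pi> ^ v dvd (\<Prod>i<k. t - of_nat i) - fact k * of_nat (n choose k)
      + fact k * of_nat (n choose k)" by (rule dvd_add)
  hence "\<pi> ^ v dvd (\<Prod>i<k. t - of_nat i)" by simp
  moreover have "fact k * u' = (\<pi> ^ v :: 'p padic_int)" by (simp add: u mult.assoc)
  ultimately show ?thesis by (metis dvd_trans dvd_triv_left)
qed


section \<open>The binomial series\<close>

text \<open>\<open>padic_binomial\<close> divides the product by k!, whereas
  \<open>scaled_binomial_poly\<close> divides p^k by it. Both divisions are exact, so multiplying by
  k! compares them.\<close>

lemma padic_binomial_mult_prime_power:
  fixes t :: "'p::prime_card padic_int"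
  assumes "CARD('p) \<ge> 5"
  shows "padic_binomial t k * \<pi> ^ k = poly (scaled_binomial_poly k) t"
proof -
  have "fact k * (padic_binomial t k * \<pi> ^ k) = (\<Prod>i<k. t - of_nat i) * \<pi> ^ k"
    using fact_dvd_prod_diff[OF assms, of k t] by (simp add: padic_binomial_def flip: mult.assoc)
  also have "\<dots> = fact k * (\<pi> ^ k div fact k) * (\<Prod>i<k. t - of_nat i)"
    by (simp only: fact_mult_prime_power_div_fact[OF assms] mult.commute)
  also have "\<dots> = fact k * poly (scaled_binomial_poly k) t"
    by (simp add: scaled_binomial_poly_def poly_prod mult.assoc algebra_simps)
  finally show ?thesis by simp
qed

lemma prime_power_dvd_scaled_binomial:
  assumes "CARD('p::prime_card) \<ge> 5" "N \<le> k - (k - 1) div 4"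
  shows "\<pi> ^ N dvd poly.coeff (scaled_binomial_poly k :: 'p padic_int poly) n"
    and "\<pi> ^ N dvd poly (scaled_binomial_poly k :: 'p padic_int poly) t"
proof -
  have "\<pi> ^ N dvd (\<pi> ^ k div fact k :: 'p padic_int)"
    using fact_mult_prime_power_div_fact(2)[OF assms(1)] le_imp_power_dvd[OF assms(2)]
    by (metis dvd_trans)
  thus "\<pi> ^ N dvd poly.coeff (scaled_binomial_poly k :: 'p padic_int poly) n"
    and "\<pi> ^ N dvd poly (scaled_binomial_poly k :: 'p padic_int poly) t"
    by (auto simp: scaled_binomial_poly_def)
qed

context padic_algebra
begin

text \<open>The common approximation of \<open>trace_fps\<close> and \<open>trace_fun\<close>
  through which the two are identified.\<close>

definition partial_trace_poly :: "'a \<Rightarrow> 'a \<Rightarrow> 'p padic_int \<Rightarrow> nat \<Rightarrow> 'p padic_int poly" where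
  "partial_trace_poly y U c K =
    (\<Sum>k<K. Polynomial.smult (alg_trace \<phi> (y * U ^ k)) (scaled_binomial_poly k)) - [:c:]"

lemma trace_fps_approx:
  assumes p5: "CARD('p) \<ge> 5" and K: "\<And>k. k \<ge> K \<Longrightarrow> N \<le> k - (k - 1) div 4"
  shows "fps_const (\<pi> ^ N) dvd trace_fps \<phi> y U c - fps_of_poly (partial_trace_poly y U c K)"
  unfolding fps_const_dvd_iff
proof
  fix n
  let ?a = "\<lambda>k. poly.coeff (scaled_binomial_poly k :: 'p padic_int poly) n"
  \<comment> \<open>The exponent \<open>k - (k - 1) div 4\<close> is at least k / 2, so precision M
    is reached from k = 2 * M on.\<close>
  have "\<forall>k\<ge>2 * M. \<pi> ^ M dvd ?a k" for M
    using prime_power_dvd_scaled_binomial(1)[OF p5] by auto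
  hence null: "adic_null \<pi> ?a" unfolding adic_null_def by blast
  have sums: "adic_sums \<pi> (\<lambda>k. ?a k * alg_trace \<phi> (y * U ^ k))
      (fps_nth (trace_fps \<phi> y U c) n + fps_nth (fps_const c) n)"
    using alg_trace_suminf[OF null, of y U] by (simp add: trace_fps_def padic_power_fps_def)
  have "\<pi> ^ N dvd fps_nth (trace_fps \<phi> y U c) n + fps_nth (fps_const c) n -
      (\<Sum>k<K. ?a k * alg_trace \<phi> (y * U ^ k))"
    by (rule adic_sums_partial[OF sums]) (intro dvd_mult2 prime_power_dvd_scaled_binomial p5 K)
  also have "\<dots> = fps_nth (trace_fps \<phi> y U c - fps_of_poly (partial_trace_poly y U c K)) n"
    by (cases n) (simp_all add: partial_trace_poly_def coeff_sum mult.commute)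
  finally show "\<pi> ^ N dvd \<dots>" .
qed

lemma trace_fun_approx:
  assumes p5: "CARD('p) \<ge> 5" and K: "\<And>k. k \<ge> K \<Longrightarrow> N \<le> k - (k - 1) div 4"
  shows "\<pi> ^ N dvd trace_fun \<phi> y (1 + of_nat CARD('p) * U) c t - poly (partial_trace_poly y U c K) t"
proof -
  let ?a = "\<lambda>k. poly (scaled_binomial_poly k) t"
  have "\<forall>k\<ge>2 * M. \<pi> ^ M dvd ?a k" for M
    using prime_power_dvd_scaled_binomial(2)[OF p5] by auto
  hence null: "adic_null \<pi> ?a" unfolding adic_null_def by blast
  \<comment> \<open>Since w - 1 = p U, the factor p^k moves from the power of w - 1 into the scaled
    binomial polynomial.\<close>
  have "\<phi> (padic_binomial t k) * (1 + of_nat CARD('p) * U - 1) ^ k = \<phi> (?a k) * U ^ k" for k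
    by (simp add: power_mult_distrib hom_mult hom_power mult.assoc
        flip: padic_binomial_mult_prime_power[OF p5] map_prime)
  hence "adic_sums \<pi> (\<lambda>k. ?a k * alg_trace \<phi> (y * U ^ k))
      (trace_fun \<phi> y (1 + of_nat CARD('p) * U) c t + c)"
    using alg_trace_suminf[OF null, of y U] by (simp add: trace_fun_def padic_power_def)
  hence "\<pi> ^ N dvd trace_fun \<phi> y (1 + of_nat CARD('p) * U) c t + c -
      (\<Sum>k<K. ?a k * alg_trace \<phi> (y * U ^ k))"
    by (rule adic_sums_partial) (intro dvd_mult2 prime_power_dvd_scaled_binomial p5 K)
  also have "\<dots> = trace_fun \<phi> y (1 + of_nat CARD('p) * U) c t - poly (partial_trace_poly y U c K) t"
    by (simp add: partial_trace_poly_def poly_sum mult.commute)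
  finally show ?thesis .
qed

lemma restricted_trace_fps:
  assumes "CARD('p) \<ge> 5"
  shows "trace_fps \<phi> y U c \<in> restricted_fps"
  unfolding restricted_fps_iff_approx
proof
  fix N :: nat
  have "N \<le> k - (k - 1) div 4" if "k \<ge> 2 * N" for k using that by simp
  thus "\<exists>h. fps_const (\<pi> ^ N) dvd trace_fps \<phi> y U c - fps_of_poly h"
    using trace_fps_approx[OF assms] by blast
qed

lemma rps_eval_trace_fps:
  assumes "CARD('p) \<ge> 5"
  shows "rps_eval (trace_fps \<phi> y U c) t = trace_fun \<phi> y (1 + of_nat CARD('p) * U) c t"
proof (rule rps_eval_eqI[OF restricted_trace_fps[OF assms]])
  fix N :: nat
  have "N \<le> k - (k - 1) div 4" if "k \<ge> 2 * N" for k using that by simp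
  thus "\<exists>h. fps_const (\<pi> ^ N) dvd trace_fps \<phi> y U c - fps_of_poly h \<and>
      \<pi> ^ N dvd trace_fun \<phi> y (1 + of_nat CARD('p) * U) c t - poly h t"
    using trace_fps_approx[OF assms, of "2 * N" N] trace_fun_approx[OF assms, of "2 * N" N] by blast
qed

end

section \<open>Binomial polynomials of degree below p\<close>

lemma of_nat_fact_mod_ring_nonzero:
  assumes "k < CARD('p::prime_card)"
  shows "(of_nat (fact k) :: 'p mod_ring) \<noteq> 0"
proof -
  have "\<not> CARD('p) dvd fact k"
    using assms prime_dvd_fact_iff[OF prime_card[where 'a = 'p]] by simp
  thus ?thesis using of_nat_0_mod_ring_dvd[where 'a = 'p] by blast
qed

text \<open>For k < p the factorial is a unit, so the full power p^k splits off; \<open>w\<close> is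
  the inverse of k! and reduces to the scalar in \<open>binomial_poly\<close>.\<close>

lemma scaled_binomial_poly_below_prime:
  assumes "k < CARD('p::prime_card)"
  obtains w where "scaled_binomial_poly k =
      Polynomial.smult (\<pi> ^ k * w) (\<Prod>i<k. [:- of_nat i, 1 :: 'p padic_int:])"
    "padic_residue w = inverse (of_nat (fact k))"
proof -
  have nz: "(of_nat (fact k) :: 'p mod_ring) \<noteq> 0"
    by (rule of_nat_fact_mod_ring_nonzero[OF assms])
  have res: "padic_residue (fact k :: 'p padic_int) = of_nat (fact k)"
    using padic_residue.hom_of_nat[of "fact k"] by simp
  hence "(fact k :: 'p padic_int) dvd 1" using nz by (simp add: padic_unit_iff)
  then obtain w where w: "1 = (fact k :: 'p padic_int) * w" by auto
  have "\<pi> ^ k div fact k = (fact k * (\<pi> ^ k * w)) div fact k"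
    using w by (metis mult.left_commute mult_1_right)
  hence "\<pi> ^ k div fact k = \<pi> ^ k * w" by simp
  moreover have "of_nat (fact k) * padic_residue w = (1 :: 'p mod_ring)"
    using w res by (metis padic_residue.hom_mult padic_residue.hom_one)
  hence "padic_residue w = inverse (of_nat (fact k))"
    by (metis inverse_unique)
  ultimately show ?thesis by (intro that) (simp_all add: scaled_binomial_poly_def)
qed

lemma map_poly_residue_falling:
  "map_poly padic_residue (\<Prod>i<k. [:- of_nat i, 1:]) = (\<Prod>i<k. [:- of_nat i, 1:])"
proof -
  interpret map_poly_comm_ring_hom padic_residue ..
  show ?thesis
    unfolding hom_prod
    by (intro prod.cong refl)
      (simp add: padic_residue.map_poly_pCons_hom padic_residue.hom_uminus padic_residue.hom_of_nat)
qed


section \<open>Zeros in a residue disk\<close>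

text \<open>One digit of precision beyond p^m is exactly what determines the quotient by p^m modulo
  p.\<close>

lemma restricted_divide_prime_power:
  assumes f: "f \<in> restricted_fps"
    and h: "fps_const (\<pi> ^ Suc m) dvd f - fps_of_poly (Polynomial.smult (\<pi> ^ m) h)"
  shows "\<exists>G\<in>restricted_fps. f = fps_const (\<pi> ^ m) * G \<and>
    rps_residue G = fps_of_poly (map_poly padic_residue h)"
proof -
  obtain g where "f - fps_of_poly (Polynomial.smult (\<pi> ^ m) h) = fps_const (\<pi> ^ Suc m) * g"
    using h by auto
  moreover have "fps_const (\<pi> ^ Suc m) = fps_const (\<pi> ^ m) * (fps_const \<pi> :: 'a padic_int fps)"
    by (simp add: mult.commute)
  ultimately have eq: "f = fps_const (\<pi> ^ m) * (fps_of_poly h + fps_const \<pi> * g)"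
    by (simp add: fps_of_poly_smult algebra_simps)
  moreover have "fps_of_poly h + fps_const \<pi> * g \<in> restricted_fps"
    using f unfolding eq by (rule restricted_cancel)
  moreover have "rps_residue (fps_of_poly h + fps_const \<pi> * g) = rps_residue (fps_of_poly h)"
    unfolding rps_residue_eq_iff by simp
  ultimately show ?thesis unfolding rps_residue_of_poly by blast
qed

text \<open>The disk is the residue class of \<open>r\<close>, recentred at its least
  representative. The order of \<open>R\<close> at \<open>r\<close> is meaningful because
  \<open>R\<close> is nonzero.\<close>

locale residue_disk =
  fixes G :: "'p::prime_card padic_int fps" and R :: "'p mod_ring poly" and r :: "'p mod_ring"
  assumes restricted: "G \<in> restricted_fps" and residue: "rps_residue G = fps_of_poly R"
    and nonzero: "R \<noteq> 0"
begin

abbreviation centred :: "'p padic_int fps" where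
  "centred \<equiv> rps_shift (least_rep r) G"

lemma centred_restricted: "centred \<in> restricted_fps"
  by (rule restricted_rps_shift[OF restricted])

lemma centred_residue: "rps_residue centred = fps_of_poly (pcompose R [:r, 1:])"
  using rps_residue_shift[OF restricted residue, of "least_rep r"] by simp

text \<open>Translation carries X - r to X, so the multiplicity of the root becomes the exponent in
  the shape of reduction on which the local factors rest.\<close>

lemma translate_order:
  obtains Q where "pcompose R [:r, 1:] = [:0, 1:] ^ Polynomial.order r R * Q" "poly Q 0 \<noteq> 0"
proof -
  obtain q where q: "R = [:- r, 1:] ^ Polynomial.order r R * q" "\<not> [:- r, 1:] dvd q"
    using order_decomp[OF nonzero] by blast
  have "pcompose R [:r, 1:] = pcompose ([:- r, 1:] ^ Polynomial.order r R * q) [:r, 1:]"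
    using q(1) by simp
  also have "\<dots> = [:0, 1:] ^ Polynomial.order r R * pcompose q [:r, 1:]"
    by (simp add: pcompose_mult pcompose_hom.hom_power pcompose_pCons)
  finally have "pcompose R [:r, 1:] = [:0, 1:] ^ Polynomial.order r R * pcompose q [:r, 1:]" .
  moreover have "poly (pcompose q [:r, 1:]) 0 \<noteq> 0"
    using q(2) unfolding poly_eq_0_iff_dvd[symmetric] by (simp add: poly_pcompose)
  ultimately show ?thesis by (rule that)
qed

lemma centred_eval: "rps_eval centred (t - least_rep r) = rps_eval G t"
  by (simp add: rps_eval_shift[OF restricted])

lemma local_factor_zeros_in_disk:
  assumes H: "local_factor (Polynomial.order r R) centred H"
  shows "{t. \<pi> dvd t - least_rep r \<and> rps_eval G t = 0} =
    {least_rep r + Y | Y. \<pi> dvd Y \<and> rps_eval H Y = 0}"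
proof -
  obtain Q where Q: "pcompose R [:r, 1:] = [:0, 1:] ^ Polynomial.order r R * Q" "poly Q 0 \<noteq> 0"
    by (rule translate_order)
  obtain V where V: "\<And>t. rps_eval centred t = rps_eval H t * rps_eval V t"
    "\<And>t. \<pi> dvd t \<Longrightarrow> \<not> \<pi> dvd rps_eval V t"
    using local_factor_zeros[OF centred_residue[unfolded Q(1)] Q(2) H] by blast
  have iff: "rps_eval G t = 0 \<longleftrightarrow> rps_eval H (t - least_rep r) = 0"
    if "\<pi> dvd t - least_rep r" for t
  proof -
    have "rps_eval V (t - least_rep r) \<noteq> 0" using V(2)[OF that] by auto
    thus ?thesis using V(1)[of "t - least_rep r"] by (simp add: centred_eval)
  qed
  show ?thesis
  proof (intro equalityI subsetI)
    fix t assume "t \<in> {t. \<pi> dvd t - least_rep r \<and> rps_eval G t = 0}"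
    thus "t \<in> {least_rep r + Y | Y. \<pi> dvd Y \<and> rps_eval H Y = 0}"
      using iff[of t] by (auto intro!: exI[of _ "t - least_rep r"])
  next
    fix t assume "t \<in> {least_rep r + Y | Y. \<pi> dvd Y \<and> rps_eval H Y = 0}"
    then obtain Y where "t = least_rep r + Y" "\<pi> dvd Y" "rps_eval H Y = 0" by blast
    thus "t \<in> {t. \<pi> dvd t - least_rep r \<and> rps_eval G t = 0}"
      using iff[of t] by simp
  qed
qed

text \<open>A monic local factor of degree one is Y + k with k divisible by p, so \<tau> is
  \<open>least_rep r - k\<close>. Writing the value as t - \<tau> times a unit yields existence,
  uniqueness and the valuation formula together.\<close>

lemma simple_root_branch:
  assumes "Polynomial.order r R = 1"
  obtains \<tau> where "padic_residue \<tau> = r"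
    "\<And>t. padic_residue t = r \<Longrightarrow> \<exists>v. \<not> \<pi> dvd v \<and> rps_eval G t = (t - \<tau>) * v"
proof -
  obtain Q where Q: "pcompose R [:r, 1:] = [:0, 1:] ^ 1 * Q" "poly Q 0 \<noteq> 0"
    using translate_order unfolding assms .
  note res = centred_residue[unfolded Q(1)]
  obtain h where h: "monic h" "degree h = 1" "local_factor 1 centred (fps_of_poly h)"
    using monic_local_factor_exists[OF centred_restricted res Q(2)] by blast
  obtain V where V: "\<And>t. rps_eval centred t = poly h t * rps_eval V t"
    "\<And>t. \<pi> dvd t \<Longrightarrow> \<not> \<pi> dvd rps_eval V t"
    using local_factor_zeros[OF res Q(2) h(3)] by auto
  obtain k where k: "h = [:k, 1:]"
    using h(1,2) by (metis coeff_pCons_0 coeff_pCons_Suc degree1_coeffs One_nat_def)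
  have "map_poly padic_residue h = [:0, 1:] ^ 1"
    using h(3) monic_local_factor_residue[OF h(1,2)] unfolding local_factor_def by blast
  hence "padic_residue k = 0"
    using arg_cong[of "map_poly padic_residue h" _ "\<lambda>q. poly.coeff q 0"] by (simp add: k)
  show ?thesis
  proof (rule that[of "least_rep r - k"])
    show "padic_residue (least_rep r - k) = r"
      using \<open>padic_residue k = 0\<close> by (simp add: padic_residue.hom_minus)
    fix t :: "'p padic_int" assume "padic_residue t = r"
    hence "\<pi> dvd t - least_rep r" by (simp flip: padic_residue_eq_iff)
    moreover have "rps_eval G t = (t - (least_rep r - k)) * rps_eval V (t - least_rep r)"
      using V(1)[of "t - least_rep r"] by (simp add: centred_eval k algebra_simps)
    ultimately show "\<exists>v. \<not> \<pi> dvd v \<and> rps_eval G t = (t - (least_rep r - k)) * v"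
      using V(2) by blast
  qed
qed

text \<open>Modulo p the derivative at a simple root is the value of the complementary factor of
  \<open>R\<close>, which does not vanish there.\<close>

lemma simple_root_deriv:
  assumes "Polynomial.order r R = 1" "padic_residue \<tau> = r"
  shows "rps_eval (fps_deriv G) \<tau> \<noteq> 0"
proof -
  obtain q where q: "R = [:- r, 1:] ^ 1 * q" "\<not> [:- r, 1:] dvd q"
    using order_decomp[OF nonzero, of r] unfolding assms by blast
  have "padic_residue (rps_eval (fps_deriv G) \<tau>) = poly (pderiv R) r"
    using padic_residue_rps_eval[OF restricted_fps_deriv[OF restricted] rps_residue_deriv[OF residue]]
    by (simp add: assms)
  also have "\<dots> = poly q r"
    unfolding q(1) power_one_right pderiv_mult by (simp add: pderiv_pCons)
  finally have "padic_residue (rps_eval (fps_deriv G) \<tau>) \<noteq> 0"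
    using q(2) by (simp add: poly_eq_0_iff_dvd)
  thus ?thesis by auto
qed

end


section \<open>The trace series at a critical class\<close>

text \<open>A local factor is determined only up to units, so uniqueness is expressed twice: up to a
  unit of the ring of restricted series, and exactly after normalisation to a monic polynomial of
  degree \<open>e\<close>. That a branch is simple is expressed by a nonvanishing derivative at
  \<tau>.\<close>

theorem theorem3p21:
  fixes \<phi> :: "'p::prime_card padic_int \<Rightarrow> 'a::comm_ring_1"
    and p :: "'p padic_int"
    and \<eta> \<gamma> U y :: 'a
    and c :: "'p padic_int"
    and P a :: nat
    and \<omega> x :: "('p, 'a) modp"
    and \<alpha> \<beta> \<delta>\<^sub>0 s :: "'p mod_ring"
    and z :: "nat \<Rightarrow> ('p, 'a) modp"
    and C :: "nat \<Rightarrow> 'p padic_int"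
    and F :: "'p padic_int \<Rightarrow> 'p padic_int"
    and FX :: "'p padic_int fps"
  assumes p: "p = of_nat CARD('p)" "CARD('p) \<ge> 5"
    and A: "finite_etale 3 \<phi>"
    and \<eta>: "\<eta> dvd 1"
    and P: "P = mult_order (reduce \<eta> :: ('p, 'a) modp)"
    and U: "\<eta> ^ P = 1 + of_nat CARD('p) * U"
    and \<omega>: "\<omega> = reduce U"
    and gen: "generates_algebra of_fp \<omega>"
    and f\<omega>: "alg_char_poly of_fp \<omega> = [:\<delta>\<^sub>0, \<beta>, \<alpha>, 1:]"
    and \<omega>_unit: "\<omega> dvd 1"
    and a: "a < P"
    and y: "y = \<gamma> * \<eta> ^ a"
    and C: "\<And>m. C m = alg_trace \<phi> (y * U ^ m)"
    and F: "F = trace_fun \<phi> y (\<eta> ^ P) c"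
    and FX: "FX = trace_fps \<phi> y U c"
    and z: "\<And>i j. i < 3 \<Longrightarrow> j < 3 \<Longrightarrow>
              alg_trace of_fp (\<omega> ^ i * z j) = (if i = j then 1 else 0)"
    and x: "x = reduce y" "x = of_fp s * z 0"
    and s: "s = padic_residue c" "s \<noteq> 0"
  shows
    "alg_basis (of_fp :: 'p mod_ring \<Rightarrow> ('p, 'a) modp) [1, \<omega>, \<omega>\<^sup>2] \<and>
     alg_norm of_fp \<omega> = - \<delta>\<^sub>0 \<and> alg_norm of_fp \<omega> \<noteq> 0 \<and>
     FX \<in> restricted_fps \<and> (\<forall>t. rps_eval FX t = F t) \<and>
     alg_trace of_fp (x * \<omega>) = 0 \<and>
     alg_trace of_fp (x * \<omega>\<^sup>2) = 0 \<and>
     alg_trace of_fp (x * \<omega> ^ 3) = s * alg_norm of_fp \<omega> \<and>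
     s * alg_norm of_fp \<omega> \<noteq> 0 \<and>
     (p ^ 3 dvd C 0 - c \<and> p\<^sup>2 dvd C 1 \<and> p dvd C 2 \<longrightarrow>
       (let A3 = padic_residue ((C 0 - c) div p ^ 3);
            B3 = padic_residue (C 1 div p\<^sup>2);
            D3 = padic_residue (C 2 div p);
            R = [:A3:] + Polynomial.smult B3 [:0, 1:] + Polynomial.smult D3 (binomial_poly 2)
                  + Polynomial.smult (s * alg_norm of_fp \<omega>) (binomial_poly 3)
        in
          (\<exists>G\<in>restricted_fps. FX = fps_const (p ^ 3) * G \<and> rps_residue G = fps_of_poly R) \<and>
          (\<forall>u. \<exists>G\<in>restricted_fps. rps_shift u FX = fps_const (p ^ 3) * G) \<and>
          (\<forall>t. p ^ 4 dvd F t \<longleftrightarrow> poly R (padic_residue t) = 0) \<and>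
          {padic_residue t | t. p ^ 4 dvd F t} = {r. poly R r = 0} \<and>
          (\<forall>r. poly R r = 0 \<and> Polynomial.order r R = 1 \<longrightarrow>
            (\<exists>!\<tau>. padic_residue \<tau> = r \<and> F \<tau> = 0) \<and>
            (\<forall>\<tau>. padic_residue \<tau> = r \<and> F \<tau> = 0 \<longrightarrow>
              rps_eval (fps_deriv FX) \<tau> \<noteq> 0 \<and>
              (\<forall>t. padic_residue t = r \<longrightarrow> padic_val (F t) = 3 + padic_val (t - \<tau>)))) \<and>
          (\<forall>r e. poly R r = 0 \<and> Polynomial.order r R = e \<and> e \<ge> 2 \<longrightarrow>
            (\<exists>G\<in>restricted_fps.
              rps_shift (least_rep r) FX = fps_const (p ^ 3) * G \<and>
              rps_residue G = fps_of_poly (pcompose R [:r, 1:]) \<and>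
              (\<exists>Q. pcompose R [:r, 1:] = [:0, 1:] ^ e * Q \<and> poly Q 0 \<noteq> 0) \<and>
              (\<exists>!h. monic h \<and> degree h = e \<and> local_factor e G (fps_of_poly h)) \<and>
              (\<forall>H H'. local_factor e G H \<and> local_factor e G H' \<longrightarrow>
                (\<exists>W. rps_unit W \<and> H' = W * H)) \<and>
              (\<forall>H. local_factor e G H \<longrightarrow>
                {t. p dvd t - least_rep r \<and> F t = 0}
                  = {least_rep r + Y | Y. p dvd Y \<and> rps_eval H Y = 0})))))"
proof -
  note p5 = p(2)
  obtain es where "comm_ring_hom \<phi>" "alg_basis \<phi> es" using A unfolding finite_etale_def by blast
  then interpret padic_algebra \<phi> es
    unfolding padic_algebra_def free_algebra_def free_algebra_axioms_def by blast
  interpret cubic: cubic_generator of_fp "map reduce es" \<omega> "[:\<delta>\<^sub>0, \<beta>, \<alpha>, 1:]" z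
    by (rule cubic_generator.intro) (use reduced_free_algebra f\<omega> z in auto)
  define n where "n = alg_norm of_fp \<omega>"
  have norm: "n = - \<delta>\<^sub>0" "n \<noteq> 0"
    using cubic.alg_norm_char_poly cubic.alg_norm_nonzero[OF \<omega>_unit] by (simp_all add: n_def)
  \<comment> \<open>Since \<open>x\<close> is a multiple of \<open>z 0\<close>, its traces against
    powers of \<omega> are \<open>s\<close> times those of the dual vector, which vanish for the
    exponents 1 and 2.\<close>
  have trace_x: "alg_trace of_fp (x * \<omega> ^ i) = s * alg_trace of_fp (z 0 * \<omega> ^ i)" for i
    unfolding x(2) mult.assoc by (rule cubic.alg_trace_scale)
  have x1: "alg_trace of_fp (x * \<omega>) = 0"
    using trace_x[of 1] z[of 1 0] by (simp add: mult.commute)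
  have x2: "alg_trace of_fp (x * \<omega>\<^sup>2) = 0"
    using trace_x[of 2] z[of 2 0] by (simp add: mult.commute)
  have x3: "alg_trace of_fp (x * \<omega> ^ 3) = s * n"
    using trace_x[of 3] by (simp only: cubic.alg_trace_dual_cube n_def)
  have FX_restricted: "FX \<in> restricted_fps"
    unfolding FX by (rule restricted_trace_fps[OF p5])
  have F_eval: "rps_eval FX t = F t" for t
    unfolding FX F U by (rule rps_eval_trace_fps[OF p5])
  \<comment> \<open>\<open>C 3\<close> carries no divisibility assumption: its residue is the
    nonzero trace of x * \<omega>^3.\<close>
  have C3: "padic_residue (C 3) = s * n"
    using alg_trace_reduce[of "y * U ^ 3"] x3
    by (simp add: C x(1) \<omega> reduce.hom_mult reduce.hom_power)

  have main: "(let A3 = padic_residue ((C 0 - c) div p ^ 3);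
            B3 = padic_residue (C 1 div p\<^sup>2);
            D3 = padic_residue (C 2 div p);
            R = [:A3:] + Polynomial.smult B3 [:0, 1:] + Polynomial.smult D3 (binomial_poly 2)
                  + Polynomial.smult (s * n) (binomial_poly 3)
        in
          (\<exists>G\<in>restricted_fps. FX = fps_const (p ^ 3) * G \<and> rps_residue G = fps_of_poly R) \<and>
          (\<forall>u. \<exists>G\<in>restricted_fps. rps_shift u FX = fps_const (p ^ 3) * G) \<and>
          (\<forall>t. p ^ 4 dvd F t \<longleftrightarrow> poly R (padic_residue t) = 0) \<and>
          {padic_residue t | t. p ^ 4 dvd F t} = {r. poly R r = 0} \<and>
          (\<forall>r. poly R r = 0 \<and> Polynomial.order r R = 1 \<longrightarrow>
            (\<exists>!\<tau>. padic_residue \<tau> = r \<and> F \<tau> = 0) \<and>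
            (\<forall>\<tau>. padic_residue \<tau> = r \<and> F \<tau> = 0 \<longrightarrow>
              rps_eval (fps_deriv FX) \<tau> \<noteq> 0 \<and>
              (\<forall>t. padic_residue t = r \<longrightarrow> padic_val (F t) = 3 + padic_val (t - \<tau>)))) \<and>
          (\<forall>r e. poly R r = 0 \<and> Polynomial.order r R = e \<and> e \<ge> 2 \<longrightarrow>
            (\<exists>G\<in>restricted_fps.
              rps_shift (least_rep r) FX = fps_const (p ^ 3) * G \<and>
              rps_residue G = fps_of_poly (pcompose R [:r, 1:]) \<and>
              (\<exists>Q. pcompose R [:r, 1:] = [:0, 1:] ^ e * Q \<and> poly Q 0 \<noteq> 0) \<and>
              (\<exists>!h. monic h \<and> degree h = e \<and> local_factor e G (fps_of_poly h)) \<and>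
              (\<forall>H H'. local_factor e G H \<and> local_factor e G H' \<longrightarrow>
                (\<exists>W. rps_unit W \<and> H' = W * H)) \<and>
              (\<forall>H. local_factor e G H \<longrightarrow>
                {t. p dvd t - least_rep r \<and> F t = 0}
                  = {least_rep r + Y | Y. p dvd Y \<and> rps_eval H Y = 0}))))"
    if dvd: "p ^ 3 dvd C 0 - c \<and> p\<^sup>2 dvd C 1 \<and> p dvd C 2"
  proof -
    define a b d where "a = (C 0 - c) div \<pi> ^ 3" and "b = C 1 div \<pi>\<^sup>2" and "d = C 2 div \<pi>"
    have abd: "C 0 - c = \<pi> ^ 3 * a" "C 1 = \<pi>\<^sup>2 * b" "C 2 = \<pi> * d"
      using dvd unfolding a_def b_def d_def p(1) by auto
    define R where "R = [:padic_residue a:] + Polynomial.smult (padic_residue b) [:0, 1:]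
      + Polynomial.smult (padic_residue d) (binomial_poly 2)
      + Polynomial.smult (s * n) (binomial_poly 3)"
    let ?E = "\<lambda>k. (\<Prod>i<k. [:- of_nat i, 1 :: 'p padic_int:])"
    obtain w2 where w2: "scaled_binomial_poly 2 = Polynomial.smult (\<pi>\<^sup>2 * w2) (?E 2)"
      "padic_residue w2 = inverse (of_nat (fact 2))"
      by (rule scaled_binomial_poly_below_prime[where 'p = 'p and k = 2]) (use p5 in simp)
    obtain w3 where w3: "scaled_binomial_poly 3 = Polynomial.smult (\<pi> ^ 3 * w3) (?E 3)"
      "padic_residue w3 = inverse (of_nat (fact 3))"
      by (rule scaled_binomial_poly_below_prime[where 'p = 'p and k = 3]) (use p5 in simp)
    \<comment> \<open>\<open>h\<close> is the sum of the first four terms divided by p^3: the k-th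
      term brings its own p^k, and the divisibility of \<open>C 0 - c\<close>, \<open>C 1\<close>
      and \<open>C 2\<close> supplies the missing p^(3 - k).\<close>
    define h where "h = [:a:] + Polynomial.smult b [:0, 1:] + Polynomial.smult (d * w2) (?E 2)
      + Polynomial.smult (C 3 * w3) (?E 3)"
    have "partial_trace_poly y U c 4 = [:C 0 - c:] + Polynomial.smult (C 1) [:0, \<pi>:]
        + Polynomial.smult (C 2) (scaled_binomial_poly 2)
        + Polynomial.smult (C 3) (scaled_binomial_poly 3)"
    proof -
      have "scaled_binomial_poly 0 = (1 :: 'p padic_int poly)"
        "scaled_binomial_poly 1 = [:0, \<pi> :: 'p padic_int:]"
        by (simp_all add: scaled_binomial_poly_def)
      moreover have "(\<Sum>k<4. g k) = g 0 + g 1 + g 2 + g 3" for g :: "nat \<Rightarrow> 'p padic_int poly"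
        by (simp add: numeral_eq_Suc)
      moreover have "[:C 0 - c:] = Polynomial.smult (C 0) 1 - [:c:]" by simp
      ultimately show ?thesis
        by (simp only: partial_trace_poly_def C[symmetric]) (simp only: diff_conv_add_uminus ac_simps)
    qed
    also have "\<dots> = Polynomial.smult (\<pi> ^ 3) h"
    proof -
      have "Polynomial.smult (C 1) [:0, \<pi>:] = Polynomial.smult (\<pi> ^ 3) (Polynomial.smult b [:0, 1:])"
        unfolding abd(2) by (simp add: power3_eq_cube power2_eq_square)
      moreover have "C 2 * (\<pi>\<^sup>2 * w2) = \<pi> ^ 3 * (d * w2)"
        by (simp add: abd power3_eq_cube power2_eq_square)
      moreover have "C 3 * (\<pi> ^ 3 * w3) = \<pi> ^ 3 * (C 3 * w3)" by simp
      ultimately show ?thesis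
        by (simp only: h_def w2(1) w3(1) smult_add_right smult_smult abd(1)) simp
    qed
    finally have partial: "partial_trace_poly y U c 4 = Polynomial.smult (\<pi> ^ 3) h" .
    have h_residue: "map_poly padic_residue h = R"
      unfolding h_def R_def binomial_poly_def
      by (simp only: padic_residue.map_poly_hom_add padic_residue.map_poly_hom_smult
          map_poly_residue_falling padic_residue.hom_mult w2(2) w3(2) C3 smult_smult
          padic_residue.map_poly_pCons_hom padic_residue.hom_zero padic_residue.hom_one map_poly_0)
    \<comment> \<open>Four terms suffice for precision 4, one digit beyond the p^3 that is divided
      out.\<close>
    have "4 \<le> k - (k - 1) div 4" if "k \<ge> 4" for k :: nat using that by simp
    hence "fps_const (\<pi> ^ 4) dvd FX - fps_of_poly (Polynomial.smult (\<pi> ^ 3) h)"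
      unfolding FX partial[symmetric] by (rule trace_fps_approx[OF p5])
    then obtain G where G: "G \<in> restricted_fps" "FX = fps_const (\<pi> ^ 3) * G"
      "rps_residue G = fps_of_poly R"
      using restricted_divide_prime_power[OF FX_restricted, of 3 h] unfolding h_residue by auto
    have FG: "F t = \<pi> ^ 3 * rps_eval G t" for t
      using F_eval[of t] G by (simp add: rps_eval_mult)
    have F0: "F t = 0 \<longleftrightarrow> rps_eval G t = 0" for t by (simp add: FG)
    \<comment> \<open>The cubic coefficient is s * n / 6, and 6 is invertible because p exceeds
      3.\<close>
    have R_nonzero: "R \<noteq> 0"
    proof -
      have "poly.coeff R 3 = s * n * inverse (of_nat (fact 3))"
        by (simp add: R_def binomial_poly_def numeral_3_eq_3 numeral_2_eq_2 del: fact_Suc)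
      moreover have "of_nat (fact 3) \<noteq> (0 :: 'p mod_ring)"
        using p5 by (intro of_nat_fact_mod_ring_nonzero) simp
      ultimately have "poly.coeff R 3 \<noteq> 0" using s norm by simp
      thus ?thesis by auto
    qed
    have disk: "residue_disk G R" by unfold_locales (use G R_nonzero in auto)
    have p4: "\<forall>t. \<pi> ^ 4 dvd F t \<longleftrightarrow> poly R (padic_residue t) = 0"
    proof
      fix t
      have "\<pi> ^ 4 dvd F t \<longleftrightarrow> \<pi> ^ 3 * \<pi> dvd \<pi> ^ 3 * rps_eval G t"
        unfolding FG by (simp add: numeral_eq_Suc mult_ac)
      also have "\<dots> \<longleftrightarrow> padic_residue (rps_eval G t) = 0"
        by (simp add: padic_residue_eq_0_iff)
      finally show "\<pi> ^ 4 dvd F t \<longleftrightarrow> poly R (padic_residue t) = 0"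
        by (simp add: padic_residue_rps_eval[OF G(1,3)])
    qed
    have roots: "{padic_residue t | t. \<pi> ^ 4 dvd F t} = {r. poly R r = 0}"
    proof (intro equalityI subsetI)
      fix r assume "r \<in> {r. poly R r = 0}"
      \<comment> \<open>Every root of \<open>R\<close> is attained by its least
        representative.\<close>
      hence "\<pi> ^ 4 dvd F (least_rep r)" by (simp add: p4)
      thus "r \<in> {padic_residue t | t. \<pi> ^ 4 dvd F t}"
        by (intro CollectI exI[of _ "least_rep r"]) simp
    qed (auto simp: p4)
    have shift: "\<forall>u. \<exists>G\<in>restricted_fps. rps_shift u FX = fps_const (\<pi> ^ 3) * G"
      unfolding G(2) using rps_shift_const_mult[OF G(1)] restricted_rps_shift[OF G(1)] by blast
    have simple: "\<forall>r. poly R r = 0 \<and> Polynomial.order r R = 1 \<longrightarrow>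
        (\<exists>!\<tau>. padic_residue \<tau> = r \<and> F \<tau> = 0) \<and>
        (\<forall>\<tau>. padic_residue \<tau> = r \<and> F \<tau> = 0 \<longrightarrow>
          rps_eval (fps_deriv FX) \<tau> \<noteq> 0 \<and>
          (\<forall>t. padic_residue t = r \<longrightarrow> padic_val (F t) = 3 + padic_val (t - \<tau>)))"
    proof (intro allI impI, elim conjE)
      fix r assume order: "Polynomial.order r R = 1"
      interpret residue_disk G R r by (rule disk)
      obtain \<tau> where \<tau>: "padic_residue \<tau> = r"
        "\<And>t. padic_residue t = r \<Longrightarrow> \<exists>v. \<not> \<pi> dvd v \<and> rps_eval G t = (t - \<tau>) * v"
        using simple_root_branch[OF order] by blast
      have zero: "F t = 0 \<longleftrightarrow> t = \<tau>" if "padic_residue t = r" for t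
        using \<tau>(2)[OF that] by (auto simp: F0)
      have "fps_deriv FX = fps_const (\<pi> ^ 3) * fps_deriv G" by (simp add: G(2))
      hence "rps_eval (fps_deriv FX) \<tau> \<noteq> 0"
        using simple_root_deriv[OF order \<tau>(1)] restricted_fps_deriv[OF G(1)]
        by (simp add: rps_eval_mult)
      moreover have "padic_val (F t) = 3 + padic_val (t - \<tau>)" if t: "padic_residue t = r" for t
      proof -
        obtain v where "\<not> \<pi> dvd v" "rps_eval G t = (t - \<tau>) * v" using \<tau>(2)[OF t] by blast
        thus ?thesis using padic_val_shift[of v 3 "t - \<tau>"] by (simp add: FG numeral_eq_enat)
      qed
      ultimately show "(\<exists>!\<tau>. padic_residue \<tau> = r \<and> F \<tau> = 0) \<and>
        (\<forall>\<tau>. padic_residue \<tau> = r \<and> F \<tau> = 0 \<longrightarrow>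
          rps_eval (fps_deriv FX) \<tau> \<noteq> 0 \<and>
          (\<forall>t. padic_residue t = r \<longrightarrow> padic_val (F t) = 3 + padic_val (t - \<tau>)))"
        using zero \<tau>(1) by metis
    qed
    have multiple: "\<forall>r e. poly R r = 0 \<and> Polynomial.order r R = e \<and> e \<ge> 2 \<longrightarrow>
            (\<exists>G\<in>restricted_fps.
              rps_shift (least_rep r) FX = fps_const (\<pi> ^ 3) * G \<and>
              rps_residue G = fps_of_poly (pcompose R [:r, 1:]) \<and>
              (\<exists>Q. pcompose R [:r, 1:] = [:0, 1:] ^ e * Q \<and> poly Q 0 \<noteq> 0) \<and>
              (\<exists>!h. monic h \<and> degree h = e \<and> local_factor e G (fps_of_poly h)) \<and>
              (\<forall>H H'. local_factor e G H \<and> local_factor e G H' \<longrightarrow>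
                (\<exists>W. rps_unit W \<and> H' = W * H)) \<and>
              (\<forall>H. local_factor e G H \<longrightarrow>
                {t. \<pi> dvd t - least_rep r \<and> F t = 0}
                  = {least_rep r + Y | Y. \<pi> dvd Y \<and> rps_eval H Y = 0}))"
    proof (intro allI impI, elim conjE)
      fix r e assume order: "Polynomial.order r R = e"
      interpret residue_disk G R r by (rule disk)
      obtain Q where Q: "pcompose R [:r, 1:] = [:0, 1:] ^ e * Q" "poly Q 0 \<noteq> 0"
        using translate_order unfolding order .
      note res = centred_residue[unfolded Q(1)]
      show "\<exists>G\<in>restricted_fps.
              rps_shift (least_rep r) FX = fps_const (\<pi> ^ 3) * G \<and>
              rps_residue G = fps_of_poly (pcompose R [:r, 1:]) \<and>
              (\<exists>Q. pcompose R [:r, 1:] = [:0, 1:] ^ e * Q \<and> poly Q 0 \<noteq> 0) \<and>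
              (\<exists>!h. monic h \<and> degree h = e \<and> local_factor e G (fps_of_poly h)) \<and>
              (\<forall>H H'. local_factor e G H \<and> local_factor e G H' \<longrightarrow>
                (\<exists>W. rps_unit W \<and> H' = W * H)) \<and>
              (\<forall>H. local_factor e G H \<longrightarrow>
                {t. \<pi> dvd t - least_rep r \<and> F t = 0}
                  = {least_rep r + Y | Y. \<pi> dvd Y \<and> rps_eval H Y = 0})"
      \<comment> \<open>The witness is \<open>G\<close> recentred in the disk; translation commutes
        with the scalar p^3.\<close>
      proof (intro bexI[of _ centred] conjI)
        show "rps_shift (least_rep r) FX = fps_const (\<pi> ^ 3) * centred"
          unfolding G(2) by (rule rps_shift_const_mult[OF G(1)])
        show "rps_residue centred = fps_of_poly (pcompose R [:r, 1:])" by (rule centred_residue)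
        show "\<exists>Q. pcompose R [:r, 1:] = [:0, 1:] ^ e * Q \<and> poly Q 0 \<noteq> 0" using Q by blast
        show "\<exists>!h. monic h \<and> degree h = e \<and> local_factor e centred (fps_of_poly h)"
          using monic_local_factor_exists[OF centred_restricted res Q(2)]
            monic_local_factor_unique[OF res Q(2)] by blast
        show "\<forall>H H'. local_factor e centred H \<and> local_factor e centred H' \<longrightarrow>
            (\<exists>W. rps_unit W \<and> H' = W * H)"
          using local_factor_unique_up_to_unit[OF res Q(2)] by blast
        show "\<forall>H. local_factor e centred H \<longrightarrow>
            {t. \<pi> dvd t - least_rep r \<and> F t = 0} =
            {least_rep r + Y | Y. \<pi> dvd Y \<and> rps_eval H Y = 0}"
          using local_factor_zeros_in_disk unfolding order F0 by blast
        show "centred \<in> restricted_fps" by (rule centred_restricted)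
      qed
    qed
    have scaled: "\<exists>G\<in>restricted_fps. FX = fps_const (\<pi> ^ 3) * G \<and> rps_residue G = fps_of_poly R"
      using G by blast
    show ?thesis
      unfolding Let_def p(1) a_def[symmetric] b_def[symmetric] d_def[symmetric] R_def[symmetric]
      by (rule conjI[OF scaled conjI[OF shift conjI[OF p4
            conjI[OF roots conjI[OF simple multiple]]]]])
  qed
  have "s * n \<noteq> 0" using norm(2) s(2) by simp
  show ?thesis
    unfolding n_def[symmetric]
    by (rule conjI[OF cubic.alg_basis_powers conjI[OF norm(1) conjI[OF norm(2) conjI[OF FX_restricted
          conjI[OF allI[OF F_eval] conjI[OF x1 conjI[OF x2 conjI[OF x3
          conjI[OF \<open>s * n \<noteq> 0\<close> impI[OF main]]]]]]]]]])
qed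

end
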